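(* Let $L>0$, $h^*>0$, $g>0$, $\mu>0$, $\sigma>0$ and $\bar\kappa\ge 0$ be constants, let $c=\sqrt{gh^*}$, and let $\bar S=\{\varphi\in H^2(0,L):\varphi'(0)=\varphi'(L)=0\}$. Let $B,C\in\mathbb{R}$ be constants and let $\tilde r,\tilde p\in C^0([0,L])$ be given functions. Let $\phi_n(x)=\sqrt{2/L}\cos(n\pi x/L)$ for $n=1,2,\dots$ and $\tilde g(x):=x^3-\frac{3L}{2}x^2+\frac{L^3}{4}$ for $x\in[0,L]$. Suppose that $$\langle\tilde g,\tilde r\rangle\ge \frac{12L^4}{\pi^4}\sqrt{\frac{2}{L}}\sum_{n\ \mathrm{odd}}\frac{|\langle\phi_n,\tilde r\rangle|}{n^4},\qquad \langle\tilde g',\tilde p\rangle\ge \frac{12L^4}{\pi^4}\sqrt{\frac{2}{L}}\sum_{n\ \mathrm{odd}}\frac{|\langle\phi_n',\tilde p\rangle|}{n^4},$$ where the sums run over positive odd integers $n$. Then for every $(\xi_0,w_0)\in\mathbb{R}^2$, $\varphi_0\in\bar S\cap H^4(0,L)$, $u_0\in\bar S$ with $\int_0^L\varphi_0(x)\,dx=\int_0^L u_0(x)\,dx=0$ and $$\varphi_0'''(0)=\varphi_0'''(L)=-\sigma^{-1}\big(B\xi_0+Cw_0+\langle u_0,\tilde r\rangle+\langle\varphi_0',\tilde p\rangle\big),$$ there exist unique functions $\varphi\in C^0(\mathbb{R}_+;\bar S\cap H^4(0,L))\cap C^1(\mathbb{R}_+;\bar S)\cap C^2(\mathbb{R}_+;L^2(0,L))$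 and $(\xi,w)\in C^1(\mathbb{R}_+;\mathbb{R}^2)$ with $(\xi(0),w(0))=(\xi_0,w_0)$, $\varphi[0]=\varphi_0$, $\varphi_t[0]=u_0$, that satisfy for all $t\ge0$: $$\dot\xi=w,\qquad \dot w=-f,$$ $$\varphi_{tt}=c^2\varphi_{xx}-\sigma h^*\varphi_{xxxx}+\mu\varphi_{txx}-\bar\kappa\varphi_t \ \text{ on } (0,L),$$ $$\varphi_x(t,0)=\varphi_x(t,L)=0,\qquad \varphi_{xxx}(t,0)=\varphi_{xxx}(t,L)=-\sigma^{-1}f(t),$$ $$\int_0^L\varphi(t,x)\,dx=\int_0^L\varphi_t(t,x)\,dx=0,$$ where $f(t)=B\xi(t)+Cw(t)+\langle\varphi_t[t],\tilde r\rangle+\langle\varphi_x[t],\tilde p\rangle$.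
   Context: $\mathbb{R}_+=[0,+\infty)$. $\langle f,g\rangle=\int_0^L f(x)g(x)\,dx$ is the $L^2(0,L)$ scalar product. For a function $\varphi$ of $(t,x)$, $\varphi[t]$ denotes the profile $x\mapsto\varphi(t,x)$. For a normed space $Y$, $C^k(\mathbb{R}_+;Y)$ denotes $k$-times continuously differentiable maps $\mathbb{R}_+\to Y$; time derivatives (and mixed derivatives) are understood as derivatives of the maps $t\mapsto\varphi[t]$ (resp. $t\mapsto\varphi_{xx}[t]$) in the corresponding function spaces; $x$-derivatives are weak spatial derivatives. $H^k(0,L)$ is the usual Sobolev space. *)

theory Defs
  imports "HOL-Analysis.Analysis"
begin

text \<open>Profiles on (0,L) are represented by functions real => real; elements of
L2/Sobolev spaces are identified up to equality almost everywhere on [0,L].\<close>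

definition L2 :: "real \<Rightarrow> (real \<Rightarrow> real) \<Rightarrow> bool" where
  "L2 L f \<longleftrightarrow> f \<in> borel_measurable (lebesgue_on {0..L})
      \<and> integrable (lebesgue_on {0..L}) (\<lambda>x. (f x)^2)"

definition ip :: "real \<Rightarrow> (real \<Rightarrow> real) \<Rightarrow> (real \<Rightarrow> real) \<Rightarrow> real" where
  "ip L f g = (LINT x|lebesgue_on {0..L}. f x * g x)"

definition l2norm :: "real \<Rightarrow> (real \<Rightarrow> real) \<Rightarrow> real" where
  "l2norm L f = sqrt (LINT x|lebesgue_on {0..L}. (f x)^2)"

definition test_fun :: "real \<Rightarrow> (real \<Rightarrow> real) \<Rightarrow> bool" where
  "test_fun L \<psi> \<longleftrightarrow> (\<forall>k x. ((deriv ^^ k) \<psi>) differentiable (at x))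
      \<and> (\<exists>a b. 0 < a \<and> b < L \<and> (\<forall>x. x \<notin> {a..b} \<longrightarrow> \<psi> x = 0))"

definition weak_deriv :: "real \<Rightarrow> (real \<Rightarrow> real) \<Rightarrow> (real \<Rightarrow> real) \<Rightarrow> bool" where
  "weak_deriv L f g \<longleftrightarrow> integrable (lebesgue_on {0..L}) f \<and> integrable (lebesgue_on {0..L}) g
      \<and> (\<forall>\<psi>. test_fun L \<psi> \<longrightarrow> ip L f (deriv \<psi>) = - ip L g \<psi>)"

text \<open>A chosen weak derivative (unique up to a.e. equality when it exists).\<close>
definition wd :: "real \<Rightarrow> (real \<Rightarrow> real) \<Rightarrow> (real \<Rightarrow> real)" where
  "wd L f = (SOME g. weak_deriv L f g)"

definition inHk :: "real \<Rightarrow> nat \<Rightarrow> (real \<Rightarrow> real) \<Rightarrow> bool" where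
  "inHk L k f \<longleftrightarrow> (\<forall>j\<le>k. L2 L ((wd L ^^ j) f))
      \<and> (\<forall>j<k. weak_deriv L ((wd L ^^ j) f) ((wd L ^^ Suc j) f))"

definition hknorm :: "real \<Rightarrow> nat \<Rightarrow> (real \<Rightarrow> real) \<Rightarrow> real" where
  "hknorm L k f = sqrt (\<Sum>j\<le>k. (l2norm L ((wd L ^^ j) f))^2)"

definition bval :: "real \<Rightarrow> (real \<Rightarrow> real) \<Rightarrow> real \<Rightarrow> real" where
  "bval L f a = (THE y. \<exists>g. continuous_on {0..L} g
      \<and> (AE x in lebesgue_on {0..L}. f x = g x) \<and> g a = y)"

definition barS :: "real \<Rightarrow> (real \<Rightarrow> real) \<Rightarrow> bool" where
  "barS L f \<longleftrightarrow> inHk L 2 f \<and> bval L (wd L f) 0 = 0 \<and> bval L (wd L f) L = 0"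

definition mean0 :: "real \<Rightarrow> (real \<Rightarrow> real) \<Rightarrow> bool" where
  "mean0 L f \<longleftrightarrow> (LINT x|lebesgue_on {0..L}. f x) = 0"

definition cont_in :: "((real \<Rightarrow> real) \<Rightarrow> real) \<Rightarrow> (real \<Rightarrow> real \<Rightarrow> real) \<Rightarrow> bool" where
  "cont_in N \<phi> \<longleftrightarrow> (\<forall>t\<ge>0. ((\<lambda>s. N (\<lambda>x. \<phi> s x - \<phi> t x)) \<longlongrightarrow> 0) (at t within {0..}))"

definition tderiv_in :: "((real \<Rightarrow> real) \<Rightarrow> real) \<Rightarrow> (real \<Rightarrow> real \<Rightarrow> real) \<Rightarrow> (real \<Rightarrow> real \<Rightarrow> real) \<Rightarrow> bool" where
  "tderiv_in N \<phi> u \<longleftrightarrow> (\<forall>t\<ge>0.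
      ((\<lambda>s. N (\<lambda>x. (\<phi> s x - \<phi> t x) / (s - t) - u t x)) \<longlongrightarrow> 0) (at t within {0..}))"

definition phin :: "real \<Rightarrow> nat \<Rightarrow> real \<Rightarrow> real" where
  "phin L n x = sqrt (2 / L) * cos (real n * pi * x / L)"

definition gt :: "real \<Rightarrow> real \<Rightarrow> real" where
  "gt L x = x^3 - 3 * L / 2 * x^2 + L^3 / 4"

definition is_sol ::
  "real \<Rightarrow> real \<Rightarrow> real \<Rightarrow> real \<Rightarrow> real \<Rightarrow> real \<Rightarrow> real \<Rightarrow> real
   \<Rightarrow> (real \<Rightarrow> real) \<Rightarrow> (real \<Rightarrow> real) \<Rightarrow> real \<Rightarrow> real \<Rightarrow> (real \<Rightarrow> real) \<Rightarrow> (real \<Rightarrow> real)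
   \<Rightarrow> (real \<Rightarrow> real \<Rightarrow> real) \<Rightarrow> (real \<Rightarrow> real) \<Rightarrow> (real \<Rightarrow> real) \<Rightarrow> bool" where
  "is_sol L hs grav mu sig kappa B C r p \<xi>0 w0 \<phi>0 u0 \<phi> \<xi> w \<longleftrightarrow>
    (\<exists>u v. let c = sqrt (grav * hs);
              F = (\<lambda>t. B * \<xi> t + C * w t + ip L (u t) r + ip L (wd L (\<phi> t)) p) in
      (\<forall>t\<ge>0. barS L (\<phi> t) \<and> inHk L 4 (\<phi> t) \<and> barS L (u t) \<and> L2 L (v t))
      \<and> cont_in (hknorm L 4) \<phi> \<and> tderiv_in (hknorm L 2) \<phi> u \<and> cont_in (hknorm L 2) u
      \<and> tderiv_in (hknorm L 0) u v \<and> cont_in (hknorm L 0) v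
      \<and> (\<forall>t\<ge>0. (\<xi> has_real_derivative w t) (at t within {0..})
               \<and> (w has_real_derivative - F t) (at t within {0..}))
      \<and> continuous_on {0..} F
      \<and> \<xi> 0 = \<xi>0 \<and> w 0 = w0
      \<and> (AE x in lebesgue_on {0..L}. \<phi> 0 x = \<phi>0 x)
      \<and> (AE x in lebesgue_on {0..L}. u 0 x = u0 x)
      \<and> (\<forall>t\<ge>0.
           (AE x in lebesgue_on {0..L}.
              v t x = c^2 * (wd L ^^ 2) (\<phi> t) x - sig * hs * (wd L ^^ 4) (\<phi> t) x
                      + mu * (wd L ^^ 2) (u t) x - kappa * u t x)
         \<and> bval L (wd L (\<phi> t)) 0 = 0 \<and> bval L (wd L (\<phi> t)) L = 0
         \<and> bval L ((wd L ^^ 3) (\<phi> t)) 0 = - F t / sig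
         \<and> bval L ((wd L ^^ 3) (\<phi> t)) L = - F t / sig
         \<and> mean0 L (\<phi> t) \<and> mean0 L (u t)))"

end

theory Submission
  imports Defs
begin

text \<open>In the cosine basis the equation becomes a family of damped oscillators
  \<open>a'' + \<gamma> a' + \<omega> a = \<beta> f\<close> with \<open>\<gamma> = \<mu> \<lambda> + \<kappa>\<close>, \<open>\<omega> = c^2 \<lambda> + \<sigma> h \<lambda>^2\<close>, \<open>\<lambda> = (n \<pi> / L)^2\<close> and
  bounded \<open>\<beta>\<close>, coupled only through the scalar feedback \<open>f\<close>, which enters as a boundary value of
  \<open>\<phi>_xxx\<close>. Since the damping grows like \<open>n^2\<close>, every mode satisfies
  \<open>((a')^2 + \<omega> a^2)' \<le> K f^2\<close> with \<open>K\<close> summable over \<open>n\<close>; hence the total energy is controlled by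
  \<open>\<integral> f^2\<close>, while \<open>f^2\<close> is controlled by the energy. For the difference of two solutions this gives
  \<open>f^2 \<le> C \<integral> f^2\<close>, so Gronwall's inequality yields uniqueness. For existence the same estimate, applied
  to the time derivatives of the modes, makes the map \<open>f' \<mapsto> f'\<close> a Volterra map with a Picard fixed point;
  the compatibility conditions on the initial data say precisely that the initial accelerations are
  square summable. The solution is reassembled from its coefficients by Riesz-Fischer, with
  \<open>\<phi>\<close> obtained from \<open>\<phi>_xxxx\<close> by integrating four times, so that the boundary conditions hold.\<close>

section \<open>Square integrable functions on an interval\<close>

text \<open>The obstacle is that the feedback acts through a boundary value. Two integrations by
  parts against Neumann cosines turn it into a forcing with bounded coefficients that do not decay
  along odd modes, so it is not an L2 source; only the gain \<beta>^2 / (2 \<gamma>), of order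
  1/n^2, is summable. For the same reason \<omega> a and \<beta> f are not separately square
  summable, only the acceleration is. Hence phi_xxxx does not have the coefficients \<lambda>^2 a;
  it is found by solving the equation for it, and it is integrated with the boundary value - f /
  \<sigma> put in by hand. Time differentiation is forced by the regularity sought: H4 in space
  needs square summable accelerations, and these are part of the energy of the differentiated modes.
  The term <phi_x, p>, with p merely continuous, becomes <phi_xx, P> with P the primitive of - p
  vanishing at L; its weights grow with n but stay within what the energy \<omega> a^2 controls.
  Derivatives and boundary values are encoded by \<open>SOME\<close> and \<open>THE\<close>, so
  their uniqueness comes from a fundamental lemma proved with explicit test functions.\<close>

lemma finite_measure_interval: "finite_measure (lebesgue_on {0..L::real})"
  by (rule finite_measureI, cases "0 \<le> L") (simp_all add: emeasure_restrict_space)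

lemma atLeastAtMost_lebesgue: "{a..b::real} \<in> sets lebesgue"
  by simp

text \<open>Completeness of Lebesgue measure is the reason; extension by zero moves the claim from
  the interval to the whole line.\<close>

lemma borel_measurable_lebesgue_on_AE:
  fixes f g :: "real \<Rightarrow> real"
  assumes "f \<in> borel_measurable (lebesgue_on {0..L})" "AE x in lebesgue_on {0..L}. f x = g x"
  shows "g \<in> borel_measurable (lebesgue_on {0..L})"
proof -
  let ?r = "\<lambda>h x. if x \<in> {0..L} then h x else 0 :: real"
  have "?r f \<in> borel_measurable lebesgue"
    using assms(1) by (simp only: borel_measurable_if[OF atLeastAtMost_lebesgue])
  moreover have "AE x in lebesgue. ?r f x = ?r g x"
    using assms(2) by (subst (asm) AE_restrict_space_iff) (auto elim!: eventually_mono)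
  ultimately have "?r g \<in> borel_measurable lebesgue"
    by (rule borel_measurable_AE)
  thus ?thesis by (simp only: borel_measurable_if[OF atLeastAtMost_lebesgue])
qed

lemma L2_integrable: "L2 L f \<Longrightarrow> integrable (lebesgue_on {0..L}) f"
  using finite_measure.square_integrable_imp_integrable[OF finite_measure_interval]
  unfolding L2_def by blast

lemma L2_mult_integrable:
  assumes "L2 L f" "L2 L g"
  shows "integrable (lebesgue_on {0..L}) (\<lambda>x. f x * g x)"
proof (rule Bochner_Integration.integrable_bound)
  show "integrable (lebesgue_on {0..L}) (\<lambda>x. (f x)^2 + (g x)^2)"
    using assms unfolding L2_def by auto
  show "(\<lambda>x. f x * g x) \<in> borel_measurable (lebesgue_on {0..L})"
    using assms unfolding L2_def by auto
  show "AE x in lebesgue_on {0..L}. norm (f x * g x) \<le> norm ((f x)\<^sup>2 + (g x)\<^sup>2)"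
  proof (intro AE_I2)
    fix x
    have "2 * (\<bar>f x\<bar> * \<bar>g x\<bar>) \<le> (f x)\<^sup>2 + (g x)\<^sup>2"
      using sum_squares_bound[of "\<bar>f x\<bar>" "\<bar>g x\<bar>"] by (simp add: power2_eq_square)
    moreover have "0 \<le> \<bar>f x\<bar> * \<bar>g x\<bar>" by simp
    ultimately show "norm (f x * g x) \<le> norm ((f x)\<^sup>2 + (g x)\<^sup>2)"
      unfolding real_norm_def abs_mult by linarith
  qed
qed

lemma L2_add: "L2 L f \<Longrightarrow> L2 L g \<Longrightarrow> L2 L (\<lambda>x. f x + g x)"
  using L2_mult_integrable[of L f g] unfolding L2_def
  by (auto simp: power2_sum mult.assoc)

lemma L2_cmult: "L2 L f \<Longrightarrow> L2 L (\<lambda>x. c * f x)"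
  unfolding L2_def by (auto simp: power_mult_distrib)

lemma L2_diff: "L2 L f \<Longrightarrow> L2 L g \<Longrightarrow> L2 L (\<lambda>x. f x - g x)"
  using L2_add[OF _ L2_cmult[of L g "-1"], of f] by simp

lemma L2_divide: "L2 L f \<Longrightarrow> L2 L (\<lambda>x. f x / c)"
  using L2_cmult[of L f "1/c"] by simp

lemma L2_cong_AE:
  assumes "L2 L f" "AE x in lebesgue_on {0..L}. f x = g x"
  shows "L2 L g"
proof -
  have m: "g \<in> borel_measurable (lebesgue_on {0..L})"
    by (rule borel_measurable_lebesgue_on_AE[OF _ assms(2)]) (use assms in \<open>auto simp: L2_def\<close>)
  moreover have "integrable (lebesgue_on {0..L}) (\<lambda>x. (g x)^2)"
    using assms m by (subst integrable_cong_AE[where g="\<lambda>x. (f x)^2"]) (auto simp: L2_def)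
  ultimately show ?thesis by (simp add: L2_def)
qed

lemma L2_continuous: "continuous_on {0..L} f \<Longrightarrow> L2 L f"
  unfolding L2_def
  by (intro conjI borel_measurable_integrable continuous_imp_integrable_real continuous_intros)

lemma integrable_mult_continuous:
  fixes f g :: "real \<Rightarrow> real"
  assumes f: "integrable (lebesgue_on {0..L}) f" and g: "continuous_on {0..L} g"
  shows "integrable (lebesgue_on {0..L}) (\<lambda>x. f x * g x)"
proof -
  have "bounded (g ` {0..L})"
    by (intro compact_imp_bounded compact_continuous_image g) simp
  then obtain B where B: "\<And>x. x \<in> {0..L} \<Longrightarrow> \<bar>g x\<bar> \<le> B"
    unfolding bounded_iff by (auto simp del: atLeastAtMost_iff)
  have mg: "g \<in> borel_measurable (lebesgue_on {0..L})"
    using g by (intro borel_measurable_integrable continuous_imp_integrable_real)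
  show ?thesis
  proof (rule Bochner_Integration.integrable_bound)
    show "integrable (lebesgue_on {0..L}) (\<lambda>x. B * f x)" using f by simp
    show "(\<lambda>x. f x * g x) \<in> borel_measurable (lebesgue_on {0..L})"
      using f mg by (auto dest: borel_measurable_integrable)
    show "AE x in lebesgue_on {0..L}. norm (f x * g x) \<le> norm (B * f x)"
    proof (rule AE_I2)
      fix x assume "x \<in> space (lebesgue_on {0..L})"
      hence "\<bar>g x\<bar> \<le> B" by (intro B) (simp add: space_restrict_space)
      hence "\<bar>f x\<bar> * \<bar>g x\<bar> \<le> \<bar>f x\<bar> * \<bar>B\<bar>" by (intro mult_left_mono) auto
      thus "norm (f x * g x) \<le> norm (B * f x)"
        by (simp add: abs_mult mult.commute)
    qed
  qed
qed

lemma ip_commute: "ip L f g = ip L g f"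
  unfolding ip_def by (simp add: mult.commute)

lemma ip_cong_AE:
  assumes "AE x in lebesgue_on {0..L}. f x = f' x" "f \<in> borel_measurable (lebesgue_on {0..L})"
    "g \<in> borel_measurable (lebesgue_on {0..L})"
  shows "ip L f g = ip L f' g"
proof -
  have "f' \<in> borel_measurable (lebesgue_on {0..L})"
    by (rule borel_measurable_lebesgue_on_AE[OF assms(2,1)])
  thus ?thesis unfolding ip_def using assms by (intro integral_cong_AE) auto
qed

lemma ip_cmult: "ip L (\<lambda>x. c * f x) g = c * ip L f g"
  unfolding ip_def by (simp add: mult.assoc)

lemma ip_add: "L2 L f \<Longrightarrow> L2 L g \<Longrightarrow> L2 L h \<Longrightarrow> ip L (\<lambda>x. f x + g x) h = ip L f h + ip L g h"
  unfolding ip_def using L2_mult_integrable by (simp add: distrib_right)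

lemma ip_diff: "L2 L f \<Longrightarrow> L2 L g \<Longrightarrow> L2 L h \<Longrightarrow> ip L (\<lambda>x. f x - g x) h = ip L f h - ip L g h"
  unfolding ip_def using L2_mult_integrable by (simp add: left_diff_distrib)

lemma l2norm_nonneg: "0 \<le> l2norm L f"
  unfolding l2norm_def by simp

lemma l2norm_sq: "(l2norm L f)\<^sup>2 = ip L f f"
  unfolding l2norm_def ip_def by (simp add: power2_eq_square)

lemma ip_self_nonneg: "0 \<le> ip L f f"
  unfolding ip_def by simp

text \<open>The square of s f - r g has a nonnegative integral for all s and r. The choice s =
  <g,g>, r = <f,g> gives the inequality after division by <g,g>; the degenerate case <g,g> = 0 needs
  another choice.\<close>

lemma ip_Cauchy_Schwarz:
  assumes f: "L2 L f" and g: "L2 L g"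
  shows "\<bar>ip L f g\<bar> \<le> l2norm L f * l2norm L g"
proof -
  let ?F = "ip L f f" and ?G = "ip L g g" and ?H = "ip L f g"
  have q: "0 \<le> s * s * ?F - 2 * s * r * ?H + r * r * ?G" for r s
  proof -
    have "0 \<le> ip L (\<lambda>x. s * f x - r * g x) (\<lambda>x. s * f x - r * g x)" by (rule ip_self_nonneg)
    also have "\<dots> = s * ip L f (\<lambda>x. s * f x - r * g x) - r * ip L g (\<lambda>x. s * f x - r * g x)"
      by (simp add: ip_diff ip_cmult L2_cmult L2_diff f g)
    also have "\<dots> = s * (s * ?F - r * ip L g f) - r * (s * ?H - r * ?G)"
      unfolding ip_commute[of L f "\<lambda>x. s * f x - r * g x"] ip_commute[of L g "\<lambda>x. s * f x - r * g x"]
      by (simp add: ip_diff ip_cmult L2_cmult f g)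
    also have "\<dots> = s * s * ?F - 2 * s * r * ?H + r * r * ?G"
      by (simp add: ip_commute[of L g f] algebra_simps)
    finally show ?thesis .
  qed
  have "?H\<^sup>2 \<le> ?F * ?G"
  proof (cases "?G = 0")
    case True
    have "?H = 0"
    proof (rule ccontr)
      assume h: "?H \<noteq> 0"
      \<comment> \<open>With <g,g> = 0 the form is affine in r, and this r brings it to exactly
        -1.\<close>
      have "0 \<le> ?F - 2 * ((?F + 1) / (2 * ?H)) * ?H" using q[of 1 "(?F + 1) / (2 * ?H)"] True by simp
      also have "\<dots> = -1" using h by (simp add: field_simps)
      finally show False by simp
    qed
    thus ?thesis using True by simp
  next
    case False
    hence g0: "?G > 0" using ip_self_nonneg[of L g] by simp
    have "0 \<le> ?G * ?G * ?F - ?H * ?H * ?G" using q[of ?G ?H] by (simp add: algebra_simps)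
    hence "0 \<le> ?G * (?F * ?G - ?H\<^sup>2)" by (simp add: algebra_simps power2_eq_square)
    thus ?thesis using g0 by (simp add: zero_le_mult_iff)
  qed
  also have "\<dots> = (l2norm L f * l2norm L g)\<^sup>2" by (simp add: power_mult_distrib l2norm_sq)
  finally show ?thesis
    by (metis abs_le_square_iff abs_of_nonneg l2norm_nonneg mult_nonneg_nonneg)
qed

lemma l2norm_cmult: "l2norm L (\<lambda>x. c * f x) = \<bar>c\<bar> * l2norm L f"
  unfolding l2norm_def by (simp add: power_mult_distrib real_sqrt_mult)

lemma l2norm_triangle:
  assumes f: "L2 L f" and g: "L2 L g"
  shows "l2norm L (\<lambda>x. f x + g x) \<le> l2norm L f + l2norm L g"
proof (rule power2_le_imp_le)
  have "(l2norm L (\<lambda>x. f x + g x))\<^sup>2 = ip L f (\<lambda>x. f x + g x) + ip L g (\<lambda>x. f x + g x)"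
    by (simp add: l2norm_sq ip_add L2_add f g)
  also have "\<dots> \<le> l2norm L f * l2norm L (\<lambda>x. f x + g x) + l2norm L g * l2norm L (\<lambda>x. f x + g x)"
    by (intro add_mono order_trans[OF abs_ge_self ip_Cauchy_Schwarz] L2_add f g)
  finally have *: "l2norm L (\<lambda>x. f x + g x) * l2norm L (\<lambda>x. f x + g x)
      \<le> (l2norm L f + l2norm L g) * l2norm L (\<lambda>x. f x + g x)"
    by (simp add: power2_eq_square distrib_right)
  have "l2norm L (\<lambda>x. f x + g x) \<le> l2norm L f + l2norm L g"
  proof (cases "l2norm L (\<lambda>x. f x + g x) = 0")
    case True then show ?thesis by (simp add: l2norm_nonneg)
  next
    case False
    hence "0 < l2norm L (\<lambda>x. f x + g x)" using l2norm_nonneg[of L "\<lambda>x. f x + g x"] by simp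
    thus ?thesis using * by simp
  qed
  thus "(l2norm L (\<lambda>x. f x + g x))\<^sup>2 \<le> (l2norm L f + l2norm L g)\<^sup>2"
    by (rule power_mono) (rule l2norm_nonneg)
qed (simp add: l2norm_nonneg)

lemma l2norm_cong_AE:
  assumes "AE x in lebesgue_on {0..L}. f x = g x" "f \<in> borel_measurable (lebesgue_on {0..L})"
  shows "l2norm L f = l2norm L g"
proof -
  have "g \<in> borel_measurable (lebesgue_on {0..L})"
    by (rule borel_measurable_lebesgue_on_AE[OF assms(2,1)])
  thus ?thesis unfolding l2norm_def using assms
    by (intro arg_cong[of _ _ sqrt] integral_cong_AE) auto
qed

lemma l2norm_bound:
  assumes "\<And>x. x \<in> {0..L} \<Longrightarrow> \<bar>f x\<bar> \<le> K" "0 \<le> K" "0 \<le> L"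
  shows "l2norm L f \<le> sqrt L * K"
proof -
  have "(LINT x|lebesgue_on {0..L}. (f x)\<^sup>2) \<le> L * K\<^sup>2"
  proof (cases "integrable (lebesgue_on {0..L}) (\<lambda>x. (f x)\<^sup>2)")
    case True
    have "(LINT x|lebesgue_on {0..L}. (f x)\<^sup>2) \<le> (LINT x|lebesgue_on {0..L}. K\<^sup>2)"
    proof (rule integral_mono[OF True])
      show "integrable (lebesgue_on {0..L}) (\<lambda>x. K\<^sup>2)"
        by (rule continuous_imp_integrable_real) simp
      fix x assume "x \<in> space (lebesgue_on {0..L})"
      hence "\<bar>f x\<bar> \<le> \<bar>K\<bar>" using assms by (auto simp: space_restrict_space)
      thus "(f x)\<^sup>2 \<le> K\<^sup>2" by (simp only: abs_le_square_iff)
    qed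
    also have "\<dots> = L * K\<^sup>2"
      using assms by (simp add: measure_restrict_space)
    finally show ?thesis .
  next
    case False
    \<comment> \<open>A non-integrable square has integral 0 by convention, so the bound holds
      trivially.\<close>
    thus ?thesis using assms by (simp add: not_integrable_integral_eq)
  qed
  hence "l2norm L f \<le> sqrt (L * K\<^sup>2)" unfolding l2norm_def by (rule real_sqrt_le_mono)
  thus ?thesis using assms by (simp add: real_sqrt_mult)
qed

section \<open>Continuous representatives and primitives of integrable functions\<close>

text \<open>A continuous nonnegative function with integral 0 vanishes everywhere; here it is
  \<open>\<bar>f x - g x\<bar>\<close>. This is what makes the \<open>THE\<close> in
  \<open>bval\<close> well defined.\<close>

lemma AE_eq_continuous_imp_eq:
  fixes f g :: "real \<Rightarrow> real"
  assumes L: "L > 0" and f: "continuous_on {0..L} f" and g: "continuous_on {0..L} g"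
    and eq: "AE x in lebesgue_on {0..L}. f x = g x" and x: "x \<in> {0..L}"
  shows "f x = g x"
proof -
  define h where "h = (\<lambda>x. \<bar>f x - g x\<bar>)"
  have h: "continuous_on {0..L} h" unfolding h_def by (intro continuous_intros f g)
  have ih: "integrable (lebesgue_on {0..L}) h" by (rule continuous_imp_integrable_real[OF h])
  have "integral\<^sup>L (lebesgue_on {0..L}) h = integral\<^sup>L (lebesgue_on {0..L}) (\<lambda>x. 0)"
    using eq ih unfolding h_def by (intro integral_cong_AE) (auto dest: borel_measurable_integrable)
  hence "integral {0..L} h = 0" using lebesgue_integral_eq_integral[OF ih] by simp
  hence "\<forall>x\<in>cbox 0 L. h x = 0"
    using h L by (subst integral_cbox_eq_0_iff[symmetric]) (auto simp: h_def box_real)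
  thus ?thesis using x unfolding h_def by auto
qed

lemma integrable_indicator_mult:
  fixes f :: "real \<Rightarrow> real"
  assumes "integrable (lebesgue_on {0..L}) f" "A \<in> sets borel"
  shows "integrable (lebesgue_on {0..L}) (\<lambda>s. indicator A s * f s)"
proof (rule Bochner_Integration.integrable_bound[OF assms(1)])
  have "A \<in> sets lebesgue" using assms(2) by simp
  hence "A \<inter> {0..L} \<in> sets (lebesgue_on {0..L})" by (auto simp: sets_restrict_space)
  hence "indicator A \<in> borel_measurable (lebesgue_on {0..L})"
    by (intro borel_measurable_indicator') (auto simp: space_restrict_space Int_def conj_ac)
  thus "(\<lambda>s. indicator A s * f s) \<in> borel_measurable (lebesgue_on {0..L})"
    using assms(1) by (intro borel_measurable_times) (auto dest: borel_measurable_integrable)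
  show "AE x in lebesgue_on {0..L}. norm (indicator A x * f x) \<le> norm (f x)"
    by (auto simp: indicator_def)
qed

text \<open>Bridge between the two integrals in use: pairings are Lebesgue integrals on the
  interval, primitives are Henstock-Kurzweil integrals up to x.\<close>

lemma integral_indicator_primitive:
  fixes f :: "real \<Rightarrow> real"
  assumes f: "integrable (lebesgue_on {0..L}) f" and x: "x \<in> {0..L}"
  shows "(LINT s|lebesgue_on {0..L}. indicator {..x} s * f s) = integral {0..x} f"
proof -
  have "(LINT s|lebesgue_on {0..L}. indicator {..x} s * f s) = integral {0..L} (\<lambda>s. indicator {..x} s * f s)"
    by (rule lebesgue_integral_eq_integral[OF integrable_indicator_mult[OF f]]) auto
  also have "\<dots> = integral {0..L} (\<lambda>s. if s \<in> {0..x} then f s else 0)"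
    by (rule integral_cong) (auto simp: indicator_def)
  also have "\<dots> = integral {0..x} f"
    using x by (subst integral_restrict_Int) (auto intro!: arg_cong2[of _ _ _ _ integral])
  finally show ?thesis .
qed

lemma continuous_on_primitive:
  fixes f :: "real \<Rightarrow> real"
  assumes f: "integrable (lebesgue_on {0..L}) f"
  shows "continuous_on {0..L} (\<lambda>x. integral {0..x} f)"
  by (rule indefinite_integral_continuous_1) (rule integrable_on_lebesgue_on[OF f], simp)

lemma primitive_by_parts:
  fixes f g :: "real \<Rightarrow> real"
  assumes f: "integrable (lebesgue_on {0..L}) f" and g: "integrable (lebesgue_on {0..L}) g"
  shows "(LINT x|lebesgue_on {0..L}. integral {0..x} f * g x)
      = integral {0..L} f * integral {0..L} g - (LINT x|lebesgue_on {0..L}. f x * integral {0..x} g)"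
proof -
  let ?M = "lebesgue_on {0..L}"
  have sf: "sigma_finite_measure ?M"
    using finite_measure_interval unfolding finite_measure_def by simp
  interpret pair_sigma_finite ?M ?M
    by (intro pair_sigma_finite.intro sf)
  have m: "fst \<in> ?M \<Otimes>\<^sub>M ?M \<rightarrow>\<^sub>M borel" "snd \<in> ?M \<Otimes>\<^sub>M ?M \<rightarrow>\<^sub>M borel"
  proof -
    have "(\<lambda>x. x) \<in> ?M \<rightarrow>\<^sub>M (borel :: real measure)"
      by (intro borel_measurable_integrable continuous_imp_integrable_real continuous_intros)
    from measurable_compose[OF measurable_fst[of ?M ?M] this] measurable_compose[OF measurable_snd[of ?M ?M] this]
    show "fst \<in> ?M \<Otimes>\<^sub>M ?M \<rightarrow>\<^sub>M borel" "snd \<in> ?M \<Otimes>\<^sub>M ?M \<rightarrow>\<^sub>M borel" by simp_all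
  qed
  have mf: "f \<in> borel_measurable ?M" and mg: "g \<in> borel_measurable ?M"
    using f g by (auto dest: borel_measurable_integrable)
  \<comment> \<open>Integrating \<open>h\<close> in s yields the primitive of f times g; integrating
    it in x yields f times the tail of the integral of g.\<close>
  define h where "h = (\<lambda>s x. indicator {s..} x * (f s * g x))"
  have prod: "integrable (?M \<Otimes>\<^sub>M ?M) (case_prod (\<lambda>s x. f s * g x))"
  proof (rule Fubini_integrable)
    show "case_prod (\<lambda>s x. f s * g x) \<in> borel_measurable (?M \<Otimes>\<^sub>M ?M)"
      using mf mg by measurable
    show "integrable ?M (\<lambda>s. LINT x|?M. norm (case (s, x) of (s, x) \<Rightarrow> f s * g x))"
      using f by (simp add: abs_mult)
    show "AE s in ?M. integrable ?M (\<lambda>x. case (s, x) of (s, x) \<Rightarrow> f s * g x)"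
      using g by simp
  qed
  have int: "integrable (?M \<Otimes>\<^sub>M ?M) (case_prod h)"
  proof (rule Bochner_Integration.integrable_bound[OF prod])
    have "(\<lambda>z. indicator {z. fst z \<le> snd z} z * (f (fst z) * g (snd z))) \<in> borel_measurable (?M \<Otimes>\<^sub>M ?M)"
    proof (intro borel_measurable_times borel_measurable_indicator')
      show "{x \<in> space (?M \<Otimes>\<^sub>M ?M). x \<in> {z. fst z \<le> snd z}} \<in> sets (?M \<Otimes>\<^sub>M ?M)"
        using borel_measurable_le[OF m] by simp
    qed (use mf mg in measurable)
    also have "(\<lambda>z. indicator {z. fst z \<le> snd z} z * (f (fst z) * g (snd z))) = case_prod h"
      by (auto simp: h_def indicator_def fun_eq_iff)
    finally show "case_prod h \<in> borel_measurable (?M \<Otimes>\<^sub>M ?M)" .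
    show "AE z in ?M \<Otimes>\<^sub>M ?M. norm (case_prod h z) \<le> norm (case z of (s, x) \<Rightarrow> f s * g x)"
      by (auto simp: h_def indicator_def)
  qed
  have "(LINT x|?M. integral {0..x} f * g x) = (LINT x|?M. LINT s|?M. h s x)"
  proof (rule Bochner_Integration.integral_cong[OF refl])
    fix x assume "x \<in> space ?M"
    hence x: "x \<in> {0..L}" by (simp add: space_restrict_space)
    have "(LINT s|?M. h s x) = (LINT s|?M. (indicator {..x} s * f s) * g x)"
      by (intro Bochner_Integration.integral_cong) (auto simp: h_def indicator_def)
    also have "\<dots> = integral {0..x} f * g x"
      using integral_indicator_primitive[OF f x] by simp
    finally show "integral {0..x} f * g x = (LINT s|?M. h s x)" ..
  qed
  also have "\<dots> = (LINT s|?M. LINT x|?M. h s x)"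
    by (rule Fubini_integral[OF int])
  also have "\<dots> = (LINT s|?M. integral {0..L} g * f s - f s * integral {0..s} g)"
  proof (rule Bochner_Integration.integral_cong[OF refl])
    fix s assume "s \<in> space ?M"
    hence s: "s \<in> {0..L}" by (simp add: space_restrict_space)
    have gL: "g integrable_on {0..L}" by (rule integrable_on_lebesgue_on[OF g]) simp
    have "(LINT x|?M. h s x) = f s * (LINT x|?M. indicator {s..} x * g x)"
      by (subst Bochner_Integration.integral_mult_right_zero[symmetric])
        (intro Bochner_Integration.integral_cong, auto simp: h_def)
    also have "(LINT x|?M. indicator {s..} x * g x) = integral {0..L} (\<lambda>x. indicator {s..} x * g x)"
      by (rule lebesgue_integral_eq_integral[OF integrable_indicator_mult[OF g]]) auto
    also have "\<dots> = integral {0..L} (\<lambda>x. if x \<in> {s..L} then g x else 0)"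
      by (rule integral_cong) (auto simp: indicator_def)
    also have "\<dots> = integral {s..L} g"
      using s by (subst integral_restrict_Int) (auto intro!: arg_cong2[of _ _ _ _ integral])
    also have "\<dots> = integral {0..L} g - integral {0..s} g"
      using Henstock_Kurzweil_Integration.integral_combine[of 0 s L g] s gL by simp
    finally show "(LINT x|?M. h s x) = integral {0..L} g * f s - f s * integral {0..s} g"
      by (simp add: algebra_simps)
  qed
  also have "\<dots> = integral {0..L} g * integral {0..L} f - (LINT x|?M. f x * integral {0..x} g)"
    using f integrable_mult_continuous[OF f continuous_on_primitive[OF g]] lebesgue_integral_eq_integral[OF f]
    by simp
  finally show ?thesis by (simp add: mult.commute)
qed

section \<open>Completeness of the cosine system\<close>

text \<open>The form for absolutely continuous \<open>F\<close> and \<open>G\<close> with arbitrary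
  initial values. Its boundary terms are later what feeds the boundary data into the cosine
  coefficients.\<close>

lemma primitive_by_parts_affine:
  fixes f g F G :: "real \<Rightarrow> real"
  assumes f: "integrable (lebesgue_on {0..L}) f" and g: "integrable (lebesgue_on {0..L}) g" and L: "0 \<le> L"
    and F: "\<And>x. x \<in> {0..L} \<Longrightarrow> F x = F 0 + integral {0..x} f"
    and G: "\<And>x. x \<in> {0..L} \<Longrightarrow> G x = G 0 + integral {0..x} g"
  shows "ip L f G = F L * G L - F 0 * G 0 - ip L F g"
proof -
  have 1: "ip L f G = (LINT x|lebesgue_on {0..L}. G 0 * f x + f x * integral {0..x} g)"
    unfolding ip_def
    by (rule Bochner_Integration.integral_cong[OF refl]) (subst G, auto simp: space_restrict_space algebra_simps)
  have 2: "ip L F g = (LINT x|lebesgue_on {0..L}. F 0 * g x + g x * integral {0..x} f)"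
    unfolding ip_def
    by (rule Bochner_Integration.integral_cong[OF refl]) (subst F, auto simp: space_restrict_space algebra_simps)
  have 3: "ip L f G = G 0 * integral {0..L} f + (LINT x|lebesgue_on {0..L}. f x * integral {0..x} g)"
    unfolding 1 using integrable_mult_continuous[OF f continuous_on_primitive[OF g]] f
      lebesgue_integral_eq_integral[OF f] by simp
  have 4: "ip L F g = F 0 * integral {0..L} g + (LINT x|lebesgue_on {0..L}. g x * integral {0..x} f)"
    unfolding 2 using integrable_mult_continuous[OF g continuous_on_primitive[OF f]] g
      lebesgue_integral_eq_integral[OF g] by simp
  have 5: "F L = F 0 + integral {0..L} f" "G L = G 0 + integral {0..L} g"
    using F[of L] G[of L] L by auto
  show ?thesis
    using primitive_by_parts[OF f g] unfolding 3 4 5 by (simp add: algebra_simps)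
qed

text \<open>The test function one wants is the sign of g, which gives the integral of the absolute
  value of g. It is a pointwise limit of continuous functions off a negligible set, and dominated
  convergence transfers the orthogonality.\<close>

lemma orthogonal_continuous_imp_AE_0:
  fixes g :: "real \<Rightarrow> real"
  assumes g: "integrable (lebesgue_on {0..L}) g"
    and orth: "\<And>h. continuous_on UNIV h \<Longrightarrow> (LINT x|lebesgue_on {0..L}. g x * h x) = 0"
  shows "AE x in lebesgue_on {0..L}. g x = 0"
proof -
  have mg: "g \<in> borel_measurable (lebesgue_on {0..L})" using g by (rule borel_measurable_integrable)
  have "(\<lambda>x. sgn (g x)) \<in> borel_measurable (lebesgue_on {0..L})" using mg by measurable
  hence "(\<lambda>x. sgn (g x)) measurable_on {0..L}" by (subst measurable_on_iff_borel_measurable) auto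
  then obtain N h where N: "negligible N" and h: "\<And>n. continuous_on UNIV (h n :: real \<Rightarrow> real)"
    and lim: "\<And>x. x \<notin> N \<Longrightarrow> (\<lambda>n. h n x) \<longlonglongrightarrow> (if x \<in> {0..L} then sgn (g x) else 0)"
    unfolding measurable_on_def by blast
  \<comment> \<open>Clipping to [-1, 1] does not change the limit, which lies in that range, and
    makes the absolute value of g a dominating function.\<close>
  define k where "k n x = max (-1) (min 1 (h n x))" for n x
  have k: "continuous_on UNIV (k n)" for n unfolding k_def by (intro continuous_intros h)
  have mk: "k n \<in> borel_measurable (lebesgue_on {0..L})" for n
    by (intro borel_measurable_integrable continuous_imp_integrable_real continuous_on_subset[OF k]) auto
  have "(\<lambda>n. LINT x|lebesgue_on {0..L}. g x * k n x) \<longlonglongrightarrow> (LINT x|lebesgue_on {0..L}. g x * sgn (g x))"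
  proof (rule integral_dominated_convergence[where w="\<lambda>x. \<bar>g x\<bar>"])
    show "(\<lambda>x. g x * sgn (g x)) \<in> borel_measurable (lebesgue_on {0..L})" using mg by measurable
    show "(\<lambda>x. g x * k n x) \<in> borel_measurable (lebesgue_on {0..L})" for n using mg mk by measurable
    show "integrable (lebesgue_on {0..L}) (\<lambda>x. \<bar>g x\<bar>)" using g by simp
    show "AE x in lebesgue_on {0..L}. norm (g x * k n x) \<le> \<bar>g x\<bar>" for n
    proof (intro AE_I2)
      fix x
      have "\<bar>g x\<bar> * \<bar>k n x\<bar> \<le> \<bar>g x\<bar> * 1" by (intro mult_left_mono) (auto simp: k_def)
      thus "norm (g x * k n x) \<le> \<bar>g x\<bar>" by (simp add: abs_mult)
    qed
    have "AE x in lebesgue. x \<notin> N" using N by (simp add: AE_not_in negligible_iff_null_sets)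
    hence "AE x in lebesgue_on {0..L}. x \<notin> N"
      by (subst AE_restrict_space_iff) auto
    moreover have "AE x in lebesgue_on {0..L}. x \<in> {0..L}"
      by (intro AE_I2) (simp add: space_restrict_space)
    ultimately show "AE x in lebesgue_on {0..L}. (\<lambda>n. g x * k n x) \<longlonglongrightarrow> g x * sgn (g x)"
    proof eventually_elim
      case (elim x)
      have "(\<lambda>n. k n x) \<longlonglongrightarrow> max (-1) (min 1 (sgn (g x)))"
        unfolding k_def using lim[OF elim(1)] elim(2) by (intro tendsto_intros) auto
      also have "max (-1) (min 1 (sgn (g x))) = sgn (g x)" by (auto simp: sgn_if)
      finally show ?case by (intro tendsto_intros)
    qed
  qed
  hence "(LINT x|lebesgue_on {0..L}. g x * sgn (g x)) = 0"
    unfolding orth[OF k] by (simp add: LIMSEQ_const_iff)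
  hence "(LINT x|lebesgue_on {0..L}. \<bar>g x\<bar>) = 0" by (simp add: abs_sgn)
  thus ?thesis
    using g by (subst (asm) integral_nonneg_eq_0_iff_AE) auto
qed

section \<open>Cosine polynomials and their density\<close>

lemma cos_mult_cos_frequencies:
  "cos (real m * pi * x / L) * cos (real n * pi * x / L) = (1/2) * cos (real (m + n) * pi * x / L)
     + (1/2) * cos (real (if m \<le> n then n - m else m - n) * pi * x / L)"
proof -
  define k where "k = (if m \<le> n then n - m else m - n)"
  have "cos (real m * pi * x / L - real n * pi * x / L) = cos (real k * pi * x / L)"
  proof (cases "m \<le> n")
    case True
    hence "real k * pi * x / L = - (real m * pi * x / L - real n * pi * x / L)"
      by (simp add: k_def of_nat_diff diff_divide_distrib algebra_simps)
    thus ?thesis by (metis cos_minus)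
  next
    case False
    hence "real k * pi * x / L = real m * pi * x / L - real n * pi * x / L"
      by (simp add: k_def of_nat_diff diff_divide_distrib algebra_simps)
    thus ?thesis by simp
  qed
  moreover have "real m * pi * x / L + real n * pi * x / L = real (m + n) * pi * x / L"
    by (simp add: add_divide_distrib algebra_simps)
  ultimately show ?thesis by (simp add: cos_times_cos k_def)
qed

text \<open>The linear span is given inductively so that a linear identity checked on the cosines
  extends by rule induction. No closure under products is built in; it follows from the product
  formula.\<close>

inductive cos_span :: "real \<Rightarrow> (real \<Rightarrow> real) \<Rightarrow> bool" for L where
  basic: "cos_span L (\<lambda>x. cos (real n * pi * x / L))"
| add: "cos_span L f \<Longrightarrow> cos_span L g \<Longrightarrow> cos_span L (\<lambda>x. f x + g x)"
| scale: "cos_span L f \<Longrightarrow> cos_span L (\<lambda>x. c * f x)"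

lemma cos_span_continuous: "cos_span L f \<Longrightarrow> L > 0 \<Longrightarrow> continuous_on A f"
  by (induction rule: cos_span.induct) (auto intro!: continuous_intros)

lemma cos_span_mult_cos:
  assumes "cos_span L f" "L > 0"
  shows "cos_span L (\<lambda>x. cos (real m * pi * x / L) * f x)"
  using assms(1)
proof (induction rule: cos_span.induct)
  case (basic n)
  define k where "k = (if m \<le> n then n - m else m - n)"
  have "(\<lambda>x. cos (real m * pi * x / L) * cos (real n * pi * x / L))
     = (\<lambda>x. (1/2) * cos (real (m + n) * pi * x / L) + (1/2) * cos (real k * pi * x / L))"
    unfolding k_def by (rule ext) (rule cos_mult_cos_frequencies)
  moreover have "cos_span L \<dots>"
    by (rule cos_span.add[OF cos_span.scale[OF cos_span.basic] cos_span.scale[OF cos_span.basic]])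
  ultimately show ?case by (simp only:)
next
  case (add f g)
  thus ?case using cos_span.add[OF add.IH] by (simp add: distrib_left)
next
  case (scale f c)
  thus ?case using cos_span.scale[OF scale.IH, of c] by (simp add: mult.left_commute)
qed

lemma cos_span_mult:
  assumes "cos_span L f" "cos_span L g" "L > 0"
  shows "cos_span L (\<lambda>x. f x * g x)"
  using assms(1)
proof (induction rule: cos_span.induct)
  case (basic n)
  show ?case by (rule cos_span_mult_cos[OF assms(2,3)])
next
  case (add f h)
  thus ?case using cos_span.add[OF add.IH] by (simp add: distrib_right)
next
  case (scale f c)
  thus ?case using cos_span.scale[OF scale.IH, of c] by (simp add: mult.assoc)
qed

text \<open>Stone-Weierstrass: cosines alone form an algebra with constants, and the single function
  cos(pi x / L) separates points because it is injective on [0, L].\<close>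

lemma cos_span_dense:
  assumes L: "L > 0" and h: "continuous_on {0..L} h" and e: "0 < e"
  shows "\<exists>f. cos_span L f \<and> (\<forall>x\<in>{0..L}. \<bar>h x - f x\<bar> < e)"
proof (rule Stone_Weierstrass_HOL[where P="cos_span L", OF _ _ _ _ _ _ h e])
  show "cos_span L (\<lambda>x. c)" for c
    using cos_span.scale[OF cos_span.basic[of L 0], of c] by simp
  fix x y assume xy: "x \<in> {0..L} \<and> y \<in> {0..L} \<and> x \<noteq> y"
  have "cos (real 1 * pi * x / L) \<noteq> cos (real 1 * pi * y / L)"
  proof
    assume "cos (real 1 * pi * x / L) = cos (real 1 * pi * y / L)"
    hence "pi * x / L = pi * y / L"
      using xy L by - (rule cos_inj_pi, auto simp: field_simps)
    thus False using xy L by (simp add: field_simps)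
  qed
  thus "\<exists>f. cos_span L f \<and> f x \<noteq> f y" using cos_span.basic[of L 1] by blast
qed (use cos_span_continuous cos_span.add cos_span_mult L in auto)

text \<open>Orthogonality passes from cosine polynomials to continuous functions with an error of
  the uniform distance times the L1 norm of g. Integrability of g suffices for this, which matters
  because weak derivatives are only assumed integrable.\<close>

lemma cos_complete:
  fixes g :: "real \<Rightarrow> real"
  assumes L: "L > 0" and g: "integrable (lebesgue_on {0..L}) g"
    and orth: "\<And>n. (LINT x|lebesgue_on {0..L}. g x * cos (real n * pi * x / L)) = 0"
  shows "AE x in lebesgue_on {0..L}. g x = 0"
proof (rule orthogonal_continuous_imp_AE_0[OF g])
  fix h :: "real \<Rightarrow> real" assume "continuous_on UNIV h"
  hence h: "continuous_on {0..L} h" by (rule continuous_on_subset) simp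
  let ?M = "lebesgue_on {0..L}"
  have span: "(LINT x|?M. g x * f x) = 0" if "cos_span L f" for f
    using that
  proof (induction rule: cos_span.induct)
    case (add f k)
    have "integrable ?M (\<lambda>x. g x * f x)" "integrable ?M (\<lambda>x. g x * k x)"
      by (rule integrable_mult_continuous[OF g cos_span_continuous[OF add.hyps(1) L]],
          rule integrable_mult_continuous[OF g cos_span_continuous[OF add.hyps(2) L]])
    thus ?case using add by (simp add: distrib_left)
  next
    case (scale f c)
    have "(LINT x|?M. g x * (c * f x)) = (LINT x|?M. c * (g x * f x))"
      by (intro Bochner_Integration.integral_cong) auto
    thus ?case using scale by simp
  qed (rule orth)
  define K where "K = (LINT x|?M. \<bar>g x\<bar>)"
  have K: "K \<ge> 0" unfolding K_def by simp
  have bound: "\<bar>LINT x|?M. g x * h x\<bar> \<le> e * K" if e: "e > 0" for e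
  proof -
    obtain f where f: "cos_span L f" "\<And>x. x \<in> {0..L} \<Longrightarrow> \<bar>h x - f x\<bar> < e"
      using cos_span_dense[OF L h e] by blast
    have cf: "continuous_on {0..L} f" by (rule cos_span_continuous[OF f(1) L])
    have "(LINT x|?M. g x * h x) = (LINT x|?M. g x * h x) - (LINT x|?M. g x * f x)"
      using span[OF f(1)] by simp
    also have "\<dots> = (LINT x|?M. g x * (h x - f x))"
      using integrable_mult_continuous[OF g h] integrable_mult_continuous[OF g cf]
      by (simp add: right_diff_distrib)
    also have "\<bar>\<dots>\<bar> \<le> (LINT x|?M. \<bar>g x * (h x - f x)\<bar>)"
      by (rule integral_abs_bound)
    also have "\<dots> \<le> (LINT x|?M. e * \<bar>g x\<bar>)"
    proof (rule integral_mono)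
      show "integrable ?M (\<lambda>x. \<bar>g x * (h x - f x)\<bar>)"
        by (intro integrable_abs integrable_mult_continuous g continuous_intros h cf)
      show "integrable ?M (\<lambda>x. e * \<bar>g x\<bar>)" using g by simp
      fix x assume "x \<in> space ?M"
      hence "\<bar>h x - f x\<bar> \<le> e" using f(2)[of x] by (auto simp: space_restrict_space)
      thus "\<bar>g x * (h x - f x)\<bar> \<le> e * \<bar>g x\<bar>"
        using mult_left_mono[of "\<bar>h x - f x\<bar>" e "\<bar>g x\<bar>"] by (simp add: abs_mult mult.commute)
    qed
    finally show ?thesis by (simp add: K_def)
  qed
  have "\<bar>LINT x|?M. g x * h x\<bar> \<le> 0"
  proof (rule field_le_epsilon)
    fix e :: real assume e: "e > 0"
    \<comment> \<open>Dividing by \<open>K + 1\<close> avoids a separate case for vanishing L1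
      norm.\<close>
    have "e / (K + 1) * K \<le> e" using e K by (simp add: field_simps)
    thus "\<bar>LINT x|?M. g x * h x\<bar> \<le> 0 + e" using bound[of "e / (K + 1)"] e K by simp
  qed
  thus "(LINT x|?M. g x * h x) = 0" by simp
qed

section \<open>The orthonormal Neumann cosine basis\<close>

text \<open>Agrees with \<open>phin\<close> for positive n and adds the normalised constant, without
  which the system is not complete.\<close>

definition ce :: "real \<Rightarrow> nat \<Rightarrow> real \<Rightarrow> real" where
  "ce L n x = (if n = 0 then sqrt (1 / L) else sqrt (2 / L)) * cos (real n * pi * x / L)"

definition lam :: "real \<Rightarrow> nat \<Rightarrow> real" where
  "lam L n = (real n * pi / L)\<^sup>2"

lemma continuous_on_ce: "L > 0 \<Longrightarrow> continuous_on A (ce L n)"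
  unfolding ce_def by (auto intro!: continuous_intros)

lemma L2_ce: "L > 0 \<Longrightarrow> L2 L (ce L n)"
  by (intro L2_continuous continuous_on_ce)

lemma integral_cos:
  assumes "L > 0"
  shows "(LINT x|lebesgue_on {0..L}. cos (real n * pi * x / L)) = (if n = 0 then L else 0)"
proof -
  have "integrable (lebesgue_on {0..L}) (\<lambda>x. cos (real n * pi * x / L))"
    using assms by (intro continuous_imp_integrable_real continuous_intros) auto
  hence "(LINT x|lebesgue_on {0..L}. cos (real n * pi * x / L)) = integral {0..L} (\<lambda>x. cos (real n * pi * x / L))"
    by (rule lebesgue_integral_eq_integral) simp
  also have "\<dots> = (if n = 0 then L else 0)"
  proof (cases "n = 0")
    case False
    have "((\<lambda>x. cos (real n * pi * x / L)) has_integral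
        sin (real n * pi * L / L) * L / (real n * pi) - sin (real n * pi * 0 / L) * L / (real n * pi)) {0..L}"
      using assms False
      by (intro fundamental_theorem_of_calculus)
        (auto intro!: derivative_eq_intros simp flip: has_real_derivative_iff_has_vector_derivative simp: field_simps)
    thus ?thesis using assms False by (auto dest: integral_unique)
  qed (use assms in simp)
  finally show ?thesis .
qed

lemma ce_orthonormal:
  assumes L: "L > 0"
  shows "ip L (ce L m) (ce L n) = (if m = n then 1 else 0)"
proof -
  define a where "a n = (if n = 0 then sqrt (1 / L) else sqrt (2 / L))" for n :: nat
  define k where "k = (if m \<le> n then n - m else m - n)"
  have int: "integrable (lebesgue_on {0..L}) (\<lambda>x. cos (real j * pi * x / L))" for j
    using L by (intro continuous_imp_integrable_real continuous_intros) auto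
  have "ce L m x * ce L n x
     = (a m * a n / 2) * cos (real k * pi * x / L) + (a m * a n / 2) * cos (real (m + n) * pi * x / L)" for x
  proof -
    have "ce L m x * ce L n x = a m * a n * (cos (real m * pi * x / L) * cos (real n * pi * x / L))"
      by (simp add: ce_def a_def)
    also have "\<dots> = a m * a n * ((1/2) * cos (real (m + n) * pi * x / L) + (1/2) * cos (real k * pi * x / L))"
      by (simp only: cos_mult_cos_frequencies k_def)
    finally show ?thesis by (simp add: algebra_simps)
  qed
  hence "ip L (ce L m) (ce L n) = (LINT x|lebesgue_on {0..L}.
      (a m * a n / 2) * cos (real k * pi * x / L) + (a m * a n / 2) * cos (real (m + n) * pi * x / L))"
    unfolding ip_def by simp
  also have "\<dots> = (a m * a n / 2) * (if k = 0 then L else 0) + (a m * a n / 2) * (if m + n = 0 then L else 0)"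
    using int by (simp add: integral_cos[OF L] del: of_nat_add)
  \<comment> \<open>For m = n = 0 both terms contribute, which the smaller normalisation at index 0
    compensates; otherwise at most the difference frequency does.\<close>
  also have "\<dots> = (if m = n then 1 else 0)"
    using L by (auto simp: k_def a_def)
  finally show ?thesis .
qed

lemma ip_diff_right: "L2 L f \<Longrightarrow> L2 L g \<Longrightarrow> L2 L h \<Longrightarrow> ip L h (\<lambda>x. f x - g x) = ip L h f - ip L h g"
  using ip_diff[of L f g h] by (simp add: ip_commute)

lemma ip_add_right: "L2 L f \<Longrightarrow> L2 L g \<Longrightarrow> L2 L h \<Longrightarrow> ip L h (\<lambda>x. f x + g x) = ip L h f + ip L h g"
  using ip_add[of L f g h] by (simp add: ip_commute)

lemma ip_cmult_right: "ip L g (\<lambda>x. c * f x) = c * ip L g f"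
  using ip_cmult[of L c f g] by (simp add: ip_commute)

lemma L2_sum: "finite A \<Longrightarrow> (\<And>i. i \<in> A \<Longrightarrow> L2 L (f i)) \<Longrightarrow> L2 L (\<lambda>x. \<Sum>i\<in>A. f i x)"
  by (induction A rule: finite_induct) (auto intro!: L2_add L2_continuous[of _ "\<lambda>x. 0"])

lemma ip_sum:
  assumes "finite A" "\<And>i. i \<in> A \<Longrightarrow> L2 L (f i)" "L2 L g"
  shows "ip L (\<lambda>x. \<Sum>i\<in>A. f i x) g = (\<Sum>i\<in>A. ip L (f i) g)"
  using assms
proof (induction A rule: finite_induct)
  case empty thus ?case by (simp add: ip_def)
next
  case (insert i A)
  thus ?case by (simp add: ip_add L2_sum)
qed

definition ce_sum :: "real \<Rightarrow> (nat \<Rightarrow> real) \<Rightarrow> nat set \<Rightarrow> real \<Rightarrow> real" where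
  "ce_sum L c A x = (\<Sum>n\<in>A. c n * ce L n x)"

lemma L2_ce_sum: "L > 0 \<Longrightarrow> finite A \<Longrightarrow> L2 L (ce_sum L c A)"
  unfolding ce_sum_def[abs_def] by (intro L2_sum L2_cmult L2_ce)

lemma ip_ce_sum:
  assumes "L > 0" "finite A" "L2 L g"
  shows "ip L (ce_sum L c A) g = (\<Sum>n\<in>A. c n * ip L (ce L n) g)"
  unfolding ce_sum_def[abs_def] using assms by (subst ip_sum) (auto intro!: L2_cmult L2_ce simp: ip_cmult)

lemma ip_ce_sum_ce:
  assumes "L > 0" "finite A"
  shows "ip L (ce_sum L c A) (ce L m) = (if m \<in> A then c m else 0)"
  using assms by (simp add: ip_ce_sum L2_ce ce_orthonormal if_distrib[of "\<lambda>x. _ * x"] cong: if_cong)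

lemma ip_ce_sum_self:
  assumes "L > 0" "finite A"
  shows "ip L (ce_sum L c A) (ce_sum L c A) = (\<Sum>n\<in>A. (c n)\<^sup>2)"
  using assms
  by (subst ip_ce_sum) (auto intro!: L2_ce_sum sum.cong simp: ip_commute[of L "ce L _"] ip_ce_sum_ce power2_eq_square)

section \<open>Riesz-Fischer and Parseval\<close>

lemma integral_abs_le_l2norm:
  assumes "L2 L f" "0 \<le> L"
  shows "(LINT x|lebesgue_on {0..L}. \<bar>f x\<bar>) \<le> sqrt L * l2norm L f"
proof -
  have a: "L2 L (\<lambda>x. \<bar>f x\<bar>)" using assms unfolding L2_def by auto
  have "(LINT x|lebesgue_on {0..L}. \<bar>f x\<bar>) = ip L (\<lambda>x. 1) (\<lambda>x. \<bar>f x\<bar>)" by (simp add: ip_def)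
  also have "\<dots> \<le> l2norm L (\<lambda>x. 1) * l2norm L (\<lambda>x. \<bar>f x\<bar>)"
    by (rule order_trans[OF abs_ge_self ip_Cauchy_Schwarz]) (auto intro!: L2_continuous a)
  also have "l2norm L (\<lambda>x. \<bar>f x\<bar>) = l2norm L f" by (simp add: l2norm_def)
  also have "l2norm L (\<lambda>x. 1) = sqrt L" using assms by (simp add: l2norm_def measure_restrict_space)
  finally show ?thesis .
qed

text \<open>The partial sums are Cauchy in L2, hence in L1 on a bounded interval, so a subsequence
  converges almost everywhere. Fatou's lemma then bounds the L2 distance of the limit to each
  partial sum by the tail of the coefficient series.\<close>

lemma Riesz_Fischer_cos:
  assumes L: "L > 0" and c: "summable (\<lambda>n. (c n)\<^sup>2)"
  obtains f where "L2 L f" "\<And>n. ip L f (ce L n) = c n" "(\<lambda>n. (c n)\<^sup>2) sums ip L f f"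
proof -
  let ?M = "lebesgue_on {0..L}"
  define S where "S n = ce_sum L c {..<n}" for n
  define tail where "tail n = (\<Sum>k. (c (k + n))\<^sup>2)" for n
  have tail0: "tail \<longlonglongrightarrow> 0" unfolding tail_def by (rule suminf_exist_split2[OF c])
  have tail_nonneg: "tail n \<ge> 0" for n unfolding tail_def
    by (intro suminf_nonneg summable_ignore_initial_segment c) auto
  have L2S: "L2 L (S n)" for n unfolding S_def by (intro L2_ce_sum L) auto
  have dist: "ip L (\<lambda>x. S i x - S j x) (\<lambda>x. S i x - S j x) \<le> tail j" if "j \<le> i" for i j
  proof -
    have eq: "S i x - S j x = ce_sum L c {j..<i} x" for x
    proof -
      have "{..<i} = {..<j} \<union> {j..<i}" using that by auto
      thus ?thesis unfolding S_def ce_sum_def by (simp add: sum.union_disjoint ivl_disj_int)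
    qed
    have "ip L (\<lambda>x. S i x - S j x) (\<lambda>x. S i x - S j x) = (\<Sum>n\<in>{j..<i}. (c n)\<^sup>2)"
      unfolding eq using ip_ce_sum_self[OF L, of "{j..<i}" c] by simp
    also have "\<dots> = (\<Sum>k<i-j. (c (k + j))\<^sup>2)"
      by (rule sum.reindex_bij_witness[of _ "\<lambda>k. k + j" "\<lambda>n. n - j"]) auto
    also have "\<dots> \<le> tail j" unfolding tail_def
      by (intro sum_le_suminf summable_ignore_initial_segment c) auto
    finally show ?thesis .
  qed
  have dist': "(LINT x|?M. norm (S i x - S j x)) \<le> sqrt L * sqrt (tail j)" if "j \<le> i" for i j
  proof -
    have "(LINT x|?M. norm (S i x - S j x)) \<le> sqrt L * l2norm L (\<lambda>x. S i x - S j x)"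
      unfolding real_norm_def using L by (intro integral_abs_le_l2norm L2_diff L2S) auto
    also have "l2norm L (\<lambda>x. S i x - S j x) \<le> sqrt (tail j)"
      using dist[OF that] by (intro real_le_rsqrt) (simp add: l2norm_sq)
    finally show ?thesis using L by (simp add: mult_left_mono)
  qed
  have "\<exists>N. \<forall>i\<ge>N. \<forall>j\<ge>N. (LINT x|?M. norm (S i x - S j x)) < e" if e: "e > 0" for e
  proof -
    have "(\<lambda>n. sqrt L * sqrt (tail n)) \<longlonglongrightarrow> sqrt L * sqrt 0"
      by (intro tendsto_intros tail0)
    hence "eventually (\<lambda>n. sqrt L * sqrt (tail n) < e) sequentially"
      using e by (intro order_tendstoD(2)[of _ "sqrt L * sqrt 0"]) auto
    then obtain N where N: "\<And>n. n \<ge> N \<Longrightarrow> sqrt L * sqrt (tail n) < e"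
      unfolding eventually_sequentially by auto
    have "(LINT x|?M. norm (S i x - S j x)) < e" if "i \<ge> N" "j \<ge> N" for i j
    proof (cases "j \<le> i")
      case True
      thus ?thesis using dist'[OF True] N[OF that(2)] by linarith
    next
      case False
      hence "(LINT x|?M. norm (S j x - S i x)) < e" using dist'[of i j] N[OF that(1)] by simp
      thus ?thesis by (simp add: abs_minus_commute)
    qed
    thus ?thesis by blast
  qed
  with cauchy_L1_AE_cauchy_subseq[of ?M S] L2_integrable[OF L2S]
  obtain r where r: "strict_mono r" and cau: "AE x in ?M. Cauchy (\<lambda>i. S (r i) x)"
    by blast
  define f where "f x = lim (\<lambda>i. S (r i) x)" for x
  have lim: "AE x in ?M. (\<lambda>i. S (r i) x) \<longlonglongrightarrow> f x"
    using cau by eventually_elim (simp add: f_def Cauchy_convergent_iff convergent_LIMSEQ_iff)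
  have mS: "S n \<in> borel_measurable ?M" for n using L2S by (simp add: L2_def)
  have mf: "f \<in> borel_measurable ?M"
    unfolding f_def[abs_def] by (rule borel_measurable_lim_metric) (rule mS)
  have close: "L2 L (\<lambda>x. f x - S n x) \<and> ip L (\<lambda>x. f x - S n x) (\<lambda>x. f x - S n x) \<le> tail n" for n
  proof -
    have "(\<integral>\<^sup>+x. ennreal ((f x - S n x)\<^sup>2) \<partial>?M) = (\<integral>\<^sup>+x. liminf (\<lambda>i. ennreal ((S (r i) x - S n x)\<^sup>2)) \<partial>?M)"
    proof (rule nn_integral_cong_AE, use lim in eventually_elim)
      case (elim x)
      have "(\<lambda>i. ennreal ((S (r i) x - S n x)\<^sup>2)) \<longlonglongrightarrow> ennreal ((f x - S n x)\<^sup>2)"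
        by (intro tendsto_intros elim)
      thus ?case by (intro lim_imp_Liminf[symmetric]) (auto simp: tendsto_ennrealI)
    qed
    \<comment> \<open>Fatou's lemma; only eventual bounds along the subsequence are needed, so
      indices \<open>r i\<close> below \<open>n\<close> do not disturb.\<close>
    also have "\<dots> \<le> liminf (\<lambda>i. \<integral>\<^sup>+x. ennreal ((S (r i) x - S n x)\<^sup>2) \<partial>?M)"
      using mS by (intro nn_integral_liminf) measurable
    also have "\<dots> \<le> liminf (\<lambda>i. ennreal (tail n))"
    proof (rule Liminf_mono)
      have "eventually (\<lambda>i. n \<le> i) sequentially" by (rule eventually_ge_at_top)
      thus "eventually (\<lambda>i. (\<integral>\<^sup>+x. ennreal ((S (r i) x - S n x)\<^sup>2) \<partial>?M) \<le> ennreal (tail n)) sequentially"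
      proof eventually_elim
        case (elim i)
        hence "n \<le> r i" using seq_suble[OF r, of i] by simp
        moreover have "integrable ?M (\<lambda>x. (S (r i) x - S n x)\<^sup>2)"
          using L2_diff[OF L2S L2S] by (simp add: L2_def)
        ultimately show ?case using dist[of n "r i"]
          by (subst nn_integral_eq_integral) (auto simp: ip_def power2_eq_square intro!: ennreal_leI)
      qed
    qed
    also have "\<dots> = ennreal (tail n)" by (simp add: Liminf_const)
    finally have le: "(\<integral>\<^sup>+x. ennreal ((f x - S n x)\<^sup>2) \<partial>?M) \<le> ennreal (tail n)" .
    hence int: "integrable ?M (\<lambda>x. (f x - S n x)\<^sup>2)"
      using mf mS by (intro integrableI_bounded) (auto simp: le_less_trans[OF le])
    moreover have "ennreal (LINT x|?M. (f x - S n x)\<^sup>2) \<le> ennreal (tail n)"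
      using le by (subst nn_integral_eq_integral[OF int, symmetric]) auto
    hence "(LINT x|?M. (f x - S n x)\<^sup>2) \<le> tail n"
      using tail_nonneg by (simp add: ennreal_le_iff)
    ultimately show ?thesis using mf mS by (auto simp: L2_def ip_def power2_eq_square)
  qed
  have L2f: "L2 L f" using L2_add[OF conjunct1[OF close] L2S, of 0 0] by simp
  have norm0: "(\<lambda>n. l2norm L (\<lambda>x. f x - S n x)) \<longlonglongrightarrow> 0"
  proof (rule tendsto_sandwich[of "\<lambda>_. 0" _ _ "\<lambda>n. sqrt (tail n)"])
    show "(\<lambda>n. sqrt (tail n)) \<longlonglongrightarrow> 0" using tendsto_real_sqrt[OF tail0] by simp
    show "eventually (\<lambda>n. l2norm L (\<lambda>x. f x - S n x) \<le> sqrt (tail n)) sequentially"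
      using close by (intro always_eventually allI real_le_rsqrt) (simp add: l2norm_sq)
  qed (auto simp: l2norm_nonneg)
  have coeff: "ip L f (ce L m) = c m" for m
  proof -
    have "(\<lambda>n. ip L (\<lambda>x. f x - S n x) (ce L m)) \<longlonglongrightarrow> 0"
    proof (rule Lim_null_comparison)
      show "eventually (\<lambda>n. norm (ip L (\<lambda>x. f x - S n x) (ce L m)) \<le> l2norm L (\<lambda>x. f x - S n x) * l2norm L (ce L m)) sequentially"
        using ip_Cauchy_Schwarz[OF conjunct1[OF close] L2_ce[OF L]] by simp
      show "(\<lambda>n. l2norm L (\<lambda>x. f x - S n x) * l2norm L (ce L m)) \<longlonglongrightarrow> 0"
        using tendsto_mult_right[OF norm0, of "l2norm L (ce L m)"] by simp
    qed
    moreover have "eventually (\<lambda>n. ip L (\<lambda>x. f x - S n x) (ce L m) = ip L f (ce L m) - c m) sequentially"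
      using eventually_gt_at_top[of m]
      by eventually_elim (simp add: ip_diff L2f L2S L2_ce L, simp add: S_def ip_ce_sum_ce L)
    ultimately have "(\<lambda>n::nat. ip L f (ce L m) - c m) \<longlonglongrightarrow> 0"
      by (rule Lim_transform_eventually)
    thus ?thesis by (simp add: LIMSEQ_const_iff)
  qed
  have "(\<lambda>n. (c n)\<^sup>2) sums ip L f f"
    unfolding sums_def
  proof (rule Lim_transform2)
    have "(\<lambda>n. (l2norm L (\<lambda>x. f x - S n x))\<^sup>2) \<longlonglongrightarrow> 0" using tendsto_power[OF norm0, of 2] by simp
    moreover have "(l2norm L (\<lambda>x. f x - S n x))\<^sup>2 = ip L f f - (\<Sum>i<n. (c i)\<^sup>2)" for n
    proof -
      have a: "ip L (S n) f = (\<Sum>i<n. (c i)\<^sup>2)"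
        unfolding S_def using ip_ce_sum[OF L _ L2f, of "{..<n}" c] coeff
        by (simp add: ip_commute[of L "ce L _"] power2_eq_square)
      have b: "ip L (S n) (S n) = (\<Sum>i<n. (c i)\<^sup>2)" unfolding S_def by (rule ip_ce_sum_self[OF L]) simp
      show ?thesis
        using a b by (simp add: l2norm_sq ip_diff ip_diff_right L2_diff L2f L2S ip_commute[of L f "S n"])
    qed
    ultimately show "(\<lambda>n. ip L f f - (\<Sum>i<n. (c i)\<^sup>2)) \<longlonglongrightarrow> 0" by simp
  qed simp
  with that L2f coeff show ?thesis by blast
qed

lemma ce_coeff_unique:
  assumes L: "L > 0" and f: "integrable (lebesgue_on {0..L}) f" and g: "integrable (lebesgue_on {0..L}) g"
    and eq: "\<And>n. ip L f (ce L n) = ip L g (ce L n)"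
  shows "AE x in lebesgue_on {0..L}. f x = g x"
proof -
  have "AE x in lebesgue_on {0..L}. f x - g x = 0"
  proof (rule cos_complete[OF L])
    show "integrable (lebesgue_on {0..L}) (\<lambda>x. f x - g x)" using f g by simp
    fix n
    have c: "continuous_on {0..L} (\<lambda>x. cos (real n * pi * x / L))" using L by (intro continuous_intros) auto
    have "(LINT x|lebesgue_on {0..L}. f x * cos (real n * pi * x / L)) = (LINT x|lebesgue_on {0..L}. g x * cos (real n * pi * x / L))"
    proof -
      define s where "s = (if n = 0 then sqrt (1 / L) else sqrt (2 / L))"
      have "ip L h (ce L n) = s * (LINT x|lebesgue_on {0..L}. h x * cos (real n * pi * x / L))" for h
        unfolding ip_def ce_def s_def by (subst mult.left_commute) (rule integral_mult_right_zero)
      moreover have "s \<noteq> 0" using L by (simp add: s_def)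
      ultimately show ?thesis using eq[of n] by simp
    qed
    thus "(LINT x|lebesgue_on {0..L}. (f x - g x) * cos (real n * pi * x / L)) = 0"
      using integrable_mult_continuous[OF f c] integrable_mult_continuous[OF g c]
      by (simp add: left_diff_distrib)
  qed
  thus ?thesis by eventually_elim simp
qed

lemma Bessel:
  assumes L: "L > 0" and f: "L2 L f"
  shows "(\<Sum>i<n. (ip L f (ce L i))\<^sup>2) \<le> ip L f f"
proof -
  define S where "S = ce_sum L (\<lambda>i. ip L f (ce L i)) {..<n}"
  have L2S: "L2 L S" unfolding S_def by (rule L2_ce_sum[OF L]) simp
  have a: "ip L S f = (\<Sum>i<n. (ip L f (ce L i))\<^sup>2)"
    unfolding S_def using ip_ce_sum[OF L _ f, of "{..<n}"]
    by (simp add: ip_commute[of L "ce L _"] power2_eq_square)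
  have b: "ip L S S = (\<Sum>i<n. (ip L f (ce L i))\<^sup>2)" unfolding S_def by (rule ip_ce_sum_self[OF L]) simp
  have "0 \<le> ip L (\<lambda>x. f x - S x) (\<lambda>x. f x - S x)" by (rule ip_self_nonneg)
  also have "\<dots> = ip L f f - (\<Sum>i<n. (ip L f (ce L i))\<^sup>2)"
    using a b by (simp add: ip_diff ip_diff_right L2_diff f L2S ip_commute[of L f S])
  finally show ?thesis by simp
qed

text \<open>Bessel makes the coefficients square summable, Riesz-Fischer builds a function from them
  whose norm is the sum of squares, and completeness identifies that function with f almost
  everywhere.\<close>

lemma Parseval:
  assumes L: "L > 0" and f: "L2 L f"
  shows "(\<lambda>n. (ip L f (ce L n))\<^sup>2) sums ip L f f"
proof -
  have "summable (\<lambda>n. (ip L f (ce L n))\<^sup>2)"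
    using Bessel[OF L f, of "Suc _"] by (intro bounded_imp_summable) (auto simp: lessThan_Suc_atMost)
  from Riesz_Fischer_cos[OF L this] obtain g where g: "L2 L g"
    "\<And>n. ip L g (ce L n) = ip L f (ce L n)" "(\<lambda>n. (ip L f (ce L n))\<^sup>2) sums ip L g g"
    by blast
  have ae: "AE x in lebesgue_on {0..L}. g x = f x"
    using ce_coeff_unique[OF L] L2_integrable f g by blast
  have "(LINT x|lebesgue_on {0..L}. g x * g x) = (LINT x|lebesgue_on {0..L}. f x * f x)"
    using ae f g(1) by (intro integral_cong_AE) (auto simp: L2_def)
  thus ?thesis using g(3) by (simp add: ip_def)
qed

text \<open>Polarization of the quadratic identity.\<close>

lemma Parseval_bilinear:
  assumes L: "L > 0" and f: "L2 L f" and g: "L2 L g"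
  shows "(\<lambda>n. ip L f (ce L n) * ip L g (ce L n)) sums ip L f g"
proof -
  have "(\<lambda>n. ((ip L (\<lambda>x. f x + g x) (ce L n))\<^sup>2 - (ip L (\<lambda>x. f x - g x) (ce L n))\<^sup>2) / 4) sums
      ((ip L (\<lambda>x. f x + g x) (\<lambda>x. f x + g x) - ip L (\<lambda>x. f x - g x) (\<lambda>x. f x - g x)) / 4)"
    by (intro sums_divide sums_diff Parseval L L2_add L2_diff f g)
  moreover have "((ip L (\<lambda>x. f x + g x) (ce L n))\<^sup>2 - (ip L (\<lambda>x. f x - g x) (ce L n))\<^sup>2) / 4
      = ip L f (ce L n) * ip L g (ce L n)" for n
    by (simp add: ip_add ip_diff f g L2_ce L power2_eq_square algebra_simps)
  moreover have "(ip L (\<lambda>x. f x + g x) (\<lambda>x. f x + g x) - ip L (\<lambda>x. f x - g x) (\<lambda>x. f x - g x)) / 4 = ip L f g"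
    by (simp add: ip_add ip_diff ip_add_right ip_diff_right f g L2_add L2_diff ip_commute[of L g f])
  ultimately show ?thesis by simp
qed

section \<open>Test functions and weak derivatives\<close>

text \<open>The functions \<open>flat k p\<close> with \<open>p\<close> a polynomial are closed under differentiation, which makes
  every \<open>flat k p\<close> smooth; test functions are products of two of them.\<close>

definition flat :: "real \<Rightarrow> real poly \<Rightarrow> real \<Rightarrow> real" where
  "flat k p x = (if x \<le> 0 then 0 else poly p (1 / x) * exp (- 1 / (k * x)))"

text \<open>In the variable y = 1/x this is the fact that the exponential beats every polynomial at
  infinity.\<close>

lemma flat_right_limit:
  assumes k: "k > 0"
  shows "(flat k p \<longlongrightarrow> 0) (at_right 0)"
proof -
  have pow: "((\<lambda>y. y ^ n * exp (- y / k)) \<longlongrightarrow> 0) at_top" for n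
  proof -
    have "((\<lambda>z. k ^ n * (z ^ n / exp z)) \<longlongrightarrow> k ^ n * 0) at_top"
      by (intro tendsto_intros tendsto_power_div_exp_0)
    hence "((\<lambda>y. k ^ n * ((y / k) ^ n / exp (y / k))) \<longlongrightarrow> k ^ n * 0) at_top"
      by (rule filterlim_compose) (use k in real_asymp)
    moreover have "k ^ n * ((y / k) ^ n / exp (y / k)) = y ^ n * exp (- y / k)" for y
      using k by (simp add: power_divide exp_minus field_simps)
    ultimately show ?thesis by simp
  qed
  have "((\<lambda>y. \<Sum>i\<le>degree p. coeff p i * (y ^ i * exp (- y / k))) \<longlongrightarrow> (\<Sum>i\<le>degree p. coeff p i * 0)) at_top"
    by (intro tendsto_intros pow)
  hence "((\<lambda>y. poly p y * exp (- y / k)) \<longlongrightarrow> 0) at_top"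
    by (simp add: poly_altdef sum_distrib_right mult.assoc)
  hence "((\<lambda>x. poly p (inverse x) * exp (- inverse x / k)) \<longlongrightarrow> 0) (at_right 0)"
    by (rule filterlim_compose[OF _ filterlim_inverse_at_top_right])
  moreover have "eventually (\<lambda>x. poly p (inverse x) * exp (- inverse x / k) = flat k p x) (at_right 0)"
    using eventually_at_right_less[of 0]
    by eventually_elim (use k in \<open>simp add: flat_def divide_simps\<close>)
  ultimately show ?thesis by (rule Lim_transform_eventually)
qed

text \<open>In the variable y = 1/x the derivative d/dx is - y^2 d/dy, and applied to p(y) exp(-
  y/k) it produces the polynomial y^2 (p/k - p'). At 0 the right difference quotient is again of the
  form \<open>flat\<close>, for the polynomial y p, so it tends to 0.\<close>

lemma flat_has_derivative:
  assumes k: "k > 0"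
  shows "(flat k p has_real_derivative flat k ([:0, 0, 1:] * (smult (1 / k) p - pderiv p)) x) (at x)"
proof -
  let ?q = "[:0, 0, 1:] * (smult (1 / k) p - pderiv p)"
  consider "x < 0" | "x > 0" | "x = 0" by linarith
  thus ?thesis
  proof cases
    case 1
    have "((\<lambda>x. 0 :: real) has_real_derivative 0) (at x)" by simp
    hence "(flat k p has_real_derivative 0) (at x)"
      by (rule has_field_derivative_transform_within_open[where S="{..<0}"]) (use 1 in \<open>auto simp: flat_def\<close>)
    thus ?thesis using 1 by (simp add: flat_def)
  next
    case 2
    have "((\<lambda>x. poly p (1 / x) * exp (- 1 / (k * x))) has_real_derivative flat k ?q x) (at x)"
      using 2 k
      by (auto intro!: derivative_eq_intros poly_DERIV[THEN DERIV_chain2] simp: flat_def power2_eq_square)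
        (simp add: field_simps)
    thus ?thesis
      by (rule has_field_derivative_transform_within_open[where S="{0<..}"]) (use 2 in \<open>auto simp: flat_def\<close>)
  next
    case 3
    have "((\<lambda>y. (flat k p y - flat k p 0) / (y - 0)) \<longlongrightarrow> 0) (at 0)"
    proof (rule filterlim_split_at)
      have "eventually (\<lambda>y. (flat k p y - flat k p 0) / (y - 0) = 0) (at_left (0::real))"
        by (auto simp: eventually_at flat_def intro!: exI[of _ 1])
      thus "((\<lambda>y. (flat k p y - flat k p 0) / (y - 0)) \<longlongrightarrow> 0) (at_left 0)"
        by (rule tendsto_eventually)
      have "eventually (\<lambda>y. flat k ([:0, 1:] * p) y = (flat k p y - flat k p 0) / (y - 0)) (at_right (0::real))"
        using eventually_at_right_less[of 0] by eventually_elim (simp add: flat_def)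
      with flat_right_limit[OF k]
      show "((\<lambda>y. (flat k p y - flat k p 0) / (y - 0)) \<longlongrightarrow> 0) (at_right 0)"
        by (rule Lim_transform_eventually)
    qed
    thus ?thesis using 3 by (simp add: has_field_derivative_iff flat_def)
  qed
qed

text \<open>A span rather than single products, because the product rule produces sums;
  \<open>p\<close> and \<open>q\<close> are independent since only one factor is differentiated at a
  time. The parameter \<open>k\<close> exists for the limit of large k, in which the bumps with p =
  q = 1 tend to the indicator of (a, b).\<close>

inductive bump_span :: "real \<Rightarrow> (real \<Rightarrow> real) \<Rightarrow> bool" for L where
  basic: "0 < a \<Longrightarrow> a < b \<Longrightarrow> b < L \<Longrightarrow> 0 < k \<Longrightarrow> bump_span L (\<lambda>x. flat k p (x - a) * flat k q (b - x))"
| add: "bump_span L f \<Longrightarrow> bump_span L g \<Longrightarrow> bump_span L (\<lambda>x. f x + g x)"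
| scale: "bump_span L f \<Longrightarrow> bump_span L (\<lambda>x. c * f x)"

lemma bump_span_derivative:
  assumes "bump_span L f"
  shows "\<exists>g. bump_span L g \<and> (\<forall>x. (f has_real_derivative g x) (at x))"
  using assms
proof (induction rule: bump_span.induct)
  case (basic a b k p q)
  define D where "D r = [:0, 0, 1:] * (smult (1 / k) r - pderiv r)" for r :: "real poly"
  have 1: "((\<lambda>x. flat k p (x - a)) has_real_derivative flat k (D p) (x - a)) (at x)" for x
  proof -
    have "((\<lambda>x. x - a) has_real_derivative 1) (at x)" by (auto intro!: derivative_eq_intros)
    from DERIV_chain2[OF flat_has_derivative[OF basic(4)] this, of p] show ?thesis by (simp add: D_def)
  qed
  have 2: "((\<lambda>x. flat k q (b - x)) has_real_derivative - flat k (D q) (b - x)) (at x)" for x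
  proof -
    have "((\<lambda>x. b - x) has_real_derivative - 1) (at x)" by (auto intro!: derivative_eq_intros)
    from DERIV_chain2[OF flat_has_derivative[OF basic(4)] this, of q] show ?thesis by (simp add: D_def)
  qed
  let ?g = "\<lambda>x. flat k (D p) (x - a) * flat k q (b - x) + (-1) * (flat k p (x - a) * flat k (D q) (b - x))"
  have "bump_span L ?g"
    by (rule bump_span.add[OF bump_span.basic bump_span.scale[OF bump_span.basic]]) (use basic in auto)
  moreover have "((\<lambda>x. flat k p (x - a) * flat k q (b - x)) has_real_derivative ?g x) (at x)" for x
    by (rule derivative_eq_intros 1 2 refl)+ simp
  ultimately show ?case by blast
next
  case (add f g)
  then obtain f' g' where "bump_span L f'" "bump_span L g'"
    "\<And>x. (f has_real_derivative f' x) (at x)" "\<And>x. (g has_real_derivative g' x) (at x)" by blast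
  thus ?case by (intro exI[of _ "\<lambda>x. f' x + g' x"]) (auto intro!: bump_span.add derivative_intros)
next
  case (scale f c)
  then obtain f' where "bump_span L f'" "\<And>x. (f has_real_derivative f' x) (at x)" by blast
  thus ?case by (intro exI[of _ "\<lambda>x. c * f' x"]) (auto intro!: bump_span.scale DERIV_cmult)
qed

lemma bump_span_deriv: "bump_span L f \<Longrightarrow> bump_span L (deriv f)"
proof -
  assume "bump_span L f"
  then obtain g where "bump_span L g" "\<And>x. (f has_real_derivative g x) (at x)"
    using bump_span_derivative by blast
  moreover from this(2) have "deriv f = g" by (intro ext DERIV_imp_deriv)
  ultimately show ?thesis by simp
qed

lemma bump_span_deriv_power: "bump_span L f \<Longrightarrow> bump_span L ((deriv ^^ k) f)"
  by (induction k) (simp_all add: bump_span_deriv)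

lemma bump_span_differentiable: "bump_span L f \<Longrightarrow> f differentiable (at x)"
  using bump_span_derivative[of L f] by (auto simp: real_differentiable_def)

lemma bump_span_support:
  assumes "bump_span L f"
  shows "\<exists>a b. 0 < a \<and> a < b \<and> b < L \<and> (\<forall>x. x \<notin> {a..b} \<longrightarrow> f x = 0)"
  using assms
proof (induction rule: bump_span.induct)
  case (basic a b k p q)
  thus ?case by (intro exI[of _ a] exI[of _ b]) (auto simp: flat_def)
next
  case (add f g)
  then obtain a b c d where "0 < a" "a < b" "b < L" "\<forall>x. x \<notin> {a..b} \<longrightarrow> f x = 0"
     "0 < c" "c < d" "d < L" "\<forall>x. x \<notin> {c..d} \<longrightarrow> g x = 0" by blast
  thus ?case by (intro exI[of _ "min a c"] exI[of _ "max b d"]) (auto simp: min_def max_def)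
qed auto

lemma bump_span_test_fun: "bump_span L f \<Longrightarrow> test_fun L f"
  unfolding test_fun_def using bump_span_support[of L f]
  by (auto intro: bump_span_differentiable bump_span_deriv_power)

lemma bump_span_continuous: "bump_span L f \<Longrightarrow> continuous_on A f"
  by (meson bump_span_differentiable differentiable_imp_continuous_within continuous_at_imp_continuous_on)

section \<open>Fundamental lemma and du Bois-Reymond lemma\<close>

text \<open>Zero mean makes the primitive vanish to the right of the support; to its left it
  vanishes in any case. So a bump with zero mean is the derivative of a test function.\<close>

lemma bump_span_primitive:
  assumes f: "bump_span L f" and f0: "integral {0..L} f = 0"
  shows "test_fun L (\<lambda>x. integral {0..x} f)" "deriv (\<lambda>x. integral {0..x} f) = f"
proof -
  let ?F = "\<lambda>x. integral {0..x} f"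
  obtain a b where ab: "0 < a" "a < b" "b < L" "\<And>x. x \<notin> {a..b} \<Longrightarrow> f x = 0"
    using bump_span_support[OF f] by blast
  have int: "f integrable_on {u..v}" for u v by (intro integrable_continuous_real bump_span_continuous[OF f])
  have low: "?F x = 0" if "x < a" for x
  proof -
    have "?F x = integral {0..x} (\<lambda>x. 0)" by (rule integral_cong) (use that ab(4) in auto)
    thus ?thesis by simp
  qed
  have high: "?F x = 0" if "b < x" for x
  proof (cases "x \<le> L")
    case True
    have "integral {x..L} f = integral {x..L} (\<lambda>x. 0)" by (rule integral_cong) (use that ab(4) in auto)
    thus ?thesis using Henstock_Kurzweil_Integration.integral_combine[of 0 x L f] True that ab f0 int by simp
  next
    case False
    have "integral {L..x} f = integral {L..x} (\<lambda>x. 0)" by (rule integral_cong) (use False ab in auto)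
    thus ?thesis using Henstock_Kurzweil_Integration.integral_combine[of 0 L x f] False ab f0 int by simp
  qed
  have D: "(?F has_real_derivative f x) (at x)" for x
  proof (cases "x < a")
    case True
    have "((\<lambda>x. 0 :: real) has_real_derivative 0) (at x)" by simp
    hence "(?F has_real_derivative 0) (at x)"
      by (rule has_field_derivative_transform_within_open[where S="{..<a}"]) (use True low in auto)
    thus ?thesis using True ab(4)[of x] by simp
  next
    case False
    hence x: "0 < x" using ab by simp
    have "(?F has_real_derivative f x) (at x within {0..x+1})"
      by (rule integral_has_real_derivative[OF bump_span_continuous[OF f]]) (use x in auto)
    thus ?thesis using x by (subst (asm) at_within_interior) auto
  qed
  show d: "deriv ?F = f" using DERIV_imp_deriv[OF D] by auto
  have "(deriv ^^ k) ?F differentiable (at x)" for k x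
  proof (cases k)
    case 0
    thus ?thesis using D[of x] by (auto simp: real_differentiable_def)
  next
    case (Suc j)
    hence "(deriv ^^ k) ?F = (deriv ^^ j) f" using d by (simp add: funpow_swap1)
    thus ?thesis using bump_span_differentiable[OF bump_span_deriv_power[OF f]] by simp
  qed
  moreover have "\<forall>x. x \<notin> {a..b} \<longrightarrow> ?F x = 0" using low high by auto
  ultimately show "test_fun L ?F" unfolding test_fun_def using ab by blast
qed

text \<open>The bumps with p = q = 1 and k = m + 1 are bounded by 1 and tend pointwise to the
  indicator of (a, b), so dominated convergence gives a vanishing integral of g over [a, b].\<close>

lemma bump_span_approx_indicator:
  assumes L: "L > 0" and g: "integrable (lebesgue_on {0..L}) g" and ab: "0 < a" "a < b" "b < L"
    and orth: "\<And>\<theta>. bump_span L \<theta> \<Longrightarrow> ip L g \<theta> = 0"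
  shows "integral {0..a} g = integral {0..b} g"
proof -
  let ?M = "lebesgue_on {0..L}"
  define \<theta> where "\<theta> m x = flat (real (Suc m)) 1 (x - a) * flat (real (Suc m)) 1 (b - x)" for m x
  have sp: "bump_span L (\<theta> m)" for m
    unfolding \<theta>_def[abs_def] by (rule bump_span.basic) (use ab in auto)
  have bd: "\<bar>flat (real (Suc m)) 1 x\<bar> \<le> 1" for m x by (auto simp: flat_def)
  have lim1: "(\<lambda>m. flat (real (Suc m)) 1 x) \<longlonglongrightarrow> indicator {0<..} x" for x
  proof (cases "x > 0")
    case True
    have "(\<lambda>m. exp (- (inverse (real (Suc m)) * (1 / x)))) \<longlonglongrightarrow> exp (- (0 * (1 / x)))"
      by (intro tendsto_intros LIMSEQ_inverse_real_of_nat)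
    thus ?thesis using True by (simp add: flat_def divide_simps)
  qed (simp add: flat_def)
  have "(\<lambda>m. LINT x|?M. g x * \<theta> m x) \<longlonglongrightarrow> (LINT x|?M. g x * indicator {a<..<b} x)"
  proof (rule integral_dominated_convergence[where w="\<lambda>x. \<bar>g x\<bar>"])
    show "(\<lambda>x. g x * indicator {a<..<b} x) \<in> borel_measurable ?M"
      using borel_measurable_integrable[OF integrable_indicator_mult[OF g, of "{a<..<b}"]] by (simp add: mult.commute)
    show "(\<lambda>x. g x * \<theta> m x) \<in> borel_measurable ?M" for m
      by (intro borel_measurable_integrable integrable_mult_continuous g bump_span_continuous[OF sp])
    show "integrable ?M (\<lambda>x. \<bar>g x\<bar>)" using g by simp
    show "AE x in ?M. norm (g x * \<theta> m x) \<le> \<bar>g x\<bar>" for m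
    proof (rule AE_I2)
      fix x
      have "\<bar>\<theta> m x\<bar> \<le> 1 * 1" unfolding \<theta>_def abs_mult by (intro mult_mono bd) auto
      thus "norm (g x * \<theta> m x) \<le> \<bar>g x\<bar>" using mult_left_mono[of "\<bar>\<theta> m x\<bar>" 1 "\<bar>g x\<bar>"] by (simp add: abs_mult)
    qed
    show "AE x in ?M. (\<lambda>m. g x * \<theta> m x) \<longlonglongrightarrow> g x * indicator {a<..<b} x"
    proof (rule AE_I2)
      fix x
      have "(\<lambda>m. g x * \<theta> m x) \<longlonglongrightarrow> g x * (indicator {0<..} (x - a) * indicator {0<..} (b - x))"
        unfolding \<theta>_def by (intro tendsto_intros lim1)
      also have "indicator {0<..} (x - a) * indicator {0<..} (b - x) = (indicator {a<..<b} x :: real)"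
        by (auto simp: indicator_def)
      finally show "(\<lambda>m. g x * \<theta> m x) \<longlonglongrightarrow> g x * indicator {a<..<b} x" .
    qed
  qed
  hence "(LINT x|?M. indicator {a<..<b} x * g x) = 0"
    using orth[OF sp] by (simp add: ip_def LIMSEQ_const_iff mult.commute)
  moreover have "(LINT x|?M. indicator {a<..<b} x * g x) = integral {0..L} (\<lambda>x. indicator {a<..<b} x * g x)"
    by (rule lebesgue_integral_eq_integral[OF integrable_indicator_mult[OF g]]) auto
  moreover have "\<dots> = integral {0..L} (\<lambda>x. if x \<in> {a..b} then g x else 0)"
    by (rule integral_spike[of "{a,b}"]) (auto simp: indicator_def)
  moreover have "\<dots> = integral {a..b} g"
    using ab by (subst integral_restrict_Int) (auto intro!: arg_cong2[of _ _ _ _ integral])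
  moreover have "g integrable_on {0..b}"
    by (rule integrable_on_subinterval[OF integrable_on_lebesgue_on[OF g]]) (use ab in auto)
  ultimately show ?thesis
    using Henstock_Kurzweil_Integration.integral_combine[of 0 a b g] ab by simp
qed

text \<open>Integration by parts moves the primitive onto the derivative of each cosine, so all
  cosine coefficients of g vanish. Completeness of the cosines thus stands in for Lebesgue
  differentiation.\<close>

lemma AE_0_if_primitive_0:
  fixes g :: "real \<Rightarrow> real"
  assumes L: "L > 0" and g: "integrable (lebesgue_on {0..L}) g"
    and P: "\<And>x. x \<in> {0..L} \<Longrightarrow> integral {0..x} g = 0"
  shows "AE x in lebesgue_on {0..L}. g x = 0"
proof (rule cos_complete[OF L g])
  fix n
  let ?c = "\<lambda>x. cos (real n * pi * x / L)" and ?s = "\<lambda>x. - (real n * pi / L) * sin (real n * pi * x / L)"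
  have "ip L g ?c = integral {0..L} g * ?c L - 0 * ?c 0 - ip L (\<lambda>x. integral {0..x} g) ?s"
  proof -
    have s: "integrable (lebesgue_on {0..L}) ?s"
      using L by (intro continuous_imp_integrable_real continuous_intros) auto
    have c: "?c x = ?c 0 + integral {0..x} ?s" if x: "x \<in> {0..L}" for x
    proof -
      have "(?s has_integral ?c x - ?c 0) {0..x}"
      using L x
      by (intro fundamental_theorem_of_calculus)
        (auto intro!: derivative_eq_intros simp flip: has_real_derivative_iff_has_vector_derivative)
      thus ?thesis by (simp only: integral_unique)
    qed
    have "ip L g ?c = integral {0..L} g * ?c L - integral {0..0} g * ?c 0 - ip L (\<lambda>x. integral {0..x} g) ?s"
      by (rule primitive_by_parts_affine[OF g s _ _ c, of "\<lambda>x. integral {0..x} g"]) (use L in simp_all)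
    moreover have "integral {0..0} g = 0" by simp
    ultimately show ?thesis by (simp only:)
  qed
  also have "ip L (\<lambda>x. integral {0..x} g) ?s = (LINT x|lebesgue_on {0..L}. 0)"
    unfolding ip_def by (rule Bochner_Integration.integral_cong) (auto simp: P space_restrict_space)
  finally show "(LINT x|lebesgue_on {0..L}. g x * ?c x) = 0" using P[of L] L by (simp add: ip_def)
qed

text \<open>The primitive of g is constant on the open interval by comparison with its value at L/2,
  by continuity on the closed one, and it is 0 at 0.\<close>

lemma fundamental_lemma:
  assumes L: "L > 0" and g: "integrable (lebesgue_on {0..L}) g"
    and orth: "\<And>\<theta>. bump_span L \<theta> \<Longrightarrow> ip L g \<theta> = 0"
  shows "AE x in lebesgue_on {0..L}. g x = 0"
proof (rule AE_0_if_primitive_0[OF L g])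
  let ?P = "\<lambda>x. integral {0..x} g"
  have cont: "continuous_on {0..L} ?P" by (rule continuous_on_primitive[OF g])
  have eq: "?P x = ?P (L/2)" if "x \<in> {0<..<L}" for x
  proof (cases x "L/2" rule: linorder_cases)
    case less
    show ?thesis by (rule bump_span_approx_indicator[OF L g _ less _ orth]) (use that L in auto)
  next
    case greater
    show ?thesis by (rule bump_span_approx_indicator[OF L g _ greater _ orth, symmetric]) (use that L in auto)
  qed (simp only:)
  have cl: "closure {0<..<L} = {0..L}" using L by simp
  have all: "?P x = ?P (L/2)" if "x \<in> {0..L}" for x
    by (rule continuous_constant_on_closure[of "{0<..<L}" ?P, OF _ eq]) (use cont that cl in simp_all)
  show "?P x = 0" if "x \<in> {0..L}" for x
    using all[OF that] all[of 0, symmetric] L by simp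
qed

text \<open>Any bump differs from a multiple of one fixed bump \<open>\<eta>\<close> by a bump of
  zero mean, which is the derivative of a test function. Hence the pairing with f depends only on
  the mean, and f acts as a constant.\<close>

lemma du_Bois_Reymond:
  assumes L: "L > 0" and f: "integrable (lebesgue_on {0..L}) f"
    and orth: "\<And>\<psi>. test_fun L \<psi> \<Longrightarrow> ip L f (deriv \<psi>) = 0"
  shows "\<exists>c. AE x in lebesgue_on {0..L}. f x = c"
proof -
  let ?M = "lebesgue_on {0..L}"
  define \<eta> where "\<eta> x = flat 1 1 (x - L/4) * flat 1 1 (L/2 - x)" for x
  have \<eta>: "bump_span L \<eta>" unfolding \<eta>_def[abs_def] by (rule bump_span.basic) (use L in auto)
  have I: "integral {0..L} \<eta> \<noteq> 0"
  proof
    assume "integral {0..L} \<eta> = 0"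
    hence "\<forall>x\<in>cbox 0 L. \<eta> x = 0"
      using bump_span_continuous[OF \<eta>] L
      by (subst integral_cbox_eq_0_iff[symmetric]) (auto simp: \<eta>_def flat_def)
    \<comment> \<open>L/3 lies strictly inside the support [L/4, L/2] of
      \<open>\<eta>\<close>.\<close>
    moreover have "\<eta> (L/3) \<noteq> 0" using L by (auto simp: \<eta>_def flat_def)
    ultimately show False using L by auto
  qed
  define c where "c = ip L f \<eta> / integral {0..L} \<eta>"
  have "AE x in ?M. f x - c = 0"
  proof (rule fundamental_lemma[OF L])
    have "integrable ?M (\<lambda>x. c)" by (rule continuous_imp_integrable_real) simp
    thus "integrable ?M (\<lambda>x. f x - c)" using f by simp
    fix \<theta> assume \<theta>: "bump_span L \<theta>"
    \<comment> \<open>The multiple of \<open>\<eta>\<close> that has the same integral as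
      \<open>\<theta>\<close>.\<close>
    define s where "s = integral {0..L} \<theta> / integral {0..L} \<eta>"
    have \<theta>': "bump_span L (\<lambda>x. \<theta> x + (- s) * \<eta> x)" by (intro bump_span.add bump_span.scale \<theta> \<eta>)
    have int: "\<theta> integrable_on {0..L}" "\<eta> integrable_on {0..L}"
      by (intro integrable_continuous_real bump_span_continuous[OF \<theta>] bump_span_continuous[OF \<eta>])+
    have "integral {0..L} (\<lambda>x. \<theta> x + (- s) * \<eta> x) = integral {0..L} \<theta> - s * integral {0..L} \<eta>"
      using int by (subst Henstock_Kurzweil_Integration.integral_add) (auto intro!: integrable_neg integrable_on_mult_right)
    also have "\<dots> = 0" using I by (simp add: s_def)
    finally have "ip L f (\<lambda>x. \<theta> x + (- s) * \<eta> x) = 0"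
      using orth[OF bump_span_primitive(1)[OF \<theta>']] bump_span_primitive(2)[OF \<theta>'] by simp
    moreover have fi: "integrable ?M (\<lambda>x. f x * \<theta> x)" "integrable ?M (\<lambda>x. f x * \<eta> x)"
      by (intro integrable_mult_continuous f bump_span_continuous[OF \<theta>] bump_span_continuous[OF \<eta>])+
    hence "ip L f (\<lambda>x. \<theta> x + (- s) * \<eta> x) = ip L f \<theta> - s * ip L f \<eta>"
      by (simp add: ip_def right_diff_distrib mult.left_commute)
    ultimately have 1: "ip L f \<theta> = s * ip L f \<eta>" by simp
    have \<theta>i: "integrable ?M \<theta>" by (intro continuous_imp_integrable_real bump_span_continuous[OF \<theta>])
    have "ip L (\<lambda>x. f x - c) \<theta> = ip L f \<theta> - c * integral {0..L} \<theta>"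
      using fi \<theta>i by (simp add: ip_def left_diff_distrib lebesgue_integral_eq_integral)
    also have "\<dots> = 0" unfolding 1 using I by (simp add: s_def c_def)
    finally show "ip L (\<lambda>x. f x - c) \<theta> = 0" .
  qed
  thus ?thesis by auto
qed

section \<open>Weak derivatives are derivatives of primitives\<close>

lemma test_fun_facts:
  assumes "test_fun L \<psi>"
  shows "continuous_on A (deriv \<psi>)" "continuous_on A \<psi>" "\<psi> 0 = 0" "\<psi> L = 0"
    "0 \<le> x \<Longrightarrow> \<psi> x = \<psi> 0 + integral {0..x} (deriv \<psi>)"
proof -
  have d: "(deriv ^^ k) \<psi> differentiable (at x)" for k x using assms by (auto simp: test_fun_def)
  have d0: "\<psi> differentiable (at x)" "deriv \<psi> differentiable (at x)" for x
    using d[of 0 x] d[of 1 x] by auto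
  show "continuous_on A (deriv \<psi>)" "continuous_on A \<psi>"
    using d0 by (auto intro!: continuous_at_imp_continuous_on differentiable_imp_continuous_within)
  show "\<psi> 0 = 0" "\<psi> L = 0" using assms unfolding test_fun_def by (metis atLeastAtMost_iff not_le)+
  assume x: "0 \<le> x"
  have "(\<psi> has_real_derivative deriv \<psi> y) (at y)" for y
    using d0(1)[of y] by (metis DERIV_deriv_iff_real_differentiable)
  hence "(deriv \<psi> has_integral \<psi> x - \<psi> 0) {0..x}"
    using x by (intro fundamental_theorem_of_calculus)
      (auto simp flip: has_real_derivative_iff_has_vector_derivative intro: has_field_derivative_at_within)
  thus "\<psi> x = \<psi> 0 + integral {0..x} (deriv \<psi>)" by (auto dest!: integral_unique)
qed

lemma primitive_weak_deriv:
  assumes L: "L > 0" and f: "integrable (lebesgue_on {0..L}) f" and g: "integrable (lebesgue_on {0..L}) g"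
    and ae: "AE x in lebesgue_on {0..L}. f x = c + integral {0..x} g"
  shows "weak_deriv L f g"
  unfolding weak_deriv_def
proof (intro conjI f g allI impI)
  fix \<psi> assume \<psi>: "test_fun L \<psi>"
  let ?F = "\<lambda>x. c + integral {0..x} g"
  note T = test_fun_facts[OF \<psi>]
  have int: "integrable (lebesgue_on {0..L}) (deriv \<psi>)" by (intro continuous_imp_integrable_real T)
  have "ip L g \<psi> = ?F L * \<psi> L - ?F 0 * \<psi> 0 - ip L ?F (deriv \<psi>)"
    by (rule primitive_by_parts_affine[OF g int _ _ T(5)]) (use L in simp_all)
  moreover have "ip L f (deriv \<psi>) = ip L ?F (deriv \<psi>)"
    by (rule ip_cong_AE[OF ae]) (use f int in auto)
  ultimately show "ip L f (deriv \<psi>) = - ip L g \<psi>" using T(3,4) by simp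
qed

text \<open>Subtracting the primitive of g leaves a function with weak derivative 0, which is
  constant by \<open>du_Bois_Reymond\<close>. This supplies the absolutely continuous representative
  used for boundary values.\<close>

lemma weak_deriv_imp_primitive:
  assumes L: "L > 0" and wd: "weak_deriv L f g"
  shows "\<exists>c. AE x in lebesgue_on {0..L}. f x = c + integral {0..x} g"
proof -
  let ?G = "\<lambda>x. integral {0..x} g"
  have f: "integrable (lebesgue_on {0..L}) f" and g: "integrable (lebesgue_on {0..L}) g"
    and w: "\<And>\<psi>. test_fun L \<psi> \<Longrightarrow> ip L f (deriv \<psi>) = - ip L g \<psi>"
    using wd by (auto simp: weak_deriv_def)
  have iG: "integrable (lebesgue_on {0..L}) ?G" by (intro continuous_imp_integrable_real continuous_on_primitive g)
  have wG: "weak_deriv L ?G g" by (rule primitive_weak_deriv[OF L iG g, of 0]) simp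
  have "\<exists>c. AE x in lebesgue_on {0..L}. f x - ?G x = c"
  proof (rule du_Bois_Reymond[OF L])
    show "integrable (lebesgue_on {0..L}) (\<lambda>x. f x - ?G x)" using f iG by simp
    fix \<psi> assume \<psi>: "test_fun L \<psi>"
    have "ip L (\<lambda>x. f x - ?G x) (deriv \<psi>) = ip L f (deriv \<psi>) - ip L ?G (deriv \<psi>)"
      using integrable_mult_continuous[OF f test_fun_facts(1)[OF \<psi>]]
        integrable_mult_continuous[OF iG test_fun_facts(1)[OF \<psi>]]
      by (simp add: ip_def left_diff_distrib)
    also have "\<dots> = 0" using w[OF \<psi>] wG \<psi> by (simp add: weak_deriv_def)
    finally show "ip L (\<lambda>x. f x - ?G x) (deriv \<psi>) = 0" .
  qed
  then obtain c where "AE x in lebesgue_on {0..L}. f x - ?G x = c" by blast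
  hence "AE x in lebesgue_on {0..L}. f x = c + ?G x" by eventually_elim auto
  thus ?thesis by blast
qed

lemma primitive_cong_AE:
  fixes f g :: "real \<Rightarrow> real"
  assumes "integrable (lebesgue_on {0..L}) f" "AE x in lebesgue_on {0..L}. f x = g x"
    and "x \<in> {0..L}"
  shows "integral {0..x} f = integral {0..x} g"
proof -
  have g: "integrable (lebesgue_on {0..L}) g"
    using assms borel_measurable_lebesgue_on_AE[OF _ assms(2)]
    by (subst integrable_cong_AE[where g=f]) auto
  have "(LINT s|lebesgue_on {0..L}. indicator {..x} s * f s) = (LINT s|lebesgue_on {0..L}. indicator {..x} s * g s)"
    using assms(2) integrable_indicator_mult[OF assms(1), of "{..x}"] integrable_indicator_mult[OF g, of "{..x}"]
    by (intro integral_cong_AE) auto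
  thus ?thesis using integral_indicator_primitive assms g by simp
qed

text \<open>Two weak derivatives of f have the same pairing with every bump, so they agree almost
  everywhere; the \<open>SOME\<close> in \<open>wd\<close> is harmless up to a null set.\<close>

lemma wd_AE:
  assumes L: "L > 0" and fg: "weak_deriv L f g"
  shows "weak_deriv L f (wd L f)" "AE x in lebesgue_on {0..L}. wd L f x = g x"
proof -
  show w: "weak_deriv L f (wd L f)" unfolding wd_def by (rule someI[of "weak_deriv L f", OF fg])
  have "AE x in lebesgue_on {0..L}. wd L f x - g x = 0"
  proof (rule fundamental_lemma[OF L])
    have i: "integrable (lebesgue_on {0..L}) (wd L f)" "integrable (lebesgue_on {0..L}) g"
      using w fg by (auto simp: weak_deriv_def)
    show "integrable (lebesgue_on {0..L}) (\<lambda>x. wd L f x - g x)" using i by simp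
    fix \<theta> assume \<theta>: "bump_span L \<theta>"
    have "ip L (\<lambda>x. wd L f x - g x) \<theta> = ip L (wd L f) \<theta> - ip L g \<theta>"
      using integrable_mult_continuous[OF i(1) bump_span_continuous[OF \<theta>]]
        integrable_mult_continuous[OF i(2) bump_span_continuous[OF \<theta>]]
      by (simp add: ip_def left_diff_distrib)
    also have "ip L (wd L f) \<theta> = - ip L f (deriv \<theta>)"
      using w bump_span_test_fun[OF \<theta>] by (simp add: weak_deriv_def)
    also have "ip L g \<theta> = - ip L f (deriv \<theta>)"
      using fg bump_span_test_fun[OF \<theta>] by (simp add: weak_deriv_def)
    also have "- ip L f (deriv \<theta>) - - ip L f (deriv \<theta>) = 0" by simp
    finally show "ip L (\<lambda>x. wd L f x - g x) \<theta> = 0" .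
  qed
  thus "AE x in lebesgue_on {0..L}. wd L f x = g x" by eventually_elim simp
qed

lemma bval_eq:
  assumes L: "L > 0" and g: "continuous_on {0..L} g" "AE x in lebesgue_on {0..L}. f x = g x" "a \<in> {0..L}"
  shows "bval L f a = g a"
  unfolding bval_def
proof (rule the_equality)
  show "\<exists>h. continuous_on {0..L} h \<and> (AE x in lebesgue_on {0..L}. f x = h x) \<and> h a = g a"
    using g by blast
  fix y assume "\<exists>h. continuous_on {0..L} h \<and> (AE x in lebesgue_on {0..L}. f x = h x) \<and> h a = y"
  then obtain h where h: "continuous_on {0..L} h" "AE x in lebesgue_on {0..L}. f x = h x" "h a = y" by blast
  have "AE x in lebesgue_on {0..L}. h x = g x" using h(2) g(2) by eventually_elim simp
  from AE_eq_continuous_imp_eq[OF L h(1) g(1) this g(3)] show "y = g a" using h(3) by simp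
qed

section \<open>Volterra equations and damped modes\<close>

lemma continuous_on_atLeast0I:
  fixes f :: "real \<Rightarrow> real"
  assumes "\<And>T. 0 \<le> T \<Longrightarrow> continuous_on {0..T} f"
  shows "continuous_on {0..} f"
  unfolding continuous_on_eq_continuous_within
proof
  fix t :: real assume t: "t \<in> {0..}"
  have "at t within {0..} = at t within {0..t+1}"
    by (rule at_within_nhd[of _ "{..<t+1}"]) auto
  moreover have "continuous (at t within {0..t+1}) f"
    using assms[of "t+1"] t by (auto simp: continuous_on_eq_continuous_within)
  ultimately show "continuous (at t within {0..}) f" by simp
qed

lemma integral_has_derivative_atLeast0:
  fixes f :: "real \<Rightarrow> real"
  assumes "continuous_on {0..} f" "0 \<le> t"
  shows "((\<lambda>t. integral {0..t} f) has_real_derivative f t) (at t within {0..})"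
proof -
  have "at t within {0..} = at t within {0..t+1}"
    by (rule at_within_nhd[of _ "{..<t+1}"]) auto
  moreover have "((\<lambda>t. integral {0..t} f) has_real_derivative f t) (at t within {0..t+1})"
    by (rule integral_has_real_derivative) (use assms in \<open>auto intro: continuous_on_subset\<close>)
  ultimately show ?thesis by simp
qed

lemma continuous_on_integral_atLeast0:
  fixes f :: "real \<Rightarrow> real"
  assumes "continuous_on {0..} f"
  shows "continuous_on {0..} (\<lambda>t. integral {0..t} f)"
  by (rule DERIV_continuous_on, rule integral_has_derivative_atLeast0[OF assms]) simp

lemma integrable_on_atLeast0:
  fixes f :: "real \<Rightarrow> real"
  shows "continuous_on {0..} f \<Longrightarrow> f integrable_on {0..t}"
  by (rule integrable_continuous_real, rule continuous_on_subset) auto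

lemma nonincreasing_atLeast0:
  fixes f :: "real \<Rightarrow> real"
  assumes d: "\<And>t. 0 \<le> t \<Longrightarrow> (f has_real_derivative f' t) (at t within {0..})"
    and neg: "\<And>t. 0 \<le> t \<Longrightarrow> f' t \<le> 0" and t: "0 \<le> t"
  shows "f t \<le> f 0"
proof -
  have "continuous_on {0..t} f"
    by (rule continuous_on_subset[of "{0..}"], rule DERIV_continuous_on, rule d) auto
  moreover have "\<exists>y. (f has_real_derivative y) (at x) \<and> y \<le> 0" if "0 < x" "x < t" for x
    using d[of x] neg[of x] that at_within_interior[of x "{0..}"] by auto
  ultimately show ?thesis
    using DERIV_nonpos_imp_decreasing_open[of 0 t f] t by blast
qed

lemma integral_sq_le:
  fixes f :: "real \<Rightarrow> real"
  assumes f: "continuous_on {0..} f" and t: "0 \<le> t"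
  shows "(integral {0..t} f)\<^sup>2 \<le> t * integral {0..t} (\<lambda>s. (f s)\<^sup>2)"
proof (cases "t = 0")
  case False
  hence t0: "t > 0" using t by simp
  define I where "I = integral {0..t} f"
  define J where "J = integral {0..t} (\<lambda>s. (f s)\<^sup>2)"
  have i: "f integrable_on {0..t}" "(\<lambda>s. (f s)\<^sup>2) integrable_on {0..t}"
    by (intro integrable_on_atLeast0 continuous_intros f)+
  \<comment> \<open>\<open>I / t\<close> is the mean of f; nonnegativity of the variance is
    Cauchy-Schwarz against the constant 1.\<close>
  have "0 \<le> integral {0..t} (\<lambda>s. (f s - I / t)\<^sup>2)"
    by (rule integral_nonneg) (auto intro!: integrable_on_atLeast0 continuous_intros f)
  also have "\<dots> = integral {0..t} (\<lambda>s. (f s)\<^sup>2 - (2 * I / t) * f s + (I / t)\<^sup>2)"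
    by (rule integral_cong) (simp add: power2_diff field_simps)
  also have "\<dots> = J - (2 * I / t) * I + measure lborel {0..t} *\<^sub>R (I / t)\<^sup>2"
    unfolding I_def J_def using i
    by (intro integral_unique has_integral_add has_integral_diff has_integral_mult_right has_integral_const_real integrable_integral)
  also have "\<dots> = J - I\<^sup>2 / t" using t0 by (simp add: field_simps power2_eq_square)
  finally have "I\<^sup>2 / t \<le> J" by simp
  hence "I\<^sup>2 \<le> t * J" using t0 by (simp add: field_simps)
  thus ?thesis by (simp add: I_def J_def)
qed simp

lemma integral_mono_upper:
  fixes f :: "real \<Rightarrow> real"
  assumes f: "continuous_on {0..} f" and nn: "\<And>s. 0 \<le> s \<Longrightarrow> 0 \<le> f s" and st: "s \<le> t"
  shows "integral {0..s} f \<le> integral {0..t} f"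
  by (rule integral_subset_le) (use st nn in \<open>auto intro!: integrable_on_atLeast0 f\<close>)

lemma continuous_on_interval_bounded_above:
  fixes g :: "real \<Rightarrow> real"
  assumes "continuous_on {a..b} g"
  obtains M where "\<And>s. s \<in> {a..b} \<Longrightarrow> g s \<le> M"
proof -
  have "bounded (g ` {a..b})"
    by (intro compact_imp_bounded compact_continuous_image assms) simp
  then obtain M where M: "\<forall>x\<in>g ` {a..b}. norm x \<le> M" unfolding bounded_iff by blast
  have "g s \<le> M" if "s \<in> {a..b}" for s
  proof -
    have "norm (g s) \<le> M" using M that by blast
    thus ?thesis by simp
  qed
  with that show thesis by blast
qed

section \<open>Volterra iteration and Picard fixed points\<close>

lemma summable_power_div_fact: "summable (\<lambda>k. (z::real) ^ k / fact k)"
  using summable_exp[of z] by (simp add: divide_inverse mult.commute)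

text \<open>Each integration in time raises the power of t by one and divides by the new exponent,
  whence the factorial. A sequence \<open>h\<close> is allowed so that the constant sequence gives
  Gronwall and the successive differences give Picard iteration.\<close>

lemma Volterra_iterates_bound:
  fixes h :: "nat \<Rightarrow> real \<Rightarrow> real"
  assumes cont: "\<And>k. continuous_on {0..T} (h k)" and K: "0 \<le> K"
    and base: "\<And>t. t \<in> {0..T} \<Longrightarrow> h 0 t \<le> M"
    and step: "\<And>k t. t \<in> {0..T} \<Longrightarrow> h (Suc k) t \<le> K * integral {0..t} (h k)"
  shows "t \<in> {0..T} \<Longrightarrow> h k t \<le> M * (K * t) ^ k / fact k"
proof (induction k arbitrary: t)
  case 0
  thus ?case using base by simp
next
  case (Suc k)
  have hi: "((\<lambda>s. M * (K * s) ^ k / fact k) has_integral M * K ^ k * t ^ Suc k / fact (Suc k) - M * K ^ k * 0 ^ Suc k / fact (Suc k)) {0..t}"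
  proof (rule fundamental_theorem_of_calculus)
    show "0 \<le> t" using Suc.prems by simp
    fix x assume "x \<in> {0..t}"
    have "((\<lambda>s. M * K ^ k * s ^ Suc k / fact (Suc k)) has_real_derivative M * K ^ k * (real (Suc k) * x ^ k) / fact (Suc k)) (at x within {0..t})"
      by (intro derivative_eq_intros refl) (auto simp del: fact_Suc)
    also have "M * K ^ k * (real (Suc k) * x ^ k) / fact (Suc k) = M * (K * x) ^ k / fact k"
      by (simp add: power_mult_distrib field_simps del: of_nat_Suc)
    finally show "((\<lambda>s. M * K ^ k * s ^ Suc k / fact (Suc k)) has_vector_derivative M * (K * x) ^ k / fact k) (at x within {0..t})"
      by (simp add: has_real_derivative_iff_has_vector_derivative)
  qed
  have "h (Suc k) t \<le> K * integral {0..t} (h k)" by (rule step[OF Suc.prems])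
  also have "\<dots> \<le> K * integral {0..t} (\<lambda>s. M * (K * s) ^ k / fact k)"
  proof (intro mult_left_mono K integral_le)
    show "h k integrable_on {0..t}"
      by (rule integrable_continuous_real, rule continuous_on_subset[OF cont]) (use Suc.prems in auto)
    show "(\<lambda>s. M * (K * s) ^ k / fact k) integrable_on {0..t}" using hi by blast
    show "h k s \<le> M * (K * s) ^ k / fact k" if "s \<in> {0..t}" for s
      using Suc.IH[of s] that Suc.prems by auto
  qed
  also have "integral {0..t} (\<lambda>s. M * (K * s) ^ k / fact k) = M * K ^ k * t ^ Suc k / fact (Suc k)"
    using integral_unique[OF hi] by simp
  also have "K * (M * K ^ k * t ^ Suc k / fact (Suc k)) = M * (K * t) ^ Suc k / fact (Suc k)"
    by (simp add: power_mult_distrib del: fact_Suc)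
  finally show ?case .
qed

lemma Gronwall_zero:
  fixes g :: "real \<Rightarrow> real"
  assumes g: "continuous_on {0..T} g" and K: "0 \<le> K" and nn: "\<And>t. t \<in> {0..T} \<Longrightarrow> 0 \<le> g t"
    and le: "\<And>t. t \<in> {0..T} \<Longrightarrow> g t \<le> K * integral {0..t} g" and t: "t \<in> {0..T}"
  shows "g t = 0"
proof -
  obtain M where M: "\<And>s. s \<in> {0..T} \<Longrightarrow> g s \<le> M"
    using continuous_on_interval_bounded_above[OF g] by blast
  have "g t \<le> M * (K * t) ^ k / fact k" for k
    by (rule Volterra_iterates_bound[of T "\<lambda>_. g" K M]) (use g K M le t in auto)
  moreover have "(\<lambda>k. M * ((K * t) ^ k / fact k)) \<longlonglongrightarrow> M * 0"
    using summable_LIMSEQ_zero[OF summable_exp[of "K * t"]]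
    by (intro tendsto_intros) (simp add: divide_inverse mult.commute)
  ultimately have "g t \<le> 0"
    by (intro tendsto_lowerbound[of "\<lambda>k. M * ((K * t) ^ k / fact k)" 0 sequentially]) auto
  thus ?thesis using nn[OF t] by simp
qed

text \<open>Turns z^2 <= b c into a bound of the absolute value of z by b + c, so that series can be
  dominated without handling square roots.\<close>

lemma mult_le_sum_sq: "0 \<le> b \<Longrightarrow> 0 \<le> c \<Longrightarrow> b * c \<le> (b + c)\<^sup>2" for b c :: real
  by (simp add: power2_sum)

text \<open>The hypothesis bounds the square of the difference at time t by the history up to t
  only, with a constant allowed to grow with the horizon \<open>T\<close>. Squared Picard
  differences therefore decay factorially on every bounded interval, and no smallness of the
  interval is required.\<close>

lemma Volterra_fixed_point:
  fixes \<Phi> :: "(real \<Rightarrow> real) \<Rightarrow> real \<Rightarrow> real" and K :: "real \<Rightarrow> real"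
  assumes cont: "\<And>y. continuous_on {0..} y \<Longrightarrow> continuous_on {0..} (\<Phi> y)"
    and est: "\<And>T y z t. continuous_on {0..} y \<Longrightarrow> continuous_on {0..} z \<Longrightarrow> 0 \<le> t \<Longrightarrow> t \<le> T \<Longrightarrow>
       (\<Phi> y t - \<Phi> z t)\<^sup>2 \<le> K T * integral {0..t} (\<lambda>s. (y s - z s)\<^sup>2)"
    and K: "\<And>T. 0 \<le> T \<Longrightarrow> 0 \<le> K T"
  shows "\<exists>y. continuous_on {0..} y \<and> (\<forall>t\<ge>0. \<Phi> y t = y t)"
proof -
  define Y where "Y k = (\<Phi> ^^ k) (\<lambda>_. 0)" for k
  have Y: "continuous_on {0..} (Y k)" for k
    by (induction k) (auto simp: Y_def intro: cont)
  have YSuc: "Y (Suc k) = \<Phi> (Y k)" for k by (simp add: Y_def)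
  define y where "y t = (\<Sum>k. Y (Suc k) t - Y k t)" for t
  have unif: "uniform_limit {0..T} Y y sequentially" if T: "0 \<le> T" for T
  proof -
    have "continuous_on {0..T} (\<lambda>t. (Y 1 t - Y 0 t)\<^sup>2)"
      by (intro continuous_intros continuous_on_subset[OF Y]) auto
    then obtain M0 where M0: "\<And>s. s \<in> {0..T} \<Longrightarrow> (Y 1 s - Y 0 s)\<^sup>2 \<le> M0"
      using continuous_on_interval_bounded_above by blast
    define M where "M = \<bar>M0\<bar>"
    have b: "(Y (Suc k) t - Y k t)\<^sup>2 \<le> M * (K T * t) ^ k / fact k" if "t \<in> {0..T}" for k t
      using that
    proof (rule Volterra_iterates_bound[rotated 4])
      show "continuous_on {0..T} (\<lambda>t. (Y (Suc k) t - Y k t)\<^sup>2)" for k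
        by (intro continuous_intros continuous_on_subset[OF Y]) auto
      show "0 \<le> K T" by (rule K[OF T])
      show "(Y (Suc 0) t - Y 0 t)\<^sup>2 \<le> M" if "t \<in> {0..T}" for t
        using M0[OF that] by (simp add: M_def)
      show "(Y (Suc (Suc k)) t - Y (Suc k) t)\<^sup>2 \<le> K T * integral {0..t} (\<lambda>t. (Y (Suc k) t - Y k t)\<^sup>2)"
        if "t \<in> {0..T}" for k t
        using est[OF Y[of "Suc k"] Y[of k], of t T] that unfolding YSuc by simp
    qed
    \<comment> \<open>The estimate controls squares. Writing z^k / k! as ((4 z)^k / k!) (1/4)^k, a
      product of two summable sequences, bounds its square root by their sum.\<close>
    define bd where "bd k = M * ((4 * (K T * T)) ^ k / fact k) + (1/4) ^ k" for k
    have "uniform_limit {0..T} (\<lambda>n t. \<Sum>k<n. Y (Suc k) t - Y k t) (\<lambda>t. \<Sum>k. Y (Suc k) t - Y k t) sequentially"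
    proof (rule Weierstrass_m_test[of _ _ bd])
      show "summable bd" unfolding bd_def
        by (intro summable_add summable_mult summable_geometric summable_power_div_fact) simp
      fix k t assume t: "t \<in> {0..T}"
      let ?b = "M * ((4 * (K T * T)) ^ k / fact k)" and ?c = "(1/4::real) ^ k"
      have M: "0 \<le> M" by (simp add: M_def)
      have b0: "0 \<le> ?b" using M K[OF T] T by simp
      have "(Y (Suc k) t - Y k t)\<^sup>2 \<le> M * (K T * t) ^ k / fact k" by (rule b[OF t])
      also have "\<dots> \<le> M * (K T * T) ^ k / fact k"
        using t M K[OF T] by (intro divide_right_mono mult_left_mono power_mono) auto
      also have "\<dots> = ?b * ?c" by (simp add: power_mult_distrib power_divide)
      also have "\<dots> \<le> (?b + ?c)\<^sup>2" using b0 by (intro mult_le_sum_sq) simp_all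
      finally show "norm (Y (Suc k) t - Y k t) \<le> bd k"
        unfolding bd_def real_norm_def using b0 by - (rule power2_le_imp_le, auto)
    qed
    moreover have "(\<Sum>k<n. Y (Suc k) t - Y k t) = Y n t" for n t
      using sum_lessThan_telescope[of "\<lambda>k. Y k t" n] by (simp add: Y_def)
    ultimately show ?thesis by (simp add: y_def[abs_def])
  qed
  have ycont: "continuous_on {0..} y"
  proof (rule continuous_on_atLeast0I)
    fix T :: real assume "0 \<le> T"
    thus "continuous_on {0..T} y"
      by (intro uniform_limit_theorem[OF _ unif]) (auto intro!: always_eventually continuous_on_subset[OF Y])
  qed
  have "\<Phi> y t = y t" if t: "0 \<le> t" for t
  proof -
    have lim: "(\<lambda>n. Y n t) \<longlonglongrightarrow> y t"
      using tendsto_uniform_limitI[OF unif[OF t], of t] t by simp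
    have "(\<lambda>n. \<Phi> y t - Y (Suc n) t) \<longlonglongrightarrow> 0"
    proof (rule LIMSEQ_I)
      fix e :: real assume e: "0 < e"
      \<comment> \<open>The added 1 makes \<open>c\<close> positive and the later comparison strict,
        even when \<open>K t * t\<close> is 0.\<close>
      define c where "c = sqrt (K t * t) + 1"
      have c: "c > 0" using K[OF t] t by (simp add: c_def add_nonneg_pos)
      have c2: "K t * t < c\<^sup>2"
      proof -
        have "K t * t = (sqrt (K t * t))\<^sup>2" using K[OF t] t by simp
        also have "\<dots> < c\<^sup>2" unfolding c_def using K[OF t] t by (intro power_strict_mono) auto
        finally show ?thesis .
      qed
      have "eventually (\<lambda>n. \<forall>s\<in>{0..t}. dist (Y n s) (y s) < e / c) sequentially"
        using unif[OF t] e c by (auto simp: uniform_limit_iff)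
      then obtain N where N: "\<And>n s. n \<ge> N \<Longrightarrow> s \<in> {0..t} \<Longrightarrow> \<bar>Y n s - y s\<bar> < e / c"
        unfolding eventually_sequentially dist_real_def by blast
      have "norm (\<Phi> y t - Y (Suc n) t - 0) < e" if n: "n \<ge> N" for n
      proof -
        have "(\<Phi> y t - Y (Suc n) t)\<^sup>2 \<le> K t * integral {0..t} (\<lambda>s. (y s - Y n s)\<^sup>2)"
          unfolding YSuc by (rule est[OF ycont Y t]) simp
        also have "\<dots> \<le> K t * integral {0..t} (\<lambda>s. (e / c)\<^sup>2)"
        proof (intro mult_left_mono integral_le K[OF t])
          show "(\<lambda>s. (y s - Y n s)\<^sup>2) integrable_on {0..t}"
            by (intro integrable_on_atLeast0 continuous_intros Y ycont)
          show "(y s - Y n s)\<^sup>2 \<le> (e / c)\<^sup>2" if "s \<in> {0..t}" for s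
            using N[OF n that] by (subst abs_le_square_iff[symmetric]) (use e c in auto)
        qed (rule integrable_const_ivl)
        also have "\<dots> = K t * t * (e / c)\<^sup>2" using t by simp
        also have "\<dots> < c\<^sup>2 * (e / c)\<^sup>2" using c2 e c by (intro mult_strict_right_mono) auto
        also have "\<dots> = e\<^sup>2" using c by (simp add: power_divide)
        finally have "\<bar>\<Phi> y t - Y (Suc n) t\<bar> < e"
          using e power2_less_imp_less[of "\<bar>\<Phi> y t - Y (Suc n) t\<bar>" e] by simp
        thus ?thesis by simp
      qed
      thus "\<exists>no. \<forall>n\<ge>no. norm (\<Phi> y t - Y (Suc n) t - 0) < e" by blast
    qed
    hence "(\<lambda>n. \<Phi> y t - (\<Phi> y t - Y (Suc n) t)) \<longlonglongrightarrow> \<Phi> y t - 0" by (intro tendsto_intros)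
    hence "(\<lambda>n. Y (Suc n) t) \<longlonglongrightarrow> \<Phi> y t" by simp
    thus ?thesis using LIMSEQ_Suc[OF lim] by (rule LIMSEQ_unique)
  qed
  with ycont show ?thesis by blast
qed

lemma integral_integral_sq_le:
  fixes f :: "real \<Rightarrow> real"
  assumes f: "continuous_on {0..} f" and t: "0 \<le> t"
  shows "(integral {0..t} (\<lambda>s. integral {0..s} f))\<^sup>2 \<le> t ^ 3 * integral {0..t} (\<lambda>s. (f s)\<^sup>2)"
proof -
  let ?J = "integral {0..t} (\<lambda>s. (f s)\<^sup>2)"
  have "(integral {0..t} (\<lambda>s. integral {0..s} f))\<^sup>2 \<le> t * integral {0..t} (\<lambda>s. (integral {0..s} f)\<^sup>2)"
    by (rule integral_sq_le[OF continuous_on_integral_atLeast0[OF f] t])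
  also have "\<dots> \<le> t * integral {0..t} (\<lambda>s. t * ?J)"
  proof (intro mult_left_mono integral_le t)
    show "(\<lambda>s. (integral {0..s} f)\<^sup>2) integrable_on {0..t}"
      by (intro integrable_on_atLeast0 continuous_intros continuous_on_integral_atLeast0 f)
    show "(integral {0..s} f)\<^sup>2 \<le> t * ?J" if "s \<in> {0..t}" for s
    proof -
      have "(integral {0..s} f)\<^sup>2 \<le> s * integral {0..s} (\<lambda>s. (f s)\<^sup>2)" using that by (intro integral_sq_le f) auto
      also have "\<dots> \<le> t * ?J" using that
        by (intro mult_mono integral_mono_upper integral_nonneg)
          (auto intro!: continuous_intros f integrable_on_atLeast0)
      finally show ?thesis .
    qed
  qed (rule integrable_const_ivl)
  also have "\<dots> = t ^ 3 * ?J" using t by (simp add: power3_eq_cube)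
  finally show ?thesis .
qed

lemma sq_sum_le: "(a + b)\<^sup>2 \<le> 2 * a\<^sup>2 + 2 * (b::real)\<^sup>2"
  using sum_squares_bound[of a b] by (simp add: power2_sum)

lemma sq_sum4_le: "((a + b) + (c + d))\<^sup>2 \<le> 4 * (a\<^sup>2 + b\<^sup>2 + c\<^sup>2 + (d::real)\<^sup>2)"
proof -
  have "((a + b) + (c + d))\<^sup>2 \<le> 2 * (a + b)\<^sup>2 + 2 * (c + d)\<^sup>2" by (rule sq_sum_le)
  also have "\<dots> \<le> 2 * (2 * a\<^sup>2 + 2 * b\<^sup>2) + 2 * (2 * c\<^sup>2 + 2 * d\<^sup>2)"
    by (intro add_mono mult_left_mono sq_sum_le) auto
  finally show ?thesis by simp
qed

section \<open>A single damped oscillator\<close>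

text \<open>The unknown of the fixed point is the second derivative \<open>z\<close>: velocity and
  displacement are its iterated primitives, so the equation becomes a Volterra equation for
  \<open>z\<close> and the solution is twice differentiable by construction.\<close>

lemma second_order_ode_exists:
  fixes y :: "real \<Rightarrow> real"
  assumes y: "continuous_on {0..} y"
  shows "\<exists>a b. a 0 = a0 \<and> b 0 = b0 \<and>
     (\<forall>t\<ge>0. (a has_real_derivative b t) (at t within {0..}) \<and>
            (b has_real_derivative - \<gamma> * b t - \<omega> * a t + y t) (at t within {0..}))"
proof -
  define b where "b z t = b0 + integral {0..t} z" for z :: "real \<Rightarrow> real" and t
  define a where "a z t = a0 + integral {0..t} (b z)" for z and t :: real
  have cb: "continuous_on {0..} (b z)" if "continuous_on {0..} z" for z
    unfolding b_def[abs_def] by (intro continuous_intros continuous_on_integral_atLeast0 that)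
  have ca: "continuous_on {0..} (a z)" if "continuous_on {0..} z" for z
    unfolding a_def[abs_def] by (intro continuous_intros continuous_on_integral_atLeast0 cb that)
  define \<Phi> where "\<Phi> z t = - \<gamma> * b z t - \<omega> * a z t + y t" for z t
  have "\<exists>z. continuous_on {0..} z \<and> (\<forall>t\<ge>0. \<Phi> z t = z t)"
  \<comment> \<open>The two terms come from one and from two time integrations, each estimated by
    Cauchy-Schwarz; the factors 2 come from squaring a sum of two terms.\<close>
  proof (rule Volterra_fixed_point[where K="\<lambda>T. 2 * \<gamma>\<^sup>2 * T + 2 * \<omega>\<^sup>2 * T ^ 3"])
    show "continuous_on {0..} (\<Phi> z)" if "continuous_on {0..} z" for z
      unfolding \<Phi>_def[abs_def] by (intro continuous_intros ca cb y that)
    show "(0::real) \<le> 2 * \<gamma>\<^sup>2 * T + 2 * \<omega>\<^sup>2 * T ^ 3" if "0 \<le> T" for T :: real using that by simp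
    fix T t :: real and z1 z2 :: "real \<Rightarrow> real" assume z: "continuous_on {0..} z1" "continuous_on {0..} z2" and t: "0 \<le> t" "t \<le> T"
    let ?e = "\<lambda>s. z1 s - z2 s"
    let ?J = "integral {0..t} (\<lambda>s. (?e s)\<^sup>2)"
    have e: "continuous_on {0..} ?e" by (intro continuous_intros z)
    have db: "b z1 s - b z2 s = integral {0..s} ?e" for s
      unfolding b_def by (subst integral_diff) (auto intro!: integrable_on_atLeast0 z)
    have da: "a z1 t - a z2 t = integral {0..t} (\<lambda>s. integral {0..s} ?e)"
      unfolding a_def db[symmetric] by (subst integral_diff) (auto intro!: integrable_on_atLeast0 cb z)
    have J: "0 \<le> ?J" by (rule integral_nonneg) (auto intro!: integrable_on_atLeast0 continuous_intros z)
    have "\<Phi> z1 t - \<Phi> z2 t = (- \<gamma>) * (b z1 t - b z2 t) + (- \<omega>) * (a z1 t - a z2 t)"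
      by (simp add: \<Phi>_def algebra_simps)
    hence "(\<Phi> z1 t - \<Phi> z2 t)\<^sup>2 \<le> 2 * \<gamma>\<^sup>2 * (b z1 t - b z2 t)\<^sup>2 + 2 * \<omega>\<^sup>2 * (a z1 t - a z2 t)\<^sup>2"
      using sq_sum_le[of "(- \<gamma>) * (b z1 t - b z2 t)" "(- \<omega>) * (a z1 t - a z2 t)"]
      by (simp add: power_mult_distrib)
    also have "\<dots> \<le> 2 * \<gamma>\<^sup>2 * (t * ?J) + 2 * \<omega>\<^sup>2 * (t ^ 3 * ?J)"
      unfolding db da by (intro add_mono mult_left_mono integral_sq_le integral_integral_sq_le e t) auto
    also have "\<dots> \<le> 2 * \<gamma>\<^sup>2 * (T * ?J) + 2 * \<omega>\<^sup>2 * (T ^ 3 * ?J)"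
      using t J by (intro add_mono mult_left_mono mult_right_mono power_mono) auto
    finally show "(\<Phi> z1 t - \<Phi> z2 t)\<^sup>2 \<le> (2 * \<gamma>\<^sup>2 * T + 2 * \<omega>\<^sup>2 * T ^ 3) * ?J"
      by (simp add: algebra_simps)
  qed
  then obtain z where z: "continuous_on {0..} z" "\<And>t. 0 \<le> t \<Longrightarrow> \<Phi> z t = z t" by blast
  have "(a z has_real_derivative b z t) (at t within {0..})" if "0 \<le> t" for t
    unfolding a_def[abs_def] using integral_has_derivative_atLeast0[OF cb[OF z(1)] that]
    by (auto intro!: derivative_eq_intros)
  moreover have "(b z has_real_derivative - \<gamma> * b z t - \<omega> * a z t + y t) (at t within {0..})" if "0 \<le> t" for t
  proof -
    have "(b z has_real_derivative z t) (at t within {0..})"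
      unfolding b_def[abs_def] using integral_has_derivative_atLeast0[OF z(1) that]
      by (auto intro!: derivative_eq_intros)
    thus ?thesis using z(2)[OF that] by (simp add: \<Phi>_def)
  qed
  moreover have "a z 0 = a0" "b z 0 = b0" by (simp_all add: a_def b_def)
  ultimately show ?thesis by blast
qed

text \<open>The elastic terms cancel in the derivative of the energy, leaving 2 \<beta> b y - 2
  \<gamma> b^2. The condition on \<open>K\<close> is the discriminant condition under which this is
  at most K y^2 for all b and y. The work of the force is thus absorbed by the damping
  alone.\<close>

lemma damped_energy_estimate:
  fixes a b y :: "real \<Rightarrow> real"
  assumes a: "\<And>t. 0 \<le> t \<Longrightarrow> (a has_real_derivative b t) (at t within {0..})"
    and b: "\<And>t. 0 \<le> t \<Longrightarrow> (b has_real_derivative - \<gamma> * b t - \<omega> * a t + \<beta> * y t) (at t within {0..})"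
    and y: "continuous_on {0..} y" and \<gamma>: "0 \<le> \<gamma>" and K: "0 \<le> K" and \<beta>: "\<beta>\<^sup>2 \<le> 2 * \<gamma> * K" and t: "0 \<le> t"
  shows "(b t)\<^sup>2 + \<omega> * (a t)\<^sup>2 \<le> (b 0)\<^sup>2 + \<omega> * (a 0)\<^sup>2 + K * integral {0..t} (\<lambda>s. (y s)\<^sup>2)"
proof -
  let ?E = "\<lambda>t. (b t)\<^sup>2 + \<omega> * (a t)\<^sup>2 - K * integral {0..t} (\<lambda>s. (y s)\<^sup>2)"
  let ?E' = "\<lambda>t. 2 * \<beta> * b t * y t - 2 * \<gamma> * (b t)\<^sup>2 - K * (y t)\<^sup>2"
  have y2: "continuous_on {0..} (\<lambda>s. (y s)\<^sup>2)" by (intro continuous_intros y)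
  have "?E t \<le> ?E 0"
  proof (rule nonincreasing_atLeast0[OF _ _ t, of ?E ?E'])
    fix s :: real assume s: "0 \<le> s"
    show "(?E has_real_derivative ?E' s) (at s within {0..})"
      by (rule derivative_eq_intros a[OF s] b[OF s] integral_has_derivative_atLeast0[OF y2 s] refl)+
        (simp add: algebra_simps power2_eq_square)
    show "?E' s \<le> 0"
    proof (cases "\<gamma> = 0")
      case True
      hence "\<beta> = 0" using \<beta> by simp
      thus ?thesis using True K by simp
    next
      case False
      hence g: "\<gamma> > 0" using \<gamma> by simp
      \<comment> \<open>Completing the square after multiplication by the positive number 2
        \<gamma>.\<close>
      have "2 * \<gamma> * ?E' s = - (2 * \<gamma> * b s - \<beta> * y s)\<^sup>2 - (2 * \<gamma> * K - \<beta>\<^sup>2) * (y s)\<^sup>2"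
        by (simp add: power2_eq_square algebra_simps)
      also have "\<dots> \<le> 0"
      proof -
        have "0 \<le> (2 * \<gamma> * K - \<beta>\<^sup>2) * (y s)\<^sup>2" using \<beta> by simp
        thus ?thesis using zero_le_power2[of "2 * \<gamma> * b s - \<beta> * y s"] by linarith
      qed
      finally show ?thesis using g by (simp add: mult_le_0_iff)
    qed
  qed
  thus ?thesis by simp
qed

section \<open>Series of modes\<close>

text \<open>Cauchy-Schwarz for the square roots of \<open>u\<close> and \<open>v\<close>. Bounding
  only squares suits feedback terms, where \<open>u\<close> is an energy bound and \<open>v\<close>
  collects the squared weights.\<close>

lemma summable_sq_le_mult:
  fixes z u v :: "nat \<Rightarrow> real"
  assumes z: "\<And>n. (z n)\<^sup>2 \<le> u n * v n" and u: "\<And>n. 0 \<le> u n" "summable u" and v: "\<And>n. 0 \<le> v n" "summable v"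
  shows "summable (\<lambda>n. \<bar>z n\<bar>)" "summable z" "(\<Sum>n. z n)\<^sup>2 \<le> (\<Sum>n. u n) * (\<Sum>n. v n)"
proof -
  have b: "\<bar>z n\<bar> \<le> u n + v n" for n
  proof (rule power2_le_imp_le)
    have "\<bar>z n\<bar>\<^sup>2 \<le> u n * v n" using z by simp
    also have "\<dots> \<le> (u n + v n)\<^sup>2" using u(1)[of n] v(1)[of n] by (simp add: power2_sum)
    finally show "\<bar>z n\<bar>\<^sup>2 \<le> (u n + v n)\<^sup>2" .
  qed (use u v in \<open>simp add: add_nonneg_nonneg\<close>)
  show s: "summable (\<lambda>n. \<bar>z n\<bar>)"
    by (rule summable_comparison_test'[OF summable_add[OF u(2) v(2)]]) (use b in simp)
  thus s': "summable z" by (rule summable_rabs_cancel)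
  have "(\<Sum>n<N. z n)\<^sup>2 \<le> (\<Sum>n. u n) * (\<Sum>n. v n)" for N
  proof -
    have "\<bar>\<Sum>n<N. z n\<bar> \<le> (\<Sum>n<N. sqrt (u n) * sqrt (v n))"
    proof (rule order_trans[OF sum_abs sum_mono])
      fix n
      have "\<bar>z n\<bar> \<le> sqrt (u n * v n)" using z[of n] by (intro real_le_rsqrt) simp
      thus "\<bar>z n\<bar> \<le> sqrt (u n) * sqrt (v n)" by (simp add: real_sqrt_mult)
    qed
    hence "(\<Sum>n<N. z n)\<^sup>2 \<le> (\<Sum>n<N. sqrt (u n) * sqrt (v n))\<^sup>2"
      by (subst abs_le_square_iff[symmetric]) linarith
    also have "\<dots> \<le> (\<Sum>n<N. (sqrt (u n))\<^sup>2) * (\<Sum>n<N. (sqrt (v n))\<^sup>2)"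
      by (rule Cauchy_Schwarz_ineq_sum)
    also have "\<dots> = (\<Sum>n<N. u n) * (\<Sum>n<N. v n)" using u v by simp
    also have "\<dots> \<le> (\<Sum>n. u n) * (\<Sum>n. v n)"
      using u v by (intro mult_mono sum_le_suminf sum_nonneg suminf_nonneg) auto
    finally show ?thesis .
  qed
  moreover have "(\<lambda>N. (\<Sum>n<N. z n)\<^sup>2) \<longlonglongrightarrow> (\<Sum>n. z n)\<^sup>2"
    by (intro tendsto_intros summable_LIMSEQ s')
  ultimately show "(\<Sum>n. z n)\<^sup>2 \<le> (\<Sum>n. u n) * (\<Sum>n. v n)"
    by (intro LIMSEQ_le_const2) auto
qed

lemma uniform_limit_series_bound:
  fixes f :: "nat \<Rightarrow> real \<Rightarrow> real"
  assumes "summable M" "\<And>n t. t \<in> A \<Longrightarrow> \<bar>f n t\<bar> \<le> M n"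
  shows "uniform_limit A (\<lambda>n t. \<Sum>i<n. f i t) (\<lambda>t. \<Sum>i. f i t) sequentially"
  by (rule Weierstrass_m_test[OF _ assms(1)]) (use assms(2) in simp)

lemma continuous_on_series_atLeast0:
  fixes f :: "nat \<Rightarrow> real \<Rightarrow> real"
  assumes cont: "\<And>n. continuous_on {0..} (f n)"
    and dom: "\<And>T. 0 \<le> T \<Longrightarrow> \<exists>M. summable M \<and> (\<forall>n. \<forall>t\<in>{0..T}. \<bar>f n t\<bar> \<le> M n)"
  shows "continuous_on {0..} (\<lambda>t. \<Sum>n. f n t)"
proof (rule continuous_on_atLeast0I)
  fix T :: real assume "0 \<le> T"
  from dom[OF this] obtain M where M: "summable M" "\<And>n t. t \<in> {0..T} \<Longrightarrow> \<bar>f n t\<bar> \<le> M n" by blast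
  have "continuous_on {0..T} (\<lambda>t. \<Sum>i<n. f i t)" for n
    by (intro continuous_intros continuous_on_subset[OF cont]) auto
  thus "continuous_on {0..T} (\<lambda>t. \<Sum>n. f n t)"
    by (intro uniform_limit_theorem[OF _ uniform_limit_series_bound[OF M]] always_eventually allI) auto
qed

lemma has_derivative_series_atLeast0:
  fixes f f' :: "nat \<Rightarrow> real \<Rightarrow> real"
  assumes d: "\<And>n t. 0 \<le> t \<Longrightarrow> (f n has_real_derivative f' n t) (at t within {0..})"
    and s0: "summable (\<lambda>n. f n 0)"
    and dom: "\<And>T. 0 \<le> T \<Longrightarrow> \<exists>M. summable M \<and> (\<forall>n. \<forall>t\<in>{0..T}. \<bar>f' n t\<bar> \<le> M n)"
    and t: "0 \<le> t"
  shows "((\<lambda>t. \<Sum>n. f n t) has_real_derivative (\<Sum>n. f' n t)) (at t within {0..})"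
proof -
  obtain M where M: "summable M" "\<And>n s. s \<in> {0..t+1} \<Longrightarrow> \<bar>f' n s\<bar> \<le> M n"
    using dom[of "t+1"] t by auto
  have "\<exists>g. \<forall>x\<in>{0..t+1}. (\<lambda>n. f n x) sums g x \<and> (g has_real_derivative (\<Sum>n. f' n x)) (at x within {0..t+1})"
  proof (rule has_field_derivative_series)
    show "(f n has_real_derivative f' n x) (at x within {0..t+1})" if "x \<in> {0..t+1}" for n x
      by (rule has_field_derivative_subset[OF d]) (use that in auto)
    show "uniform_limit {0..t+1} (\<lambda>n x. \<Sum>i<n. f' i x) (\<lambda>x. \<Sum>n. f' n x) sequentially"
      by (rule uniform_limit_series_bound[OF M])
    show "0 \<in> {0..t+1}" using t by simp
  qed (use s0 in auto)
  then obtain g where g: "\<And>x. x \<in> {0..t+1} \<Longrightarrow> (\<lambda>n. f n x) sums g x"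
    "\<And>x. x \<in> {0..t+1} \<Longrightarrow> (g has_real_derivative (\<Sum>n. f' n x)) (at x within {0..t+1})" by blast
  have "((\<lambda>t. \<Sum>n. f n t) has_real_derivative (\<Sum>n. f' n t)) (at t within {0..t+1})"
    by (rule has_field_derivative_transform_within[OF g(2) zero_less_one]) (use t g(1) in \<open>auto simp: sums_iff\<close>)
  moreover have "at t within {0..} = at t within {0..t+1}"
    by (rule at_within_nhd[of _ "{..<t+1}"]) (use t in auto)
  ultimately show ?thesis by simp
qed

section \<open>The coupled system of modes and feedback\<close>

text \<open>All data vanish, so the energy of mode n is at most \<open>K n\<close> times the
  integral of f^2, and each of the four parts of f is bounded by the same integral. The unbounded
  weights \<open>q\<close> are paired with the energy through \<open>\<theta>\<close>. The last
  conclusion keeps the factor \<open>\<omega> n\<close> because the energy says nothing about a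
  displacement with zero stiffness.\<close>

lemma modes_unique:
  fixes a b :: "nat \<Rightarrow> real \<Rightarrow> real" and \<xi> w f :: "real \<Rightarrow> real"
  assumes \<gamma>: "\<And>n. 0 \<le> \<gamma> n" and \<omega>: "\<And>n. 0 \<le> \<omega> n" and K: "\<And>n. 0 \<le> K n" "summable K"
    and \<beta>: "\<And>n. (\<beta> n)\<^sup>2 \<le> 2 * \<gamma> n * K n"
    and r: "summable (\<lambda>n. (r n)\<^sup>2)" and \<theta>: "\<And>n. 0 \<le> \<theta> n" "summable \<theta>" and q: "\<And>n. (q n)\<^sup>2 \<le> \<omega> n * \<theta> n"
    and a: "\<And>n t. 0 \<le> t \<Longrightarrow> (a n has_real_derivative b n t) (at t within {0..})"
    and b: "\<And>n t. 0 \<le> t \<Longrightarrow> (b n has_real_derivative - \<gamma> n * b n t - \<omega> n * a n t + \<beta> n * f t) (at t within {0..})"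
    and \<xi>: "\<And>t. 0 \<le> t \<Longrightarrow> (\<xi> has_real_derivative w t) (at t within {0..})"
    and w: "\<And>t. 0 \<le> t \<Longrightarrow> (w has_real_derivative - f t) (at t within {0..})"
    and init: "\<And>n. a n 0 = 0" "\<And>n. b n 0 = 0" "\<xi> 0 = 0" "w 0 = 0"
    and f: "continuous_on {0..} f"
    and feq: "\<And>t. 0 \<le> t \<Longrightarrow> f t = B * \<xi> t + C * w t + (\<Sum>n. b n t * r n) + (\<Sum>n. a n t * q n)"
    and t: "0 \<le> t"
  shows "f t = 0" "\<xi> t = 0" "w t = 0" "\<omega> n * (a n t)\<^sup>2 = 0"
proof -
  define J where "J t = integral {0..t} (\<lambda>s. (f s)\<^sup>2)" for t
  have f2: "continuous_on {0..} (\<lambda>s. (f s)\<^sup>2)" by (intro continuous_intros f)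
  have J0: "0 \<le> J t" if "0 \<le> t" for t unfolding J_def
    by (rule integral_nonneg) (auto intro!: integrable_on_atLeast0 f2)
  have E: "(b n t)\<^sup>2 + \<omega> n * (a n t)\<^sup>2 \<le> K n * J t" if "0 \<le> t" for n t
    using damped_energy_estimate[OF a[of _ n] b[of _ n] f \<gamma> K(1) \<beta> that] init that by (simp add: J_def)
  have weq: "w t = - integral {0..t} f" if "0 \<le> t" for t
  proof -
    have "((\<lambda>s. - f s) has_integral w t - w 0) {0..t}"
      using that by (intro fundamental_theorem_of_calculus)
        (auto simp flip: has_real_derivative_iff_has_vector_derivative intro: has_field_derivative_subset[OF w])
    thus ?thesis using init by (auto dest!: integral_unique)
  qed
  have \<xi>eq: "\<xi> t = integral {0..t} w" if "0 \<le> t" for t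
  proof -
    have "(w has_integral \<xi> t - \<xi> 0) {0..t}"
      using that by (intro fundamental_theorem_of_calculus)
        (auto simp flip: has_real_derivative_iff_has_vector_derivative intro: has_field_derivative_subset[OF \<xi>])
    thus ?thesis using init by (auto dest!: integral_unique)
  qed
  have w2: "(w t)\<^sup>2 \<le> t * J t" if "0 \<le> t" for t
    using integral_sq_le[OF f that] by (simp add: weq that J_def)
  have \<xi>2: "(\<xi> t)\<^sup>2 \<le> t ^ 3 * J t" if "0 \<le> t" for t
  proof -
    have "integral {0..t} w = integral {0..t} (\<lambda>s. - integral {0..s} f)"
      by (rule integral_cong) (simp add: weq)
    thus ?thesis using integral_integral_sq_le[OF f that] by (simp add: \<xi>eq that J_def)
  qed
  define SK where "SK = (\<Sum>n. K n)"
  \<comment> \<open>One summand for each of the four parts of f; the powers of \<open>T\<close>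
    count the integrations leading from f to \<open>w\<close> and to \<open>\<xi>\<close>.\<close>
  define k where "k T = 4 * (B\<^sup>2 * T ^ 3 + C\<^sup>2 * T + SK * (\<Sum>n. (r n)\<^sup>2) + SK * (\<Sum>n. \<theta> n))" for T
  have SK: "0 \<le> SK" unfolding SK_def by (rule suminf_nonneg[OF K(2,1)])
  have Sr: "0 \<le> (\<Sum>n. (r n)\<^sup>2)" by (rule suminf_nonneg[OF r]) simp
  have S\<theta>: "0 \<le> (\<Sum>n. \<theta> n)" by (rule suminf_nonneg[OF \<theta>(2,1)])
  have f2le: "(f t)\<^sup>2 \<le> k T * J t" if "0 \<le> t" "t \<le> T" for t T
  proof -
    have bn: "(b n t)\<^sup>2 \<le> K n * J t" and an: "\<omega> n * (a n t)\<^sup>2 \<le> K n * J t" for n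
      using E[OF that(1), of n] \<omega>[of n] zero_le_power2[of "b n t"] mult_nonneg_nonneg[OF \<omega>[of n] zero_le_power2[of "a n t"]]
      by linarith+
    have "(\<Sum>n. b n t * r n)\<^sup>2 \<le> (\<Sum>n. K n * J t) * (\<Sum>n. (r n)\<^sup>2)"
    proof (rule summable_sq_le_mult)
      show "(b n t * r n)\<^sup>2 \<le> K n * J t * (r n)\<^sup>2" for n
        unfolding power_mult_distrib by (rule mult_right_mono[OF bn]) simp
    qed (use K J0[OF that(1)] r in \<open>auto intro: summable_mult2\<close>)
    hence 1: "(\<Sum>n. b n t * r n)\<^sup>2 \<le> SK * J t * (\<Sum>n. (r n)\<^sup>2)"
      using suminf_mult2[OF K(2), of "J t"] by (simp add: SK_def)
    have "(\<Sum>n. a n t * q n)\<^sup>2 \<le> (\<Sum>n. K n * J t) * (\<Sum>n. \<theta> n)"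
    proof (rule summable_sq_le_mult)
      show "(a n t * q n)\<^sup>2 \<le> K n * J t * \<theta> n" for n
      proof -
        have "(a n t * q n)\<^sup>2 \<le> (a n t)\<^sup>2 * (\<omega> n * \<theta> n)"
          unfolding power_mult_distrib by (rule mult_left_mono[OF q]) simp
        also have "\<dots> = \<omega> n * (a n t)\<^sup>2 * \<theta> n" by simp
        also have "\<dots> \<le> K n * J t * \<theta> n" by (rule mult_right_mono[OF an \<theta>(1)])
        finally show ?thesis .
      qed
    qed (use K J0[OF that(1)] \<theta> in \<open>auto intro: summable_mult2\<close>)
    hence 2: "(\<Sum>n. a n t * q n)\<^sup>2 \<le> SK * J t * (\<Sum>n. \<theta> n)"
      using suminf_mult2[OF K(2), of "J t"] by (simp add: SK_def)
    have "(f t)\<^sup>2 = ((B * \<xi> t + C * w t) + ((\<Sum>n. b n t * r n) + (\<Sum>n. a n t * q n)))\<^sup>2"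
      using feq[OF that(1)] by (simp only: add.assoc)
    also have "\<dots> \<le> 4 * (B\<^sup>2 * (\<xi> t)\<^sup>2 + C\<^sup>2 * (w t)\<^sup>2 + (\<Sum>n. b n t * r n)\<^sup>2 + (\<Sum>n. a n t * q n)\<^sup>2)"
      using sq_sum4_le[of "B * \<xi> t" "C * w t" "\<Sum>n. b n t * r n" "\<Sum>n. a n t * q n"]
      by (simp only: power_mult_distrib)
    also have "\<dots> \<le> 4 * (B\<^sup>2 * (T ^ 3 * J t) + C\<^sup>2 * (T * J t) + SK * J t * (\<Sum>n. (r n)\<^sup>2) + SK * J t * (\<Sum>n. \<theta> n))"
      using that J0[OF that(1)]
      by (intro mult_left_mono add_mono 1 2 order_trans[OF w2] order_trans[OF \<xi>2] mult_right_mono power_mono) auto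
    also have "\<dots> = k T * J t" by (simp add: k_def algebra_simps)
    finally show ?thesis .
  qed
  have "(f t)\<^sup>2 = 0" if "0 \<le> t" for t
  proof (rule Gronwall_zero[of t "\<lambda>t. (f t)\<^sup>2" "k t"])
    show "continuous_on {0..t} (\<lambda>t. (f t)\<^sup>2)" by (rule continuous_on_subset[OF f2]) auto
    show "0 \<le> k t" unfolding k_def using that SK Sr S\<theta> by simp
    show "(f s)\<^sup>2 \<le> k t * integral {0..s} (\<lambda>t. (f t)\<^sup>2)" if "s \<in> {0..t}" for s
      using f2le[of s t] that by (simp add: J_def)
  qed (use that in auto)
  hence f0: "f t = 0" if "0 \<le> t" for t using that by simp
  have "J t = integral {0..t} (\<lambda>s. 0)" unfolding J_def by (rule integral_cong) (simp add: f0)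
  hence Jt: "J t = 0" by simp
  show "f t = 0" by (rule f0[OF t])
  show "\<xi> t = 0" using \<xi>2[OF t] Jt by simp
  show "w t = 0" using w2[OF t] Jt by simp
  show "\<omega> n * (a n t)\<^sup>2 = 0"
    using E[OF t, of n, unfolded Jt mult_zero_right] mult_nonneg_nonneg[OF \<omega>[of n] zero_le_power2[of "a n t"]] zero_le_power2[of "b n t"]
    by linarith
qed

text \<open>The fixed point below is \<open>y = f'\<close>: the modes driven by \<open>f\<close> and their time derivatives, driven by
  \<open>f'\<close>, both obey the energy estimate.\<close>

lemma modes_exist:
  fixes \<gamma> \<omega> \<beta> K r q \<theta> a0 b0 :: "nat \<Rightarrow> real" and B C \<xi>0 w0 :: real
  assumes \<gamma>: "\<And>n. 0 \<le> \<gamma> n" and \<omega>: "\<And>n. 0 \<le> \<omega> n" and K: "\<And>n. 0 \<le> K n" "summable K"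
    and \<beta>: "\<And>n. (\<beta> n)\<^sup>2 \<le> 2 * \<gamma> n * K n"
    and r: "summable (\<lambda>n. (r n)\<^sup>2)" and \<theta>: "\<And>n. 0 \<le> \<theta> n" "summable \<theta>" and q: "\<And>n. (q n)\<^sup>2 \<le> \<omega> n * \<theta> n"
    and f0: "f0 = B * \<xi>0 + C * w0 + (\<Sum>n. b0 n * r n) + (\<Sum>n. a0 n * q n)"
    and d0: "summable (\<lambda>n. (- \<gamma> n * b0 n - \<omega> n * a0 n + \<beta> n * f0)\<^sup>2)"
    and b0: "summable (\<lambda>n. (b0 n)\<^sup>2)" "summable (\<lambda>n. \<omega> n * (b0 n)\<^sup>2)"
    and a0: "summable (\<lambda>n. \<omega> n * (a0 n)\<^sup>2)"
  shows "\<exists>(a :: nat \<Rightarrow> real \<Rightarrow> real) b d \<xi> w f.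
    (\<forall>t\<ge>0. \<forall>n. (a n has_real_derivative b n t) (at t within {0..})
        \<and> (b n has_real_derivative d n t) (at t within {0..})
        \<and> continuous_on {0..} (d n)
        \<and> d n t = - \<gamma> n * b n t - \<omega> n * a n t + \<beta> n * f t)
    \<and> (\<forall>n. a n 0 = a0 n \<and> b n 0 = b0 n) \<and> \<xi> 0 = \<xi>0 \<and> w 0 = w0
    \<and> continuous_on {0..} f
    \<and> (\<forall>t\<ge>0. (\<xi> has_real_derivative w t) (at t within {0..}) \<and> (w has_real_derivative - f t) (at t within {0..})
        \<and> f t = B * \<xi> t + C * w t + (\<Sum>n. b n t * r n) + (\<Sum>n. a n t * q n))
    \<and> (\<forall>T\<ge>0. \<exists>M. summable M \<and> (\<forall>n. \<forall>t\<in>{0..T}. (d n t)\<^sup>2 \<le> M n \<and> \<omega> n * (b n t)\<^sup>2 \<le> M n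
        \<and> \<omega> n * (a n t)\<^sup>2 \<le> M n \<and> (b n t)\<^sup>2 \<le> M n))"
proof -
  define f where "f y t = f0 + integral {0..t} y" for y :: "real \<Rightarrow> real" and t
  define w where "w y t = w0 - integral {0..t} (f y)" for y t
  define \<xi> where "\<xi> y t = \<xi>0 + integral {0..t} (w y)" for y t
  have cf: "continuous_on {0..} (f y)" if "continuous_on {0..} y" for y
    unfolding f_def[abs_def] by (intro continuous_intros continuous_on_integral_atLeast0 that)
  have cw: "continuous_on {0..} (w y)" if "continuous_on {0..} y" for y
    unfolding w_def[abs_def] by (intro continuous_intros continuous_on_integral_atLeast0 cf that)
  \<comment> \<open>The continuity condition is placed inside the existential, so that a solution
    can be chosen as a function of every \<open>y\<close>, continuous or not.\<close>
  have "\<forall>n y. \<exists>ab. continuous_on {0..} y \<longrightarrow> fst ab 0 = a0 n \<and> snd ab 0 = b0 n \<and>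
     (\<forall>t\<ge>0. (fst ab has_real_derivative snd ab t) (at t within {0..}) \<and>
            (snd ab has_real_derivative - \<gamma> n * snd ab t - \<omega> n * fst ab t + \<beta> n * f y t) (at t within {0..}))"
  proof (intro allI)
    fix n and y :: "real \<Rightarrow> real"
    show "\<exists>ab. continuous_on {0..} y \<longrightarrow> fst ab 0 = a0 n \<and> snd ab 0 = b0 n \<and>
     (\<forall>t\<ge>0. (fst ab has_real_derivative snd ab t) (at t within {0..}) \<and>
            (snd ab has_real_derivative - \<gamma> n * snd ab t - \<omega> n * fst ab t + \<beta> n * f y t) (at t within {0..}))"
    proof (cases "continuous_on {0..} y")
      case True
      have "continuous_on {0..} (\<lambda>t. \<beta> n * f y t)" by (intro continuous_intros cf True)
      from second_order_ode_exists[OF this, of "a0 n" "b0 n" "\<gamma> n" "\<omega> n"]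
      show ?thesis by auto
    qed simp
  qed
  then obtain ab where ab: "\<And>n y. continuous_on {0..} y \<Longrightarrow> fst (ab n y) 0 = a0 n \<and> snd (ab n y) 0 = b0 n \<and>
     (\<forall>t\<ge>0. (fst (ab n y) has_real_derivative snd (ab n y) t) (at t within {0..}) \<and>
            (snd (ab n y) has_real_derivative - \<gamma> n * snd (ab n y) t - \<omega> n * fst (ab n y) t + \<beta> n * f y t) (at t within {0..}))"
    by metis
  define a where "a y n = fst (ab n y)" for y n
  define b where "b y n = snd (ab n y)" for y n
  define d where "d y n t = - \<gamma> n * b y n t - \<omega> n * a y n t + \<beta> n * f y t" for y n t
  have init: "a y n 0 = a0 n" "b y n 0 = b0 n" if "continuous_on {0..} y" for y n
    using ab[OF that, of n] by (simp_all add: a_def b_def)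
  have da: "(a y n has_real_derivative b y n t) (at t within {0..})"
    and db: "(b y n has_real_derivative d y n t) (at t within {0..})" if "continuous_on {0..} y" "0 \<le> t" for y n t
    using ab[OF that(1), of n] that(2) by (simp_all add: a_def b_def d_def)
  have df: "(f y has_real_derivative y t) (at t within {0..})" if "continuous_on {0..} y" "0 \<le> t" for y t
    unfolding f_def[abs_def] using integral_has_derivative_atLeast0[OF that] by (auto intro!: derivative_eq_intros)
  have dw: "(w y has_real_derivative - f y t) (at t within {0..})" if "continuous_on {0..} y" "0 \<le> t" for y t
    unfolding w_def[abs_def] using integral_has_derivative_atLeast0[OF cf[OF that(1)] that(2)] by (auto intro!: derivative_eq_intros)
  have d\<xi>: "(\<xi> y has_real_derivative w y t) (at t within {0..})" if "continuous_on {0..} y" "0 \<le> t" for y t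
    unfolding \<xi>_def[abs_def] using integral_has_derivative_atLeast0[OF cw[OF that(1)] that(2)] by (auto intro!: derivative_eq_intros)
  \<comment> \<open>The acceleration obeys the same oscillator equation with f replaced by its
    derivative \<open>y\<close>, so the energy estimate applies to the pair of velocity and
    acceleration.\<close>
  have dd: "(d y n has_real_derivative - \<gamma> n * d y n t - \<omega> n * b y n t + \<beta> n * y t) (at t within {0..})"
    if "continuous_on {0..} y" "0 \<le> t" for y n t
    unfolding d_def[abs_def]
    by (rule derivative_eq_intros da[OF that] db[OF that] df[OF that] refl)+ (simp add: d_def)
  have d0': "d y n 0 = - \<gamma> n * b0 n - \<omega> n * a0 n + \<beta> n * f0" if "continuous_on {0..} y" for y n
    by (simp add: d_def init[OF that] f_def)
  have c: "continuous_on {0..} (a y n)" "continuous_on {0..} (b y n)" "continuous_on {0..} (d y n)"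
    if "continuous_on {0..} y" for y n
    by (rule DERIV_continuous_on, rule da[OF that] db[OF that] dd[OF that], simp)+
  have dom: "\<exists>M. summable M \<and> (\<forall>n. 0 \<le> M n) \<and> (\<forall>n. \<forall>t\<in>{0..T}. (d y n t)\<^sup>2 \<le> M n \<and> \<omega> n * (b y n t)\<^sup>2 \<le> M n
        \<and> \<omega> n * (a y n t)\<^sup>2 \<le> M n \<and> (b y n t)\<^sup>2 \<le> M n)" if y: "continuous_on {0..} y" and T: "0 \<le> T" for y T
  proof -
    \<comment> \<open>\<open>M1\<close> bounds the energy of velocity and acceleration,
      \<open>M2\<close> that of displacement and velocity; summability of both starts from the
      initial data.\<close>
    define M1 where "M1 n = (- \<gamma> n * b0 n - \<omega> n * a0 n + \<beta> n * f0)\<^sup>2 + \<omega> n * (b0 n)\<^sup>2 + K n * integral {0..T} (\<lambda>s. (y s)\<^sup>2)" for n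
    define M2 where "M2 n = (b0 n)\<^sup>2 + \<omega> n * (a0 n)\<^sup>2 + K n * integral {0..T} (\<lambda>s. (f y s)\<^sup>2)" for n
    have cy2: "continuous_on {0..} (\<lambda>s. (y s)\<^sup>2)" "continuous_on {0..} (\<lambda>s. (f y s)\<^sup>2)"
      by (intro continuous_intros y cf[OF y])+
    have nn: "0 \<le> M1 n" "0 \<le> M2 n" for n
      unfolding M1_def M2_def using \<omega>[of n] K(1)[of n]
      by (auto intro!: add_nonneg_nonneg mult_nonneg_nonneg integral_nonneg integrable_on_atLeast0 cy2)
    have s: "summable (\<lambda>n. M1 n + M2 n)" unfolding M1_def M2_def
      by (intro summable_add d0 b0 a0 summable_mult2 K)
    have bd: "(d y n t)\<^sup>2 + \<omega> n * (b y n t)\<^sup>2 \<le> M1 n" "(b y n t)\<^sup>2 + \<omega> n * (a y n t)\<^sup>2 \<le> M2 n" if t: "t \<in> {0..T}" for n t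
    proof -
      have t0: "0 \<le> t" using t by simp
      have "(d y n t)\<^sup>2 + \<omega> n * (b y n t)\<^sup>2 \<le> (d y n 0)\<^sup>2 + \<omega> n * (b y n 0)\<^sup>2 + K n * integral {0..t} (\<lambda>s. (y s)\<^sup>2)"
        by (rule damped_energy_estimate[OF db[OF y] dd[OF y] y \<gamma> K(1) \<beta> t0])
      also have "\<dots> \<le> M1 n" unfolding M1_def d0'[OF y] init[OF y]
        using t by (intro add_left_mono mult_left_mono K integral_mono_upper cy2) auto
      finally show "(d y n t)\<^sup>2 + \<omega> n * (b y n t)\<^sup>2 \<le> M1 n" .
      have "(b y n t)\<^sup>2 + \<omega> n * (a y n t)\<^sup>2 \<le> (b y n 0)\<^sup>2 + \<omega> n * (a y n 0)\<^sup>2 + K n * integral {0..t} (\<lambda>s. (f y s)\<^sup>2)"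
        by (rule damped_energy_estimate[OF da[OF y] db[OF y, unfolded d_def] cf[OF y] \<gamma> K(1) \<beta> t0])
      also have "\<dots> \<le> M2 n" unfolding M2_def init[OF y]
        using t by (intro add_left_mono mult_left_mono K integral_mono_upper cy2) auto
      finally show "(b y n t)\<^sup>2 + \<omega> n * (a y n t)\<^sup>2 \<le> M2 n" .
    qed
    have "(d y n t)\<^sup>2 \<le> M1 n + M2 n \<and> \<omega> n * (b y n t)\<^sup>2 \<le> M1 n + M2 n
        \<and> \<omega> n * (a y n t)\<^sup>2 \<le> M1 n + M2 n \<and> (b y n t)\<^sup>2 \<le> M1 n + M2 n" if t: "t \<in> {0..T}" for n t
      using bd[OF t, of n] nn[of n] zero_le_power2[of "d y n t"] zero_le_power2[of "b y n t"]
        mult_nonneg_nonneg[OF \<omega>[of n] zero_le_power2[of "a y n t"]] mult_nonneg_nonneg[OF \<omega>[of n] zero_le_power2[of "b y n t"]]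
      by linarith
    thus ?thesis using s nn by (intro exI[of _ "\<lambda>n. M1 n + M2 n"]) (auto intro: add_nonneg_nonneg)
  qed
  have domr: "\<exists>M. summable M \<and> (\<forall>n. \<forall>t\<in>{0..T}. \<bar>d y n t * r n\<bar> \<le> M n \<and> \<bar>b y n t * r n\<bar> \<le> M n \<and> \<bar>b y n t * q n\<bar> \<le> M n \<and> \<bar>a y n t * q n\<bar> \<le> M n)"
    if y: "continuous_on {0..} y" and T: "0 \<le> T" for y T
  proof -
    obtain M where M: "summable M" "\<And>n. 0 \<le> M n" "\<And>n t. t \<in> {0..T} \<Longrightarrow> (d y n t)\<^sup>2 \<le> M n \<and> \<omega> n * (b y n t)\<^sup>2 \<le> M n
        \<and> \<omega> n * (a y n t)\<^sup>2 \<le> M n \<and> (b y n t)\<^sup>2 \<le> M n"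
      using dom[OF y T] by blast
    have 1: "\<bar>x * r n\<bar> \<le> M n + (r n)\<^sup>2 + \<theta> n" if "x\<^sup>2 \<le> M n" for x n
    proof -
      have "\<bar>x * r n\<bar>\<^sup>2 \<le> M n * (r n)\<^sup>2" using that by (simp add: power_mult_distrib mult_right_mono)
      also have "\<dots> \<le> (M n + (r n)\<^sup>2)\<^sup>2" by (intro mult_le_sum_sq M) simp
      finally have "\<bar>x * r n\<bar> \<le> M n + (r n)\<^sup>2" by (rule power2_le_imp_le) (simp add: M)
      thus ?thesis using \<theta>(1)[of n] by simp
    qed
    have 2: "\<bar>x * q n\<bar> \<le> M n + (r n)\<^sup>2 + \<theta> n" if "\<omega> n * x\<^sup>2 \<le> M n" for x n
    proof -
      have "\<bar>x * q n\<bar>\<^sup>2 \<le> x\<^sup>2 * (\<omega> n * \<theta> n)" using q[of n] by (simp add: power_mult_distrib mult_left_mono)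
      also have "\<dots> = \<omega> n * x\<^sup>2 * \<theta> n" by simp
      also have "\<dots> \<le> M n * \<theta> n" by (rule mult_right_mono[OF that \<theta>(1)])
      also have "\<dots> \<le> (M n + \<theta> n)\<^sup>2" by (intro mult_le_sum_sq M \<theta>)
      finally have "\<bar>x * q n\<bar> \<le> M n + \<theta> n" by (rule power2_le_imp_le) (simp add: M \<theta>)
      thus ?thesis using zero_le_power2[of "r n"] by linarith
    qed
    have "summable (\<lambda>n. M n + (r n)\<^sup>2 + \<theta> n)" by (intro summable_add M r \<theta>)
    thus ?thesis using 1 2 M(3) by blast
  qed
  have domd: "\<exists>M. summable M \<and> (\<forall>n. \<forall>t\<in>{0..T}. \<bar>d y n t * r n\<bar> \<le> M n)" and
     dombq: "\<exists>M. summable M \<and> (\<forall>n. \<forall>t\<in>{0..T}. \<bar>b y n t * q n\<bar> \<le> M n)"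
    if y: "continuous_on {0..} y" and T: "0 \<le> T" for y T
    using domr[OF y T] by blast+
  have summ: "summable (\<lambda>n. d y n t * r n)" "summable (\<lambda>n. b y n t * r n)" "summable (\<lambda>n. b y n t * q n)" "summable (\<lambda>n. a y n t * q n)"
    if y: "continuous_on {0..} y" and t: "0 \<le> t" for y t
  proof -
    obtain M where M: "summable M" "\<And>n. \<bar>d y n t * r n\<bar> \<le> M n \<and> \<bar>b y n t * r n\<bar> \<le> M n \<and> \<bar>b y n t * q n\<bar> \<le> M n \<and> \<bar>a y n t * q n\<bar> \<le> M n"
      using domr[OF y t] t by force
    show "summable (\<lambda>n. d y n t * r n)" "summable (\<lambda>n. b y n t * r n)" "summable (\<lambda>n. b y n t * q n)" "summable (\<lambda>n. a y n t * q n)"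
      by (rule summable_comparison_test'[OF M(1)], use M(2) in simp)+
  qed
  \<comment> \<open>The time derivative of the feedback law, with the derivative of
    \<open>\<xi>\<close> replaced by \<open>w\<close> and that of \<open>w\<close> by - f.\<close>
  define \<Phi> where "\<Phi> y t = B * w y t - C * f y t + (\<Sum>n. d y n t * r n) + (\<Sum>n. b y n t * q n)" for y t
  define SK where "SK = (\<Sum>n. K n)"
  define k where "k T = 4 * (B\<^sup>2 * T ^ 3 + C\<^sup>2 * T + SK * (\<Sum>n. (r n)\<^sup>2) + SK * (\<Sum>n. \<theta> n))" for T :: real
  have SK: "0 \<le> SK" unfolding SK_def by (rule suminf_nonneg[OF K(2,1)])
  have Sr: "0 \<le> (\<Sum>n. (r n)\<^sup>2)" by (rule suminf_nonneg[OF r]) simp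
  have S\<theta>: "0 \<le> (\<Sum>n. \<theta> n)" by (rule suminf_nonneg[OF \<theta>(2,1)])
  have "\<exists>y. continuous_on {0..} y \<and> (\<forall>t\<ge>0. \<Phi> y t = y t)"
  proof (rule Volterra_fixed_point[where K=k])
    show "continuous_on {0..} (\<Phi> y)" if y: "continuous_on {0..} y" for y
      unfolding \<Phi>_def[abs_def]
      by (intro continuous_intros cw[OF y] cf[OF y] continuous_on_series_atLeast0 c[OF y] domd[OF y] dombq[OF y])
    show "0 \<le> k T" if "0 \<le> T" for T unfolding k_def using that SK Sr S\<theta> by simp
    fix T t :: real and y z :: "real \<Rightarrow> real"
    assume y: "continuous_on {0..} y" and z: "continuous_on {0..} z" and t: "0 \<le> t" "t \<le> T"
    let ?e = "\<lambda>s. y s - z s"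
    define J where "J = integral {0..t} (\<lambda>s. (?e s)\<^sup>2)"
    have e: "continuous_on {0..} ?e" by (intro continuous_intros y z)
    have J: "0 \<le> J" unfolding J_def by (rule integral_nonneg) (auto intro!: integrable_on_atLeast0 continuous_intros y z)
    have ef: "f y s - f z s = integral {0..s} ?e" for s
      unfolding f_def by (subst Henstock_Kurzweil_Integration.integral_diff) (auto intro!: integrable_on_atLeast0 y z)
    have ew: "w y t - w z t = - integral {0..t} (\<lambda>s. integral {0..s} ?e)"
      unfolding w_def ef[symmetric] by (subst Henstock_Kurzweil_Integration.integral_diff) (auto intro!: integrable_on_atLeast0 cf y z)
    have f2: "(f y t - f z t)\<^sup>2 \<le> t * J" unfolding ef J_def by (rule integral_sq_le[OF e t(1)])
    have w2: "(w y t - w z t)\<^sup>2 \<le> t ^ 3 * J" unfolding ew J_def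
      using integral_integral_sq_le[OF e t(1)] by simp
    have E: "(d y n t - d z n t)\<^sup>2 + \<omega> n * (b y n t - b z n t)\<^sup>2 \<le> K n * J" for n
    proof -
      have "(d y n t - d z n t)\<^sup>2 + \<omega> n * (b y n t - b z n t)\<^sup>2
         \<le> (d y n 0 - d z n 0)\<^sup>2 + \<omega> n * (b y n 0 - b z n 0)\<^sup>2 + K n * integral {0..t} (\<lambda>s. (?e s)\<^sup>2)"
      proof (rule damped_energy_estimate[OF _ _ e \<gamma> K(1) \<beta> t(1)])
        fix s :: real assume s: "0 \<le> s"
        show "((\<lambda>t. b y n t - b z n t) has_real_derivative d y n s - d z n s) (at s within {0..})"
          by (intro derivative_intros db y z s)
        show "((\<lambda>t. d y n t - d z n t) has_real_derivative
            - \<gamma> n * (d y n s - d z n s) - \<omega> n * (b y n s - b z n s) + \<beta> n * (y s - z s)) (at s within {0..})"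
          by (rule derivative_eq_intros dd[OF y s] dd[OF z s] refl)+ (simp add: algebra_simps)
      qed
      \<comment> \<open>The initial energy of the difference is 0: displacement and velocity share
        their data, and the accelerations agree because f starts at \<open>f0\<close> for either
        argument.\<close>
      thus ?thesis by (simp add: d0'[OF y] d0'[OF z] init[OF y] init[OF z] J_def)
    qed
    have dn: "(d y n t - d z n t)\<^sup>2 \<le> K n * J" and bn: "\<omega> n * (b y n t - b z n t)\<^sup>2 \<le> K n * J" for n
      using E[of n] zero_le_power2[of "d y n t - d z n t"] mult_nonneg_nonneg[OF \<omega>[of n] zero_le_power2[of "b y n t - b z n t"]]
      by linarith+
    have "(\<Sum>n. (d y n t - d z n t) * r n)\<^sup>2 \<le> (\<Sum>n. K n * J) * (\<Sum>n. (r n)\<^sup>2)"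
    proof (rule summable_sq_le_mult)
      show "((d y n t - d z n t) * r n)\<^sup>2 \<le> K n * J * (r n)\<^sup>2" for n
        unfolding power_mult_distrib by (rule mult_right_mono[OF dn]) simp
    qed (use K J r in \<open>auto intro: summable_mult2\<close>)
    hence 1: "(\<Sum>n. (d y n t - d z n t) * r n)\<^sup>2 \<le> SK * J * (\<Sum>n. (r n)\<^sup>2)"
      using suminf_mult2[OF K(2), of J] by (simp add: SK_def)
    have "(\<Sum>n. (b y n t - b z n t) * q n)\<^sup>2 \<le> (\<Sum>n. K n * J) * (\<Sum>n. \<theta> n)"
    proof (rule summable_sq_le_mult)
      show "((b y n t - b z n t) * q n)\<^sup>2 \<le> K n * J * \<theta> n" for n
      proof -
        have "((b y n t - b z n t) * q n)\<^sup>2 \<le> (b y n t - b z n t)\<^sup>2 * (\<omega> n * \<theta> n)"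
          unfolding power_mult_distrib by (rule mult_left_mono[OF q]) simp
        also have "\<dots> = \<omega> n * (b y n t - b z n t)\<^sup>2 * \<theta> n" by simp
        also have "\<dots> \<le> K n * J * \<theta> n" by (rule mult_right_mono[OF bn \<theta>(1)])
        finally show ?thesis .
      qed
    qed (use K J \<theta> in \<open>auto intro: summable_mult2\<close>)
    hence 2: "(\<Sum>n. (b y n t - b z n t) * q n)\<^sup>2 \<le> SK * J * (\<Sum>n. \<theta> n)"
      using suminf_mult2[OF K(2), of J] by (simp add: SK_def)
    define S1 where "S1 = (\<Sum>n. (d y n t - d z n t) * r n)"
    define S2 where "S2 = (\<Sum>n. (b y n t - b z n t) * q n)"
    have S1: "S1 = (\<Sum>n. d y n t * r n) - (\<Sum>n. d z n t * r n)"
      unfolding S1_def left_diff_distrib by (rule suminf_diff[symmetric]) (intro summ y z t)+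
    have S2: "S2 = (\<Sum>n. b y n t * q n) - (\<Sum>n. b z n t * q n)"
      unfolding S2_def left_diff_distrib by (rule suminf_diff[symmetric]) (intro summ y z t)+
    have "\<Phi> y t - \<Phi> z t = (B * (w y t - w z t) + (- C) * (f y t - f z t)) + (S1 + S2)"
      unfolding \<Phi>_def S1 S2 by (simp add: algebra_simps)
    hence "(\<Phi> y t - \<Phi> z t)\<^sup>2 \<le> 4 * (B\<^sup>2 * (w y t - w z t)\<^sup>2 + C\<^sup>2 * (f y t - f z t)\<^sup>2 + S1\<^sup>2 + S2\<^sup>2)"
      using sq_sum4_le[of "B * (w y t - w z t)" "(- C) * (f y t - f z t)" S1 S2]
      by (simp only: power_mult_distrib power2_minus)
    also have "\<dots> \<le> 4 * (B\<^sup>2 * (T ^ 3 * J) + C\<^sup>2 * (T * J) + SK * J * (\<Sum>n. (r n)\<^sup>2) + SK * J * (\<Sum>n. \<theta> n))"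
      using t J unfolding S1_def S2_def
      by (intro mult_left_mono add_mono 1 2 order_trans[OF w2] order_trans[OF f2] mult_right_mono power_mono) auto
    also have "\<dots> = k T * J" by (simp add: k_def algebra_simps)
    finally show "(\<Phi> y t - \<Phi> z t)\<^sup>2 \<le> k T * integral {0..t} (\<lambda>s. (?e s)\<^sup>2)" by (simp add: J_def)
  qed
  then obtain y where y: "continuous_on {0..} y" and fixp: "\<And>t. 0 \<le> t \<Longrightarrow> \<Phi> y t = y t" by blast
  \<comment> \<open>A fixed point only equates the derivatives of both sides. The integration
    constant is settled at time 0 by the choice of \<open>f0\<close>; a difference with derivative 0
    is then both nonincreasing and nondecreasing.\<close>
  have feq: "f y t = B * \<xi> y t + C * w y t + (\<Sum>n. b y n t * r n) + (\<Sum>n. a y n t * q n)" if t: "0 \<le> t" for t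
  proof -
    let ?F = "\<lambda>t. B * \<xi> y t + C * w y t + (\<Sum>n. b y n t * r n) + (\<Sum>n. a y n t * q n)"
    have D: "((\<lambda>t. ?F t - f y t) has_real_derivative 0) (at s within {0..})" if s: "0 \<le> s" for s
    proof -
      have 1: "((\<lambda>t. \<Sum>n. b y n t * r n) has_real_derivative (\<Sum>n. d y n s * r n)) (at s within {0..})"
        by (rule has_derivative_series_atLeast0[OF _ _ domd[OF y] s])
          (auto intro!: summ y DERIV_cmult_right db)
      have 2: "((\<lambda>t. \<Sum>n. a y n t * q n) has_real_derivative (\<Sum>n. b y n s * q n)) (at s within {0..})"
        by (rule has_derivative_series_atLeast0[OF _ _ dombq[OF y] s])
          (auto intro!: summ y DERIV_cmult_right da)
      have "(?F has_real_derivative \<Phi> y s) (at s within {0..})"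
        by (rule derivative_eq_intros d\<xi>[OF y s] dw[OF y s] 1 2 refl)+ (simp add: \<Phi>_def)
      from DERIV_diff[OF this df[OF y s]] show ?thesis by (simp add: fixp[OF s])
    qed
    have D': "((\<lambda>t. - (?F t - f y t)) has_real_derivative 0) (at s within {0..})" if s: "0 \<le> s" for s
      using DERIV_minus[OF D[OF s]] by simp
    have "?F 0 - f y 0 = 0"
      unfolding f_def \<xi>_def w_def init[OF y] using f0 by simp
    moreover have "?F t - f y t \<le> ?F 0 - f y 0"
      by (rule nonincreasing_atLeast0[OF D _ t]) auto
    moreover have "- (?F t - f y t) \<le> - (?F 0 - f y 0)"
      by (rule nonincreasing_atLeast0[OF D' _ t]) auto
    ultimately show ?thesis by simp
  qed
  show ?thesis
  proof (rule exI[of _ "a y"], rule exI[of _ "b y"], rule exI[of _ "d y"], rule exI[of _ "\<xi> y"],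
      rule exI[of _ "w y"], rule exI[of _ "f y"], intro conjI allI impI)
    show "(a y n has_real_derivative b y n t) (at t within {0..})" if "0 \<le> t" for n t by (rule da[OF y that])
    show "(b y n has_real_derivative d y n t) (at t within {0..})" if "0 \<le> t" for n t by (rule db[OF y that])
    show "continuous_on {0..} (d y n)" for n by (rule c[OF y])
    show "d y n t = - \<gamma> n * b y n t - \<omega> n * a y n t + \<beta> n * f y t" for n t by (rule d_def)
    show "a y n 0 = a0 n" "b y n 0 = b0 n" for n by (rule init[OF y])+
    show "\<xi> y 0 = \<xi>0" "w y 0 = w0" by (simp_all add: \<xi>_def w_def)
    show "continuous_on {0..} (f y)" by (rule cf[OF y])
    show "(\<xi> y has_real_derivative w y t) (at t within {0..})" if "0 \<le> t" for t by (rule d\<xi>[OF y that])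
    show "(w y has_real_derivative - f y t) (at t within {0..})" if "0 \<le> t" for t by (rule dw[OF y that])
    show "f y t = B * \<xi> y t + C * w y t + (\<Sum>n. b y n t * r n) + (\<Sum>n. a y n t * q n)" if "0 \<le> t" for t by (rule feq[OF that])
    show "\<exists>M. summable M \<and> (\<forall>n. \<forall>t\<in>{0..T}. (d y n t)\<^sup>2 \<le> M n \<and> \<omega> n * (b y n t)\<^sup>2 \<le> M n
        \<and> \<omega> n * (a y n t)\<^sup>2 \<le> M n \<and> (b y n t)\<^sup>2 \<le> M n)" if "0 \<le> T" for T
      using dom[OF y that] by blast
  qed
qed

section \<open>Sobolev functions and their cosine coefficients\<close>

definition dce :: "real \<Rightarrow> nat \<Rightarrow> real \<Rightarrow> real" where
  "dce L n x = - (if n = 0 then sqrt (1 / L) else sqrt (2 / L)) * (real n * pi / L) * sin (real n * pi * x / L)"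

lemma continuous_on_dce: "L > 0 \<Longrightarrow> continuous_on A (dce L n)"
  unfolding dce_def by (auto intro!: continuous_intros)

lemma dce_boundary: "L > 0 \<Longrightarrow> dce L n 0 = 0" "L > 0 \<Longrightarrow> dce L n L = 0"
  by (simp_all add: dce_def)

lemma ce_primitive:
  assumes "L > 0" "x \<in> {0..L}"
  shows "ce L n x = ce L n 0 + integral {0..x} (dce L n)"
proof -
  have "(dce L n has_integral ce L n x - ce L n 0) {0..x}"
    unfolding ce_def dce_def using assms
    by (intro fundamental_theorem_of_calculus)
      (auto intro!: derivative_eq_intros simp flip: has_real_derivative_iff_has_vector_derivative)
  thus ?thesis by (simp add: integral_unique)
qed

lemma dce_primitive:
  assumes "L > 0" "x \<in> {0..L}"
  shows "dce L n x = dce L n 0 + integral {0..x} (\<lambda>x. - lam L n * ce L n x)"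
proof -
  have "((\<lambda>x. - lam L n * ce L n x) has_integral dce L n x - dce L n 0) {0..x}"
    unfolding ce_def dce_def lam_def using assms
    by (intro fundamental_theorem_of_calculus)
      (auto intro!: derivative_eq_intros simp flip: has_real_derivative_iff_has_vector_derivative simp: power2_eq_square)
  hence "integral {0..x} (\<lambda>x. - lam L n * ce L n x) = dce L n x - dce L n 0" by (rule integral_unique)
  thus ?thesis by linarith
qed

text \<open>The derivative of a Neumann cosine vanishes at both ends, so the second integration by
  parts leaves no boundary term and only the values of \<open>f1\<close> survive. For
  \<open>f1\<close> = phi_x they are zero; for \<open>f1\<close> = phi_xxx they are the channel
  through which the feedback acts.\<close>

lemma coeff_second_derivative:
  assumes L: "L > 0" and f2: "integrable (lebesgue_on {0..L}) f2"
    and f1: "\<And>x. x \<in> {0..L} \<Longrightarrow> f1 x = f1 0 + integral {0..x} f2"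
    and f: "\<And>x. x \<in> {0..L} \<Longrightarrow> f x = f 0 + integral {0..x} f1"
    and f1c: "continuous_on {0..L} f1"
  shows "ip L f2 (ce L n) = f1 L * ce L n L - f1 0 * ce L n 0 - lam L n * ip L f (ce L n)"
proof -
  have id: "integrable (lebesgue_on {0..L}) (dce L n)"
    by (intro continuous_imp_integrable_real continuous_on_dce L)
  have il: "integrable (lebesgue_on {0..L}) (\<lambda>x. - lam L n * ce L n x)"
    by (intro continuous_imp_integrable_real continuous_intros continuous_on_ce L)
  have if1: "integrable (lebesgue_on {0..L}) f1" by (intro continuous_imp_integrable_real f1c)
  have "ip L f2 (ce L n) = f1 L * ce L n L - f1 0 * ce L n 0 - ip L f1 (dce L n)"
    by (rule primitive_by_parts_affine[OF f2 id _ f1 ce_primitive[OF L]]) (use L in simp_all)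
  also have "ip L f1 (dce L n) = f L * dce L n L - f 0 * dce L n 0 - ip L f (\<lambda>x. - lam L n * ce L n x)"
    by (rule primitive_by_parts_affine[OF if1 il _ f dce_primitive[OF L]]) (use L in simp_all)
  also have "\<dots> = lam L n * ip L f (ce L n)"
    unfolding ip_cmult_right by (simp add: dce_boundary L)
  finally show ?thesis .
qed

text \<open>Both weak derivatives are replaced by primitives, which changes functions only on null
  sets; \<open>bval\<close> is the endpoint value of the continuous representative
  \<open>F1\<close>.\<close>

lemma coeff_weak_second_derivative:
  assumes L: "L > 0" and w1: "weak_deriv L f f1" and w2: "weak_deriv L f1 f2"
  shows "ip L f2 (ce L n) = bval L f1 L * ce L n L - bval L f1 0 * ce L n 0 - lam L n * ip L f (ce L n)"
    and "\<exists>F1. continuous_on {0..L} F1 \<and> (AE x in lebesgue_on {0..L}. f1 x = F1 x) \<and>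
      (\<forall>x\<in>{0..L}. F1 x = bval L f1 0 + integral {0..x} f2)"
proof -
  obtain c1 where c1: "AE x in lebesgue_on {0..L}. f1 x = c1 + integral {0..x} f2"
    using weak_deriv_imp_primitive[OF L w2] by blast
  obtain c where c: "AE x in lebesgue_on {0..L}. f x = c + integral {0..x} f1"
    using weak_deriv_imp_primitive[OF L w1] by blast
  have i: "integrable (lebesgue_on {0..L}) f" "integrable (lebesgue_on {0..L}) f1" "integrable (lebesgue_on {0..L}) f2"
    using w1 w2 by (auto simp: weak_deriv_def)
  define F1 where "F1 x = c1 + integral {0..x} f2" for x
  define F where "F x = c + integral {0..x} F1" for x
  have cF1: "continuous_on {0..L} F1"
    unfolding F1_def[abs_def] by (intro continuous_intros continuous_on_primitive i)
  have ae1: "AE x in lebesgue_on {0..L}. f1 x = F1 x" using c1 by (simp add: F1_def)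
  have "AE x in lebesgue_on {0..L}. x \<in> {0..L}" by (rule AE_I2) (simp add: space_restrict_space)
  with c have ae: "AE x in lebesgue_on {0..L}. f x = F x"
    by eventually_elim (simp only: F_def primitive_cong_AE[OF i(2) ae1])
  have b0: "bval L f1 0 = F1 0" by (rule bval_eq[OF L cF1 ae1]) (use L in simp)
  have bL: "bval L f1 L = F1 L" by (rule bval_eq[OF L cF1 ae1]) (use L in simp)
  have F1eq: "F1 x = F1 0 + integral {0..x} f2" for x by (simp add: F1_def)
  have Feq: "F x = F 0 + integral {0..x} F1" for x by (simp add: F_def)
  have "ip L f (ce L n) = ip L F (ce L n)"
    by (rule ip_cong_AE[OF ae]) (use i L2_ce[OF L] in \<open>auto simp: L2_def\<close>)
  thus "ip L f2 (ce L n) = bval L f1 L * ce L n L - bval L f1 0 * ce L n 0 - lam L n * ip L f (ce L n)"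
    unfolding b0 bL using coeff_second_derivative[OF L i(3) F1eq Feq cF1] by metis
  show "\<exists>F1. continuous_on {0..L} F1 \<and> (AE x in lebesgue_on {0..L}. f1 x = F1 x) \<and>
      (\<forall>x\<in>{0..L}. F1 x = bval L f1 0 + integral {0..x} f2)"
    using cF1 ae1 F1eq b0 by metis
qed

section \<open>Sobolev membership through explicit chains of derivatives\<close>

lemma weak_deriv_cong:
  assumes ae: "AE x in lebesgue_on {0..L}. f x = f' x" and w: "weak_deriv L f g"
  shows "weak_deriv L f' g"
proof -
  have i: "integrable (lebesgue_on {0..L}) f" "integrable (lebesgue_on {0..L}) g" using w by (auto simp: weak_deriv_def)
  have i': "integrable (lebesgue_on {0..L}) f'"
    using i ae borel_measurable_lebesgue_on_AE[OF _ ae] by (subst integrable_cong_AE[where g=f]) auto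
  have "ip L f' (deriv \<psi>) = ip L f (deriv \<psi>)" if "test_fun L \<psi>" for \<psi>
    by (rule ip_cong_AE[OF ae, symmetric])
      (use i in \<open>auto intro!: borel_measurable_integrable continuous_imp_integrable_real test_fun_facts[OF that]\<close>)
  thus ?thesis using i i' w unfolding weak_deriv_def by auto
qed

text \<open>Iterates of \<open>wd\<close> are chosen functions and known only almost everywhere. An
  explicit chain \<open>g\<close> is compared with them one derivative at a time, since a weak
  derivative does not notice changes on null sets.\<close>

lemma wd_chain:
  assumes L: "L > 0" and ae: "AE x in lebesgue_on {0..L}. f x = g 0 x"
    and w: "\<And>j. j < k \<Longrightarrow> weak_deriv L (g j) (g (Suc j))"
  shows "j \<le> k \<Longrightarrow> AE x in lebesgue_on {0..L}. (wd L ^^ j) f x = g j x"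
    and "j < k \<Longrightarrow> weak_deriv L ((wd L ^^ j) f) ((wd L ^^ Suc j) f)"
proof -
  have step: "weak_deriv L ((wd L ^^ j) f) (g (Suc j))"
    if "AE x in lebesgue_on {0..L}. (wd L ^^ j) f x = g j x" "j < k" for j
    by (rule weak_deriv_cong[OF _ w[OF that(2)]]) (use that(1) in \<open>eventually_elim, simp\<close>)
  show A: "AE x in lebesgue_on {0..L}. (wd L ^^ j) f x = g j x" if "j \<le> k" for j
    using that
  proof (induction j)
    case 0
    thus ?case using ae by simp
  next
    case (Suc j)
    hence "weak_deriv L ((wd L ^^ j) f) (g (Suc j))" by (intro step) auto
    thus ?case using wd_AE(2)[OF L] by simp
  qed
  show "weak_deriv L ((wd L ^^ j) f) ((wd L ^^ Suc j) f)" if "j < k" for j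
    using wd_AE(1)[OF L step[OF A that]] that by simp
qed

lemma inHk_chain:
  assumes L: "L > 0" and ae: "AE x in lebesgue_on {0..L}. f x = g 0 x"
    and w: "\<And>j. j < k \<Longrightarrow> weak_deriv L (g j) (g (Suc j))"
    and L2: "\<And>j. j \<le> k \<Longrightarrow> L2 L (g j)"
  shows "inHk L k f" "hknorm L k f \<le> (\<Sum>j\<le>k. l2norm L (g j))"
proof -
  have C: "AE x in lebesgue_on {0..L}. (wd L ^^ j) f x = g j x" if "j \<le> k" for j
    by (rule wd_chain(1)[OF L ae w that])
  show "inHk L k f" unfolding inHk_def
  proof (intro conjI allI impI)
    fix j assume "j \<le> k"
    from C[OF this] have "AE x in lebesgue_on {0..L}. g j x = (wd L ^^ j) f x" by eventually_elim simp
    from L2_cong_AE[OF L2[OF \<open>j \<le> k\<close>] this] show "L2 L ((wd L ^^ j) f)" .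
  qed (rule wd_chain(2)[OF L ae w])
  have "l2norm L ((wd L ^^ j) f) = l2norm L (g j)" if "j \<le> k" for j
  proof (rule l2norm_cong_AE[symmetric])
    from C[OF that] show "AE x in lebesgue_on {0..L}. g j x = (wd L ^^ j) f x" by eventually_elim simp
    show "g j \<in> borel_measurable (lebesgue_on {0..L})" using L2[OF that] by (simp add: L2_def)
  qed
  hence "hknorm L k f = L2_set (\<lambda>j. l2norm L (g j)) {..k}" by (simp add: hknorm_def L2_set_def)
  also have "\<dots> \<le> (\<Sum>j\<le>k. l2norm L (g j))" by (rule L2_set_le_sum) (rule l2norm_nonneg)
  finally show "hknorm L k f \<le> (\<Sum>j\<le>k. l2norm L (g j))" .
qed

lemma l2norm_le_hknorm: "l2norm L f \<le> hknorm L k f"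
proof -
  have "l2norm L ((wd L ^^ 0) f) ^ 2 \<le> (\<Sum>j\<le>k. (l2norm L ((wd L ^^ j) f))\<^sup>2)"
    by (rule member_le_sum[of 0 "{..k}" "\<lambda>j. (l2norm L ((wd L ^^ j) f))\<^sup>2"]) auto
  thus ?thesis unfolding hknorm_def by (intro real_le_rsqrt) simp
qed

lemma hknorm_0: "hknorm L 0 f = l2norm L f"
  by (simp add: hknorm_def l2norm_nonneg)

text \<open>\<open>D2 L A s\<close> is the solution of \<open>F'' = s\<close> with \<open>F'(0) = A\<close> and mean value 0.\<close>

definition D1 :: "real \<Rightarrow> (real \<Rightarrow> real) \<Rightarrow> real \<Rightarrow> real" where
  "D1 A s x = A + integral {0..x} s"

definition D2 :: "real \<Rightarrow> real \<Rightarrow> (real \<Rightarrow> real) \<Rightarrow> real \<Rightarrow> real" where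
  "D2 L A s x = integral {0..x} (D1 A s) - integral {0..L} (\<lambda>z. integral {0..z} (D1 A s)) / L"

lemma continuous_on_D1: "integrable (lebesgue_on {0..L}) s \<Longrightarrow> continuous_on {0..L} (D1 A s)"
  unfolding D1_def[abs_def] by (intro continuous_intros continuous_on_primitive)

lemma integrable_D1: "integrable (lebesgue_on {0..L}) s \<Longrightarrow> integrable (lebesgue_on {0..L}) (D1 A s)"
  by (rule continuous_imp_integrable_real[OF continuous_on_D1])

lemma continuous_on_D2: "integrable (lebesgue_on {0..L}) s \<Longrightarrow> continuous_on {0..L} (D2 L A s)"
  unfolding D2_def[abs_def] by (intro continuous_on_diff continuous_on_const continuous_on_primitive integrable_D1)

lemma weak_deriv_D1: "L > 0 \<Longrightarrow> integrable (lebesgue_on {0..L}) s \<Longrightarrow> weak_deriv L (D1 A s) s"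
  by (rule primitive_weak_deriv[where c=A]) (auto simp: D1_def integrable_D1)

lemma weak_deriv_D2:
  assumes "L > 0" "integrable (lebesgue_on {0..L}) s"
  shows "weak_deriv L (D2 L A s) (D1 A s)"
  by (rule primitive_weak_deriv[where c="- integral {0..L} (\<lambda>z. integral {0..z} (D1 A s)) / L", OF assms(1)
      continuous_imp_integrable_real[OF continuous_on_D2[OF assms(2)]] integrable_D1[OF assms(2)]])
    (simp add: D2_def)

lemma integral_D2:
  assumes L: "L > 0" and s: "integrable (lebesgue_on {0..L}) s"
  shows "integral {0..L} (D2 L A s) = 0"
proof -
  have "(\<lambda>z. integral {0..z} (D1 A s)) integrable_on {0..L}"
    by (intro integrable_continuous_real continuous_on_primitive integrable_D1 s)
  hence "integral {0..L} (D2 L A s) = integral {0..L} (\<lambda>z. integral {0..z} (D1 A s))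
     - integral {0..L} (\<lambda>x. integral {0..L} (\<lambda>z. integral {0..z} (D1 A s)) / L)"
    unfolding D2_def[abs_def] by (subst Henstock_Kurzweil_Integration.integral_diff) (auto intro: integrable_const_ivl)
  thus ?thesis using L by simp
qed

lemma coeff_0: "L > 0 \<Longrightarrow> ip L f (ce L 0) = sqrt (1 / L) * (LINT x|lebesgue_on {0..L}. f x)"
  by (simp add: ip_def ce_def mult.commute)

lemma mean0_iff: "L > 0 \<Longrightarrow> mean0 L f \<longleftrightarrow> ip L f (ce L 0) = 0"
  by (simp add: coeff_0 mean0_def)

lemma mean0_D2: "L > 0 \<Longrightarrow> integrable (lebesgue_on {0..L}) s \<Longrightarrow> mean0 L (D2 L A s)"
  unfolding mean0_def
  by (subst lebesgue_integral_eq_integral)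
    (auto simp: integral_D2 intro!: continuous_imp_integrable_real continuous_on_D2)

lemma coeff_D2:
  assumes L: "L > 0" and s: "integrable (lebesgue_on {0..L}) s"
  shows "ip L s (ce L n) = D1 A s L * ce L n L - A * ce L n 0 - lam L n * ip L (D2 L A s) (ce L n)"
  using coeff_second_derivative[of L s "D1 A s" "D2 L A s" n, OF L s] continuous_on_D1[OF s, of A]
  by (simp add: D1_def D2_def)

lemma D1_lincomb:
  assumes s: "integrable (lebesgue_on {0..L}) s" "integrable (lebesgue_on {0..L}) s'" and x: "x \<in> {0..L}"
  shows "D1 (a * A + b * A') (\<lambda>x. a * s x + b * s' x) x = a * D1 A s x + b * D1 A' s' x"
proof -
  have i: "s integrable_on {0..x}" "s' integrable_on {0..x}"
    using x by (auto intro: integrable_on_subinterval[OF integrable_on_lebesgue_on[OF s(1)]]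
        integrable_on_subinterval[OF integrable_on_lebesgue_on[OF s(2)]])
  have "integral {0..x} (\<lambda>x. a * s x + b * s' x) = a * integral {0..x} s + b * integral {0..x} s'"
    using i by (intro integral_unique has_integral_add has_integral_mult_right integrable_integral)
  thus ?thesis by (simp add: D1_def algebra_simps)
qed

lemma D2_lincomb:
  assumes s: "integrable (lebesgue_on {0..L}) s" "integrable (lebesgue_on {0..L}) s'" and x: "x \<in> {0..L}"
  shows "D2 L (a * A + b * A') (\<lambda>x. a * s x + b * s' x) x = a * D2 L A s x + b * D2 L A' s' x"
proof -
  let ?h = "D1 (a * A + b * A') (\<lambda>x. a * s x + b * s' x)"
  have 1: "integral {0..z} ?h = a * integral {0..z} (D1 A s) + b * integral {0..z} (D1 A' s')" if z: "z \<in> {0..L}" for z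
  proof -
    have "integral {0..z} ?h = integral {0..z} (\<lambda>x. a * D1 A s x + b * D1 A' s' x)"
      by (rule integral_cong) (use D1_lincomb[OF s] z in auto)
    also have "\<dots> = a * integral {0..z} (D1 A s) + b * integral {0..z} (D1 A' s')"
      using z by (intro integral_unique has_integral_add has_integral_mult_right integrable_integral
          integrable_on_subinterval[OF integrable_on_lebesgue_on[OF integrable_D1[OF s(1)]]]
          integrable_on_subinterval[OF integrable_on_lebesgue_on[OF integrable_D1[OF s(2)]]]) auto
    finally show ?thesis .
  qed
  have "integral {0..L} (\<lambda>z. integral {0..z} ?h) = integral {0..L} (\<lambda>z. a * integral {0..z} (D1 A s) + b * integral {0..z} (D1 A' s'))"
    by (rule integral_cong) (use 1 in auto)
  also have "\<dots> = a * integral {0..L} (\<lambda>z. integral {0..z} (D1 A s)) + b * integral {0..L} (\<lambda>z. integral {0..z} (D1 A' s'))"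
    by (intro integral_unique has_integral_add has_integral_mult_right integrable_integral
       integrable_continuous_real continuous_on_primitive integrable_D1 s)
  finally show ?thesis unfolding D2_def 1[OF x] by (simp add: add_divide_distrib algebra_simps)
qed

lemma abs_primitive_le:
  assumes s: "L2 L s" and x: "x \<in> {0..L}"
  shows "\<bar>integral {0..x} s\<bar> \<le> sqrt L * l2norm L s"
proof -
  have i: "integrable (lebesgue_on {0..L}) s" by (rule L2_integrable[OF s])
  have "integral {0..x} s = (LINT t|lebesgue_on {0..L}. indicator {..x} t * s t)"
    by (rule integral_indicator_primitive[OF i x, symmetric])
  also have "\<bar>\<dots>\<bar> \<le> (LINT t|lebesgue_on {0..L}. \<bar>indicator {..x} t * s t\<bar>)" by (rule integral_abs_bound)
  also have "\<dots> \<le> (LINT t|lebesgue_on {0..L}. \<bar>s t\<bar>)"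
  proof (rule integral_mono)
    show "integrable (lebesgue_on {0..L}) (\<lambda>t. \<bar>indicator {..x} t * s t\<bar>)"
      by (rule integrable_abs[OF integrable_indicator_mult[OF i]]) simp
    show "integrable (lebesgue_on {0..L}) (\<lambda>t. \<bar>s t\<bar>)" by (rule integrable_abs[OF i])
  qed (simp add: indicator_def)
  also have "\<dots> \<le> sqrt L * l2norm L s" by (rule integral_abs_le_l2norm[OF s]) (use x in simp)
  finally show ?thesis .
qed

lemma abs_D1_le: "L2 L s \<Longrightarrow> x \<in> {0..L} \<Longrightarrow> \<bar>D1 A s x\<bar> \<le> \<bar>A\<bar> + sqrt L * l2norm L s"
  unfolding D1_def by (rule order_trans[OF abs_triangle_ineq add_left_mono[OF abs_primitive_le]])

lemma abs_integral_le:
  fixes g :: "real \<Rightarrow> real"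
  assumes "continuous_on {0..L} g" "x \<in> {0..L}" "\<And>y. y \<in> {0..L} \<Longrightarrow> \<bar>g y\<bar> \<le> K" "0 \<le> K"
  shows "\<bar>integral {0..x} g\<bar> \<le> L * K"
proof -
  have "norm (integral {0..x} g) \<le> K * (x - 0)"
    by (rule integral_bound) (use assms in \<open>auto intro: continuous_on_subset\<close>)
  also have "\<dots> \<le> L * K" using assms by (simp add: mult.commute[of L] mult_left_mono)
  finally show ?thesis by simp
qed

lemma abs_D2_le:
  assumes L: "L > 0" and s: "L2 L s" and x: "x \<in> {0..L}"
  shows "\<bar>D2 L A s x\<bar> \<le> 2 * L * (\<bar>A\<bar> + sqrt L * l2norm L s)"
proof -
  let ?K = "\<bar>A\<bar> + sqrt L * l2norm L s"
  have K: "0 \<le> ?K" using L by (simp add: l2norm_nonneg)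
  note i = L2_integrable[OF s]
  have 1: "\<bar>integral {0..z} (D1 A s)\<bar> \<le> L * ?K" if "z \<in> {0..L}" for z
    by (rule abs_integral_le[OF continuous_on_D1[OF i] that abs_D1_le[OF s] K])
  have "\<bar>integral {0..L} (\<lambda>z. integral {0..z} (D1 A s))\<bar> \<le> L * (L * ?K)"
    by (rule abs_integral_le[OF continuous_on_primitive[OF integrable_D1[OF i]] _ 1]) (use L K in auto)
  hence "\<bar>integral {0..L} (\<lambda>z. integral {0..z} (D1 A s)) / L\<bar> \<le> L * ?K"
    using L by (simp add: abs_divide field_simps)
  with 1[OF x] show ?thesis unfolding D2_def by linarith
qed

lemma l2norm_D1_le: "L > 0 \<Longrightarrow> L2 L s \<Longrightarrow> l2norm L (D1 A s) \<le> sqrt L * (\<bar>A\<bar> + sqrt L * l2norm L s)"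
  by (rule l2norm_bound[OF abs_D1_le]) (auto simp: l2norm_nonneg)

lemma l2norm_D2_le: "L > 0 \<Longrightarrow> L2 L s \<Longrightarrow> l2norm L (D2 L A s) \<le> sqrt L * (2 * L * (\<bar>A\<bar> + sqrt L * l2norm L s))"
  by (rule l2norm_bound[OF abs_D2_le]) (auto simp: l2norm_nonneg)

text \<open>The continuous primitives \<open>D2 L A s\<close> and \<open>D1 A s\<close> represent f
  and its derivative, so boundary values can be read off directly; the slope at L is
  \<open>A\<close> plus the total integral of \<open>s\<close>.\<close>

lemma D2_chain:
  assumes L: "L > 0" and s: "L2 L s" and ae: "AE x in lebesgue_on {0..L}. f x = D2 L A s x"
  shows "inHk L 2 f" "AE x in lebesgue_on {0..L}. wd L f x = D1 A s x"
    "AE x in lebesgue_on {0..L}. (wd L ^^ 2) f x = s x"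
    "bval L (wd L f) 0 = A" "bval L (wd L f) L = A + integral {0..L} s"
    "hknorm L 2 f \<le> l2norm L (D2 L A s) + l2norm L (D1 A s) + l2norm L s"
proof -
  define g where "g j = (if j = 0 then D2 L A s else if j = 1 then D1 A s else s)" for j :: nat
  note i = L2_integrable[OF s]
  have g: "g 0 = D2 L A s" "g (Suc 0) = D1 A s" "g 2 = s" by (simp_all add: g_def)
  have ae': "AE x in lebesgue_on {0..L}. f x = g 0 x" using ae by (simp add: g)
  have w: "weak_deriv L (g j) (g (Suc j))" if "j < 2" for j
    using that weak_deriv_D1[OF L i] weak_deriv_D2[OF L i] by (auto simp: less_2_cases_iff g_def)
  have l: "L2 L (g j)" if "j \<le> 2" for j
    using s L2_continuous[OF continuous_on_D1[OF i]] L2_continuous[OF continuous_on_D2[OF i]] by (auto simp: g_def)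
  show "inHk L 2 f" by (rule inHk_chain[OF L ae' w l])
  show a: "AE x in lebesgue_on {0..L}. wd L f x = D1 A s x" using wd_chain(1)[OF L ae' w, of 2 1] by (simp add: g)
  show "AE x in lebesgue_on {0..L}. (wd L ^^ 2) f x = s x" using wd_chain(1)[OF L ae' w, of 2 2] by (simp add: g)
  show "bval L (wd L f) 0 = A" using bval_eq[OF L continuous_on_D1[OF i] a, of 0] L by (simp add: D1_def)
  show "bval L (wd L f) L = A + integral {0..L} s" using bval_eq[OF L continuous_on_D1[OF i] a, of L] L by (simp add: D1_def)
  show "hknorm L 2 f \<le> l2norm L (D2 L A s) + l2norm L (D1 A s) + l2norm L s"
    using inHk_chain(2)[of L f g 2, OF L ae' w l] by (simp add: numeral_2_eq_2 g[unfolded numeral_2_eq_2])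
qed

text \<open>The outer slope 0 encodes the Neumann condition and the inner slope \<open>A\<close> is
  the third derivative at 0. Thus the boundary condition on the third derivative is built into the
  function rather than read off from a series.\<close>

lemma D2_D2_chain:
  assumes L: "L > 0" and z: "L2 L z" and ae: "AE x in lebesgue_on {0..L}. f x = D2 L 0 (D2 L A z) x"
  shows "inHk L 4 f" "AE x in lebesgue_on {0..L}. (wd L ^^ 4) f x = z x"
    "bval L ((wd L ^^ 3) f) 0 = A" "bval L ((wd L ^^ 3) f) L = A + integral {0..L} z"
    "hknorm L 4 f \<le> l2norm L (D2 L 0 (D2 L A z)) + l2norm L (D1 0 (D2 L A z)) + l2norm L (D2 L A z) + l2norm L (D1 A z) + l2norm L z"
proof -
  let ?s = "D2 L A z"
  define g where "g j = (if j = 0 then D2 L 0 ?s else if j = 1 then D1 0 ?s else if j = 2 then ?s else if j = 3 then D1 A z else z)" for j :: nat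
  note i = L2_integrable[OF z]
  have j: "integrable (lebesgue_on {0..L}) ?s" by (intro continuous_imp_integrable_real continuous_on_D2 i)
  have g: "g 0 = D2 L 0 ?s" "g (Suc 0) = D1 0 ?s" "g 2 = ?s" "g 3 = D1 A z" "g 4 = z" by (simp_all add: g_def)
  have ae': "AE x in lebesgue_on {0..L}. f x = g 0 x" using ae by (simp add: g)
  have w: "weak_deriv L (g n) (g (Suc n))" if "n < 4" for n
  proof -
    consider "n = 0" | "n = 1" | "n = 2" | "n = 3" using \<open>n < 4\<close> by linarith
    thus ?thesis
      by cases (simp_all add: g_def weak_deriv_D1[OF L i] weak_deriv_D2[OF L i] weak_deriv_D1[OF L j] weak_deriv_D2[OF L j])
  qed
  have l: "L2 L (g n)" if "n \<le> 4" for n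
    using z L2_continuous[OF continuous_on_D1[OF i]] L2_continuous[OF continuous_on_D2[OF i]]
      L2_continuous[OF continuous_on_D1[OF j]] L2_continuous[OF continuous_on_D2[OF j]] by (auto simp: g_def)
  show "inHk L 4 f" by (rule inHk_chain[OF L ae' w l])
  have a: "AE x in lebesgue_on {0..L}. (wd L ^^ 3) f x = D1 A z x" using wd_chain(1)[OF L ae' w, of 4 3] by (simp add: g)
  show "AE x in lebesgue_on {0..L}. (wd L ^^ 4) f x = z x" using wd_chain(1)[OF L ae' w, of 4 4] by (simp add: g)
  show "bval L ((wd L ^^ 3) f) 0 = A" using bval_eq[OF L continuous_on_D1[OF i] a, of 0] L by (simp add: D1_def)
  show "bval L ((wd L ^^ 3) f) L = A + integral {0..L} z" using bval_eq[OF L continuous_on_D1[OF i] a, of L] L by (simp add: D1_def)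
  have "{..4::nat} = {0, 1, 2, 3, 4}" by auto
  thus "hknorm L 4 f \<le> l2norm L (D2 L 0 ?s) + l2norm L (D1 0 ?s) + l2norm L ?s + l2norm L (D1 A z) + l2norm L z"
    using inHk_chain(2)[of L f g 4, OF L ae' w l] by (simp add: g)
qed

lemma hknorm_2_bound:
  assumes L: "L > 0"
  obtains K where "0 \<le> K" "\<And>f s. L2 L s \<Longrightarrow> AE x in lebesgue_on {0..L}. f x = D2 L 0 s x \<Longrightarrow> hknorm L 2 f \<le> K * l2norm L s"
proof -
  define c where "c = sqrt L"
  show thesis
  proof (rule that[of "c * (2 * L * c) + c * c + 1"])
    show "0 \<le> c * (2 * L * c) + c * c + 1" using L by (simp add: c_def)
    fix f s assume s: "L2 L s" and ae: "AE x in lebesgue_on {0..L}. f x = D2 L 0 s x"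
    have "l2norm L (D1 0 s) \<le> c * (c * l2norm L s)" "l2norm L (D2 L 0 s) \<le> c * (2 * L * (c * l2norm L s))"
      using l2norm_D1_le[OF L s, of 0] l2norm_D2_le[OF L s, of 0] by (simp_all add: c_def)
    thus "hknorm L 2 f \<le> (c * (2 * L * c) + c * c + 1) * l2norm L s"
      using D2_chain(6)[OF L s ae] by (simp add: algebra_simps)
  qed
qed

text \<open>Prescribed slopes and zero means fix all integration constants, so the fourth derivative
  and the number \<open>A\<close> control the whole H4 norm. Continuity in H4 then reduces to
  continuity of these two in time.\<close>

lemma hknorm_4_bound:
  assumes L: "L > 0"
  obtains K where "0 \<le> K" "\<And>f A z. L2 L z \<Longrightarrow> AE x in lebesgue_on {0..L}. f x = D2 L 0 (D2 L A z) x \<Longrightarrow>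
    hknorm L 4 f \<le> K * (\<bar>A\<bar> + l2norm L z)"
proof -
  define c where "c = sqrt L"
  have c: "0 \<le> c" "L = c * c" using L by (simp_all add: c_def)
  \<comment> \<open>Chosen so that \<bar>A\<bar> + c N is at most m times (\<bar>A\<bar> +
    N).\<close>
  define m where "m = 1 + c"
  have m: "1 \<le> m" using c by (simp add: m_def)
  define K1 where "K1 = c * m"
  define K2 where "K2 = c * (2 * L * m)"
  have K: "0 \<le> K1" "0 \<le> K2" using c m L by (auto simp: K1_def K2_def)
  have k1: "l2norm L (D1 A s) \<le> K1 * (\<bar>A\<bar> + l2norm L s)" and k2: "l2norm L (D2 L A s) \<le> K2 * (\<bar>A\<bar> + l2norm L s)"
    if "L2 L s" for A s
  proof -
    have le: "\<bar>A\<bar> + sqrt L * l2norm L s \<le> m * (\<bar>A\<bar> + l2norm L s)"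
      using c(1) l2norm_nonneg[of L s] by (simp add: m_def algebra_simps flip: c_def)
    show "l2norm L (D1 A s) \<le> K1 * (\<bar>A\<bar> + l2norm L s)"
      using order_trans[OF l2norm_D1_le[OF L that] mult_left_mono[OF le, of "sqrt L"]] L
      by (simp add: K1_def c_def mult.assoc)
    show "l2norm L (D2 L A s) \<le> K2 * (\<bar>A\<bar> + l2norm L s)"
      using order_trans[OF l2norm_D2_le[OF L that] mult_left_mono[OF mult_left_mono[OF le, of "2 * L"], of "sqrt L"]] L
      by (simp add: K2_def c_def mult.assoc)
  qed
  show thesis
  proof (rule that[of "(K2 + K1 + 1) * K2 + K1 + 1"])
    show "0 \<le> (K2 + K1 + 1) * K2 + K1 + 1" using K by simp
    fix f A z assume z: "L2 L z" and ae: "AE x in lebesgue_on {0..L}. f x = D2 L 0 (D2 L A z) x"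
    let ?N = "\<bar>A\<bar> + l2norm L z" and ?s = "D2 L A z"
    have s: "L2 L ?s" by (intro L2_continuous continuous_on_D2 L2_integrable z)
    have "hknorm L 4 f \<le> K2 * l2norm L ?s + K1 * l2norm L ?s + l2norm L ?s + K1 * ?N + ?N"
      using D2_D2_chain(5)[OF L z ae] k1[OF s, of 0] k2[OF s, of 0] k1[OF z, of A] by simp
    also have "\<dots> = (K2 + K1 + 1) * l2norm L ?s + (K1 + 1) * ?N" by (simp add: algebra_simps)
    also have "\<dots> \<le> (K2 + K1 + 1) * (K2 * ?N) + (K1 + 1) * ?N"
      using K by (intro add_right_mono mult_left_mono k2[OF z]) auto
    also have "\<dots> = ((K2 + K1 + 1) * K2 + K1 + 1) * ?N" by (simp add: algebra_simps)
    finally show "hknorm L 4 f \<le> ((K2 + K1 + 1) * K2 + K1 + 1) * ?N" .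
  qed
qed

section \<open>Convergence in L2 through coefficients\<close>

text \<open>By Parseval the squared norm is a series, and Tannery's theorem exchanges limit and sum
  under the summable bound \<open>M\<close>.\<close>

lemma l2norm_tendsto_0:
  assumes L: "L > 0" and X: "\<forall>\<^sub>F s in F. L2 L (X s)"
    and lim: "\<And>n. ((\<lambda>s. ip L (X s) (ce L n)) \<longlongrightarrow> 0) F"
    and bd: "\<forall>\<^sub>F s in F. \<forall>n. (ip L (X s) (ce L n))\<^sup>2 \<le> M n" and M: "summable M" and F: "F \<noteq> bot"
  shows "((\<lambda>s. l2norm L (X s)) \<longlongrightarrow> 0) F"
proof -
  have "((\<lambda>s. \<Sum>n. (ip L (X s) (ce L n))\<^sup>2) \<longlongrightarrow> (\<Sum>n. 0)) F"
  proof (rule conjunct2[OF conjunct2[OF tannerys_theorem[of _ _ F M]]])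
    show "((\<lambda>s. (ip L (X s) (ce L k))\<^sup>2) \<longlongrightarrow> 0) F" for k
      using tendsto_power[OF lim, of k 2] by simp
    have "\<forall>\<^sub>F (k, s) in sequentially \<times>\<^sub>F F. \<forall>n. (ip L (X s) (ce L n))\<^sup>2 \<le> M n"
      using bd by (subst eventually_prod2) auto
    thus "\<forall>\<^sub>F (k, s) in sequentially \<times>\<^sub>F F. norm ((ip L (X s) (ce L k))\<^sup>2) \<le> M k"
      by eventually_elim auto
  qed (use M F in auto)
  hence 1: "((\<lambda>s. sqrt (\<Sum>n. (ip L (X s) (ce L n))\<^sup>2)) \<longlongrightarrow> sqrt 0) F"
    by (intro tendsto_intros) simp
  have 2: "\<forall>\<^sub>F s in F. sqrt (\<Sum>n. (ip L (X s) (ce L n))\<^sup>2) = l2norm L (X s)"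
    using X
  proof eventually_elim
    case (elim s)
    have "(\<Sum>n. (ip L (X s) (ce L n))\<^sup>2) = (l2norm L (X s))\<^sup>2"
      using Parseval[OF L elim] by (simp add: sums_iff l2norm_sq)
    thus ?case by (simp add: l2norm_nonneg)
  qed
  from Lim_transform_eventually[OF 1 2] show ?thesis by simp
qed

section \<open>The sloshing system\<close>

lemma inHk_weak_deriv: "inHk L k f \<Longrightarrow> j < k \<Longrightarrow> weak_deriv L ((wd L ^^ j) f) ((wd L ^^ Suc j) f)"
  unfolding inHk_def by blast

locale sloshing =
  fixes L hs grav mu sig kappa B C :: real and r p :: "real \<Rightarrow> real"
  assumes L: "L > 0" and hs: "hs > 0" and grav: "grav > 0" and mu: "mu > 0" and sig: "sig > 0"
    and kappa: "kappa \<ge> 0" and r: "continuous_on {0..L} r" and p: "continuous_on {0..L} p"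
begin

definition gam :: "nat \<Rightarrow> real" where "gam n = mu * lam L n + kappa"
definition om :: "nat \<Rightarrow> real" where "om n = grav * hs * lam L n + sig * hs * (lam L n)\<^sup>2"
text \<open>The boundary terms of - sig hs phi_xxxx when phi_xxx equals - f / sig at both ends. It
  vanishes for even n and is a nonzero constant for odd n, so it is bounded but not square
  summable.\<close>

definition bet :: "nat \<Rightarrow> real" where "bet n = hs * (ce L n L - ce L n 0)"
definition Kf :: "nat \<Rightarrow> real" where "Kf n = (bet n)\<^sup>2 / (2 * mu * lam L n)"
text \<open>At \<open>n = 0\<close> the division by \<open>lam L 0 = 0\<close> gives \<open>Kf 0 = 0\<close>, as needed since \<open>bet 0 = 0\<close>.\<close>

definition Pt :: "real \<Rightarrow> real" where "Pt x = integral {0..L} p - integral {0..x} p"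
definition rc :: "nat \<Rightarrow> real" where "rc n = ip L r (ce L n)"
text \<open>The weight with which a displacement mode enters <phi_x, p>: the coefficient of phi_xx
  is - lam times that of phi.\<close>

definition qc :: "nat \<Rightarrow> real" where "qc n = - lam L n * ip L Pt (ce L n)"
text \<open>The summable remainder when the square of \<open>qc\<close> is divided by the leading
  part sig hs lam^2 of \<open>om\<close>.\<close>

definition th :: "nat \<Rightarrow> real" where "th n = (ip L Pt (ce L n))\<^sup>2 / (sig * hs)"

lemma lam_nonneg: "0 \<le> lam L n" by (simp add: lam_def)
lemma lam_0: "lam L 0 = 0" by (simp add: lam_def)
lemma lam_pos: "n \<noteq> 0 \<Longrightarrow> 0 < lam L n" using L by (simp add: lam_def)
lemma bet_0: "bet 0 = 0" by (simp add: bet_def ce_def)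
lemma gam_nonneg: "0 \<le> gam n" using mu kappa lam_nonneg by (simp add: gam_def)
lemma om_nonneg: "0 \<le> om n" using grav hs sig lam_nonneg[of n] by (simp add: om_def)
lemma om_ge: "sig * hs * (lam L n)\<^sup>2 \<le> om n" using grav hs lam_nonneg[of n] by (simp add: om_def)
lemma Kf_nonneg: "0 \<le> Kf n" using mu lam_nonneg[of n] by (simp add: Kf_def)

lemma bet_sq_le: "(bet n)\<^sup>2 \<le> 2 * gam n * Kf n"
proof (cases "n = 0")
  case True
  thus ?thesis by (simp add: bet_0 Kf_def)
next
  case False
  have "(bet n)\<^sup>2 = 2 * (mu * lam L n) * Kf n" using mu lam_pos[OF False] by (simp add: Kf_def)
  also have "\<dots> \<le> 2 * gam n * Kf n"
    using kappa Kf_nonneg by (intro mult_right_mono mult_left_mono) (auto simp: gam_def)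
  finally show ?thesis .
qed

text \<open>The squared boundary coefficient stays bounded while lam grows like n^2, so comparison
  with the series of 1/n^2 applies.\<close>

lemma Kf_summable: "summable Kf"
proof (rule summable_comparison_test')
  define c where "c = (hs * (2 * sqrt (2 / L)))\<^sup>2 / (2 * mu * (pi / L)\<^sup>2)"
  show "summable (\<lambda>n. c * inverse (real n ^ 2))"
    by (intro summable_mult inverse_power_summable) simp
  show "norm (Kf n) \<le> c * inverse (real n ^ 2)" if "n \<ge> 0" for n
  proof (cases "n = 0")
    case True
    thus ?thesis by (simp add: Kf_def lam_0)
  next
    case False
    have "\<bar>ce L n x\<bar> \<le> sqrt (2 / L)" for x
      using False L mult_left_mono[OF abs_cos_le_one, of "sqrt (2 / L)"] by (simp add: ce_def abs_mult)
    hence "\<bar>ce L n L - ce L n 0\<bar> \<le> 2 * sqrt (2 / L)"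
      using abs_triangle_ineq4[of "ce L n L" "ce L n 0"] by (smt (verit))
    hence "\<bar>bet n\<bar> \<le> \<bar>hs * (2 * sqrt (2 / L))\<bar>" using hs L by (simp add: bet_def abs_mult)
    hence "(bet n)\<^sup>2 \<le> (hs * (2 * sqrt (2 / L)))\<^sup>2" by (simp only: abs_le_square_iff)
    hence "Kf n \<le> (hs * (2 * sqrt (2 / L)))\<^sup>2 / (2 * mu * lam L n)"
      unfolding Kf_def using mu lam_nonneg[of n] by (intro divide_right_mono) auto
    also have "\<dots> = c * inverse (real n ^ 2)"
      unfolding c_def lam_def by (simp add: power_mult_distrib power_divide field_simps)
    finally show ?thesis using Kf_nonneg[of n] by simp
  qed
qed

lemma L2_r: "L2 L r" by (rule L2_continuous[OF r])
lemma p_integrable: "integrable (lebesgue_on {0..L}) p" by (rule continuous_imp_integrable_real[OF p])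
lemma L2_Pt: "L2 L Pt"
  unfolding Pt_def[abs_def] by (intro L2_continuous continuous_intros continuous_on_primitive p_integrable)

lemma rc_summable: "summable (\<lambda>n. (rc n)\<^sup>2)"
  unfolding rc_def using Parseval[OF L L2_r] by (rule sums_summable)

lemma th_nonneg: "0 \<le> th n" using sig hs by (simp add: th_def)

lemma th_summable: "summable th"
  unfolding th_def[abs_def] by (rule summable_divide[OF sums_summable[OF Parseval[OF L L2_Pt]]])

lemma qc_sq_le: "(qc n)\<^sup>2 \<le> om n * th n"
proof -
  have "(qc n)\<^sup>2 = sig * hs * (lam L n)\<^sup>2 * th n"
    using sig hs by (simp add: qc_def th_def power_mult_distrib)
  also have "\<dots> \<le> om n * th n" by (rule mult_right_mono[OF om_ge th_nonneg])
  finally show ?thesis .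
qed

lemma ip_r_sums: "L2 L u \<Longrightarrow> (\<lambda>n. ip L u (ce L n) * rc n) sums ip L u r"
  unfolding rc_def by (rule Parseval_bilinear[OF L _ L2_r])

lemma ip_D1_p:
  assumes "L2 L s"
  shows "ip L (D1 0 s) p = ip L s Pt"
proof -
  note s = L2_integrable[OF assms]
  have "ip L (D1 0 s) p = integral {0..L} s * integral {0..L} p - (LINT x|lebesgue_on {0..L}. s x * integral {0..x} p)"
    unfolding ip_def D1_def using primitive_by_parts[OF s p_integrable] by simp
  also have "\<dots> = ip L s Pt"
    using integrable_mult_continuous[OF s continuous_on_primitive[OF p_integrable]] s
    by (simp add: ip_def Pt_def right_diff_distrib lebesgue_integral_eq_integral)
  finally show ?thesis .
qed

text \<open>The Neumann conditions remove every boundary term, so the second derivative acts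
  diagonally. The last fact expresses the p-part of the feedback by displacement coefficients
  alone.\<close>

lemma barS_facts:
  assumes "barS L f"
  shows "L2 L f" "L2 L ((wd L ^^ 2) f)"
    "ip L ((wd L ^^ 2) f) (ce L n) = - lam L n * ip L f (ce L n)"
    "(\<lambda>n. ip L f (ce L n) * qc n) sums ip L (wd L f) p"
proof -
  have H: "inHk L 2 f" and b: "bval L (wd L f) 0 = 0" "bval L (wd L f) L = 0" using assms by (auto simp: barS_def)
  show l2: "L2 L ((wd L ^^ 2) f)" using H by (auto simp: inHk_def)
  have "L2 L ((wd L ^^ 0) f)" using H unfolding inHk_def by blast
  thus "L2 L f" by simp
  have w: "weak_deriv L ((wd L ^^ 0) f) ((wd L ^^ Suc 0) f)" "weak_deriv L ((wd L ^^ 1) f) ((wd L ^^ Suc 1) f)"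
    by (rule inHk_weak_deriv[OF H]; simp)+
  have w1: "weak_deriv L f (wd L f)" and w2: "weak_deriv L (wd L f) ((wd L ^^ 2) f)"
    using w by (simp_all add: numeral_2_eq_2)
  have c: "ip L ((wd L ^^ 2) f) (ce L n) = - lam L n * ip L f (ce L n)" for n
    using coeff_weak_second_derivative(1)[OF L w1 w2, of n] b by simp
  thus "ip L ((wd L ^^ 2) f) (ce L n) = - lam L n * ip L f (ce L n)" .
  obtain F1 where F1: "AE x in lebesgue_on {0..L}. wd L f x = F1 x"
    "\<And>x. x \<in> {0..L} \<Longrightarrow> F1 x = integral {0..x} ((wd L ^^ 2) f)"
    using coeff_weak_second_derivative(2)[OF L w1 w2] b by auto
  have "AE x in lebesgue_on {0..L}. x \<in> {0..L}" by (rule AE_I2) (simp add: space_restrict_space)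
  with F1(1) have "AE x in lebesgue_on {0..L}. wd L f x = D1 0 ((wd L ^^ 2) f) x"
    by eventually_elim (simp add: D1_def F1(2))
  hence "ip L (wd L f) p = ip L (D1 0 ((wd L ^^ 2) f)) p"
    by (rule ip_cong_AE) (use w1 p_integrable in \<open>auto simp: weak_deriv_def\<close>)
  also have "\<dots> = ip L ((wd L ^^ 2) f) Pt" by (rule ip_D1_p[OF l2])
  finally have "(\<lambda>n. ip L ((wd L ^^ 2) f) (ce L n) * ip L Pt (ce L n)) sums ip L (wd L f) p"
    using Parseval_bilinear[OF L l2 L2_Pt] by simp
  thus "(\<lambda>n. ip L f (ce L n) * qc n) sums ip L (wd L f) p"
    unfolding c qc_def by (simp add: mult_ac)
qed

text \<open>Two applications of the second-derivative formula reduce phi_xxxx to lam^2 times the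
  coefficient of phi plus the boundary term, which becomes \<open>bet n * F\<close>. It serves
  twice: at each time it turns the equation into oscillators, and for the initial data it shows that
  the initial accelerations are coefficients of an L2 function.\<close>

lemma rhs_coeff:
  assumes f: "barS L f" "inHk L 4 f" and u: "barS L u"
    and b: "bval L ((wd L ^^ 3) f) 0 = - F / sig" "bval L ((wd L ^^ 3) f) L = - F / sig"
  defines "v \<equiv> \<lambda>x. grav * hs * (wd L ^^ 2) f x - sig * hs * (wd L ^^ 4) f x + mu * (wd L ^^ 2) u x - kappa * u x"
  shows "L2 L v" "ip L v (ce L n) = - gam n * ip L u (ce L n) - om n * ip L f (ce L n) + bet n * F"
proof -
  have l4: "L2 L ((wd L ^^ 4) f)" using f(2) by (auto simp: inHk_def)
  note l = barS_facts(1,2)[OF f(1)] barS_facts(1,2)[OF u] l4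
  show "L2 L v" unfolding v_def by (intro L2_add L2_diff L2_cmult l)
  have w: "weak_deriv L ((wd L ^^ 2) f) ((wd L ^^ Suc 2) f)" "weak_deriv L ((wd L ^^ 3) f) ((wd L ^^ Suc 3) f)"
    by (rule inHk_weak_deriv[OF f(2)]; simp)+
  have w': "weak_deriv L ((wd L ^^ 2) f) ((wd L ^^ 3) f)" "weak_deriv L ((wd L ^^ 3) f) ((wd L ^^ 4) f)"
    using w by (simp_all only: eval_nat_numeral BitM.simps One_nat_def)
  have c4: "ip L ((wd L ^^ 4) f) (ce L n) = - F / sig * (ce L n L - ce L n 0) + (lam L n)\<^sup>2 * ip L f (ce L n)"
    using coeff_weak_second_derivative(1)[OF L w', of n] b barS_facts(3)[OF f(1), of n]
    by (simp add: algebra_simps power2_eq_square)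
  have "ip L v (ce L n) = grav * hs * ip L ((wd L ^^ 2) f) (ce L n) - sig * hs * ip L ((wd L ^^ 4) f) (ce L n)
      + mu * ip L ((wd L ^^ 2) u) (ce L n) - kappa * ip L u (ce L n)"
    unfolding v_def by (simp add: ip_add ip_diff ip_cmult L2_add L2_diff L2_cmult l L2_ce[OF L])
  also have "\<dots> = - gam n * ip L u (ce L n) - om n * ip L f (ce L n) + bet n * F"
    unfolding c4 barS_facts(3)[OF f(1)] barS_facts(3)[OF u] gam_def om_def bet_def
    using sig by (simp add: field_simps)
  finally show "ip L v (ce L n) = - gam n * ip L u (ce L n) - om n * ip L f (ce L n) + bet n * F" .
qed

section \<open>From solutions to modes, and uniqueness\<close>

lemma l2norm_ce: "l2norm L (ce L n) = 1"
  unfolding l2norm_def using ce_orthonormal[OF L, of n n] by (simp add: ip_def power2_eq_square)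

text \<open>A coefficient is a pairing with a unit vector, hence bounded by the L2 norm. Any
  \<open>N\<close> above that norm is allowed, so the H2 derivative of the profile and the L2
  derivative of the velocity are covered alike.\<close>

lemma tderiv_coeff:
  assumes td: "tderiv_in N \<phi> u" and N: "\<And>f. l2norm L f \<le> N f"
    and l: "\<And>t. 0 \<le> t \<Longrightarrow> L2 L (\<phi> t)" "\<And>t. 0 \<le> t \<Longrightarrow> L2 L (u t)" and t: "0 \<le> t"
  shows "((\<lambda>t. ip L (\<phi> t) (ce L n)) has_real_derivative ip L (u t) (ce L n)) (at t within {0..})"
  unfolding has_field_derivative_iff
proof (rule Lim_transform2)
  show "((\<lambda>s. ip L (u t) (ce L n)) \<longlongrightarrow> ip L (u t) (ce L n)) (at t within {0..})" by simp
  have lim: "((\<lambda>s. N (\<lambda>x. (\<phi> s x - \<phi> t x) / (s - t) - u t x)) \<longlongrightarrow> 0) (at t within {0..})"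
    using td t by (simp add: tderiv_in_def)
  show "((\<lambda>s. ip L (u t) (ce L n) - (ip L (\<phi> s) (ce L n) - ip L (\<phi> t) (ce L n)) / (s - t)) \<longlongrightarrow> 0) (at t within {0..})"
  proof (rule Lim_null_comparison[OF _ lim])
    have "\<forall>\<^sub>F s in at t within {0..}. s \<in> {0..}" by (simp add: eventually_at_filter)
    thus "\<forall>\<^sub>F s in at t within {0..}. norm (ip L (u t) (ce L n) - (ip L (\<phi> s) (ce L n) - ip L (\<phi> t) (ce L n)) / (s - t))
        \<le> N (\<lambda>x. (\<phi> s x - \<phi> t x) / (s - t) - u t x)"
    proof eventually_elim
      case (elim s)
      let ?X = "\<lambda>x. (\<phi> s x - \<phi> t x) / (s - t)"
      have X: "L2 L ?X" using l t elim by (intro L2_divide L2_diff) auto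
      have "ip L ?X (ce L n) = (ip L (\<phi> s) (ce L n) - ip L (\<phi> t) (ce L n)) / (s - t)"
        using ip_cmult[of L "1 / (s - t)" "\<lambda>x. \<phi> s x - \<phi> t x" "ce L n"] l t elim L2_ce[OF L] by (simp add: ip_diff)
      hence "ip L (u t) (ce L n) - (ip L (\<phi> s) (ce L n) - ip L (\<phi> t) (ce L n)) / (s - t)
         = - ip L (\<lambda>x. ?X x - u t x) (ce L n)"
        using X l t L2_ce[OF L] by (simp add: ip_diff)
      also have "\<bar>\<dots>\<bar> \<le> l2norm L (\<lambda>x. ?X x - u t x) * 1"
        using ip_Cauchy_Schwarz[OF L2_diff[OF X l(2)[OF t]] L2_ce[OF L, of n]] by (simp add: l2norm_ce)
      finally show ?case using N[of "\<lambda>x. ?X x - u t x"] by simp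
    qed
  qed
qed

text \<open>Collects what the uniqueness argument for the modes consumes. The mean condition is kept
  separately because it alone determines the zero mode.\<close>

lemma sol_modes:
  assumes sol: "is_sol L hs grav mu sig kappa B C r p \<xi>0 w0 \<phi>0 u0 \<phi> \<xi> w"
  shows "\<exists>b F. (\<forall>t\<ge>0. L2 L (\<phi> t) \<and> ip L (\<phi> t) (ce L 0) = 0 \<and>
      (\<xi> has_real_derivative w t) (at t within {0..}) \<and> (w has_real_derivative - F t) (at t within {0..}) \<and>
      (\<forall>n. ((\<lambda>t. ip L (\<phi> t) (ce L n)) has_real_derivative b n t) (at t within {0..}) \<and>
           (b n has_real_derivative - gam n * b n t - om n * ip L (\<phi> t) (ce L n) + bet n * F t) (at t within {0..})) \<and>
      summable (\<lambda>n. b n t * rc n) \<and> summable (\<lambda>n. ip L (\<phi> t) (ce L n) * qc n) \<and>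
      F t = B * \<xi> t + C * w t + (\<Sum>n. b n t * rc n) + (\<Sum>n. ip L (\<phi> t) (ce L n) * qc n))
    \<and> continuous_on {0..} F \<and> \<xi> 0 = \<xi>0 \<and> w 0 = w0
    \<and> (\<forall>n. ip L (\<phi> 0) (ce L n) = ip L \<phi>0 (ce L n) \<and> b n 0 = ip L u0 (ce L n))"
proof -
  from sol obtain u v where
    S: "\<And>t. 0 \<le> t \<Longrightarrow> barS L (\<phi> t)" "\<And>t. 0 \<le> t \<Longrightarrow> inHk L 4 (\<phi> t)" "\<And>t. 0 \<le> t \<Longrightarrow> barS L (u t)" "\<And>t. 0 \<le> t \<Longrightarrow> L2 L (v t)"
    and td: "tderiv_in (hknorm L 2) \<phi> u" "tderiv_in (hknorm L 0) u v"
    and D: "\<And>t. 0 \<le> t \<Longrightarrow> (\<xi> has_real_derivative w t) (at t within {0..})"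
      "\<And>t. 0 \<le> t \<Longrightarrow> (w has_real_derivative - (B * \<xi> t + C * w t + ip L (u t) r + ip L (wd L (\<phi> t)) p)) (at t within {0..})"
    and cF: "continuous_on {0..} (\<lambda>t. B * \<xi> t + C * w t + ip L (u t) r + ip L (wd L (\<phi> t)) p)"
    and I: "\<xi> 0 = \<xi>0" "w 0 = w0" "AE x in lebesgue_on {0..L}. \<phi> 0 x = \<phi>0 x" "AE x in lebesgue_on {0..L}. u 0 x = u0 x"
    and E: "\<And>t. 0 \<le> t \<Longrightarrow> AE x in lebesgue_on {0..L}.
              v t x = (sqrt (grav * hs))\<^sup>2 * (wd L ^^ 2) (\<phi> t) x - sig * hs * (wd L ^^ 4) (\<phi> t) x
                      + mu * (wd L ^^ 2) (u t) x - kappa * u t x"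
    and b: "\<And>t. 0 \<le> t \<Longrightarrow> bval L ((wd L ^^ 3) (\<phi> t)) 0 = - (B * \<xi> t + C * w t + ip L (u t) r + ip L (wd L (\<phi> t)) p) / sig"
      "\<And>t. 0 \<le> t \<Longrightarrow> bval L ((wd L ^^ 3) (\<phi> t)) L = - (B * \<xi> t + C * w t + ip L (u t) r + ip L (wd L (\<phi> t)) p) / sig"
    and m: "\<And>t. 0 \<le> t \<Longrightarrow> mean0 L (\<phi> t)"
    unfolding is_sol_def Let_def by blast
  define F where "F t = B * \<xi> t + C * w t + ip L (u t) r + ip L (wd L (\<phi> t)) p" for t
  have l\<phi>: "L2 L (\<phi> t)" and lu: "L2 L (u t)" if "0 \<le> t" for t using barS_facts(1) S that by auto
  have da: "((\<lambda>t. ip L (\<phi> t) (ce L n)) has_real_derivative ip L (u t) (ce L n)) (at t within {0..})" if "0 \<le> t" for n t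
    by (rule tderiv_coeff[OF td(1) l2norm_le_hknorm l\<phi> lu that])
  have db: "((\<lambda>t. ip L (u t) (ce L n)) has_real_derivative
      - gam n * ip L (u t) (ce L n) - om n * ip L (\<phi> t) (ce L n) + bet n * F t) (at t within {0..})" if t: "0 \<le> t" for n t
  proof -
    have "sqrt (grav * hs) ^ 2 = grav * hs" using grav hs by simp
    with E[OF t] have ae: "AE x in lebesgue_on {0..L}. v t x = grav * hs * (wd L ^^ 2) (\<phi> t) x - sig * hs * (wd L ^^ 4) (\<phi> t) x
         + mu * (wd L ^^ 2) (u t) x - kappa * u t x" by simp
    have "ip L (v t) (ce L n) = ip L (\<lambda>x. grav * hs * (wd L ^^ 2) (\<phi> t) x - sig * hs * (wd L ^^ 4) (\<phi> t) x
         + mu * (wd L ^^ 2) (u t) x - kappa * u t x) (ce L n)"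
      by (rule ip_cong_AE[OF ae]) (use S(4)[OF t] L2_ce[OF L, of n] in \<open>auto simp: L2_def\<close>)
    also have "\<dots> = - gam n * ip L (u t) (ce L n) - om n * ip L (\<phi> t) (ce L n) + bet n * F t"
      by (rule rhs_coeff(2)[OF S(1)[OF t] S(2)[OF t] S(3)[OF t]]) (use b[OF t] in \<open>simp_all add: F_def\<close>)
    finally show ?thesis using tderiv_coeff[OF td(2) l2norm_le_hknorm lu S(4) t, of n] by simp
  qed
  have sr: "(\<lambda>n. ip L (u t) (ce L n) * rc n) sums ip L (u t) r" if "0 \<le> t" for t by (rule ip_r_sums[OF lu[OF that]])
  have sq: "(\<lambda>n. ip L (\<phi> t) (ce L n) * qc n) sums ip L (wd L (\<phi> t)) p" if "0 \<le> t" for t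
    by (rule barS_facts(4)[OF S(1)[OF that]])
  have Feq: "F t = B * \<xi> t + C * w t + (\<Sum>n. ip L (u t) (ce L n) * rc n) + (\<Sum>n. ip L (\<phi> t) (ce L n) * qc n)" if "0 \<le> t" for t
    using sr[OF that] sq[OF that] by (simp add: F_def sums_iff)
  have m0: "ip L (\<phi> t) (ce L 0) = 0" if "0 \<le> t" for t using m[OF that] mean0_iff[OF L] by simp
  have i1: "ip L (\<phi> 0) (ce L n) = ip L \<phi>0 (ce L n)" for n
    by (rule ip_cong_AE[OF I(3)]) (use l\<phi>[of 0] L2_ce[OF L, of n] in \<open>auto simp: L2_def\<close>)
  have i2: "ip L (u 0) (ce L n) = ip L u0 (ce L n)" for n
    by (rule ip_cong_AE[OF I(4)]) (use lu[of 0] L2_ce[OF L, of n] in \<open>auto simp: L2_def\<close>)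
  show ?thesis
    by (rule exI[of _ "\<lambda>n t. ip L (u t) (ce L n)"], rule exI[of _ F])
      (use l\<phi> m0 D(1) D(2)[folded F_def] da db sr sq Feq cF[folded F_def] I(1,2) i1 i2 in \<open>simp add: sums_iff\<close>)
qed

text \<open>The coefficient differences solve the homogeneous mode system with zero data. For
  positive n the stiffness \<open>om n\<close> is positive, so the displacement vanishes; for n = 0
  both profiles have mean zero. Completeness then gives equality almost everywhere.\<close>

lemma sol_unique:
  assumes 1: "is_sol L hs grav mu sig kappa B C r p \<xi>0 w0 \<phi>0 u0 \<phi>1 \<xi>1 w1"
    and 2: "is_sol L hs grav mu sig kappa B C r p \<xi>0 w0 \<phi>0 u0 \<phi>2 \<xi>2 w2" and t: "0 \<le> t"
  shows "\<xi>1 t = \<xi>2 t" "w1 t = w2 t" "AE x in lebesgue_on {0..L}. \<phi>1 t x = \<phi>2 t x"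
proof -
  define a1 where "a1 n t = ip L (\<phi>1 t) (ce L n)" for n t
  define a2 where "a2 n t = ip L (\<phi>2 t) (ce L n)" for n t
  obtain b1 F1 where M1: "\<And>t. 0 \<le> t \<Longrightarrow> L2 L (\<phi>1 t)" "\<And>t. 0 \<le> t \<Longrightarrow> a1 0 t = 0"
      "\<And>t. 0 \<le> t \<Longrightarrow> (\<xi>1 has_real_derivative w1 t) (at t within {0..})"
      "\<And>t. 0 \<le> t \<Longrightarrow> (w1 has_real_derivative - F1 t) (at t within {0..})"
      "\<And>n t. 0 \<le> t \<Longrightarrow> (a1 n has_real_derivative b1 n t) (at t within {0..})"
      "\<And>n t. 0 \<le> t \<Longrightarrow> (b1 n has_real_derivative - gam n * b1 n t - om n * a1 n t + bet n * F1 t) (at t within {0..})"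
      "\<And>t. 0 \<le> t \<Longrightarrow> summable (\<lambda>n. b1 n t * rc n)" "\<And>t. 0 \<le> t \<Longrightarrow> summable (\<lambda>n. a1 n t * qc n)"
      "\<And>t. 0 \<le> t \<Longrightarrow> F1 t = B * \<xi>1 t + C * w1 t + (\<Sum>n. b1 n t * rc n) + (\<Sum>n. a1 n t * qc n)"
      "continuous_on {0..} F1" "\<xi>1 0 = \<xi>0" "w1 0 = w0"
      "\<And>n. a1 n 0 = ip L \<phi>0 (ce L n)" "\<And>n. b1 n 0 = ip L u0 (ce L n)"
    using sol_modes[OF 1] unfolding a1_def[abs_def] by blast
  obtain b2 F2 where M2: "\<And>t. 0 \<le> t \<Longrightarrow> L2 L (\<phi>2 t)" "\<And>t. 0 \<le> t \<Longrightarrow> a2 0 t = 0"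
      "\<And>t. 0 \<le> t \<Longrightarrow> (\<xi>2 has_real_derivative w2 t) (at t within {0..})"
      "\<And>t. 0 \<le> t \<Longrightarrow> (w2 has_real_derivative - F2 t) (at t within {0..})"
      "\<And>n t. 0 \<le> t \<Longrightarrow> (a2 n has_real_derivative b2 n t) (at t within {0..})"
      "\<And>n t. 0 \<le> t \<Longrightarrow> (b2 n has_real_derivative - gam n * b2 n t - om n * a2 n t + bet n * F2 t) (at t within {0..})"
      "\<And>t. 0 \<le> t \<Longrightarrow> summable (\<lambda>n. b2 n t * rc n)" "\<And>t. 0 \<le> t \<Longrightarrow> summable (\<lambda>n. a2 n t * qc n)"
      "\<And>t. 0 \<le> t \<Longrightarrow> F2 t = B * \<xi>2 t + C * w2 t + (\<Sum>n. b2 n t * rc n) + (\<Sum>n. a2 n t * qc n)"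
      "continuous_on {0..} F2" "\<xi>2 0 = \<xi>0" "w2 0 = w0"
      "\<And>n. a2 n 0 = ip L \<phi>0 (ce L n)" "\<And>n. b2 n 0 = ip L u0 (ce L n)"
    using sol_modes[OF 2] unfolding a2_def[abs_def] by blast
  let ?a = "\<lambda>n t. a1 n t - a2 n t" and ?b = "\<lambda>n t. b1 n t - b2 n t" and ?F = "\<lambda>t. F1 t - F2 t"
  let ?\<xi> = "\<lambda>t. \<xi>1 t - \<xi>2 t" and ?w = "\<lambda>t. w1 t - w2 t"
  have da: "(?a n has_real_derivative ?b n t) (at t within {0..})" if "0 \<le> t" for n t
    by (intro derivative_intros M1 M2 that)
  have db: "(?b n has_real_derivative - gam n * ?b n t - om n * ?a n t + bet n * ?F t) (at t within {0..})" if "0 \<le> t" for n t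
    by (rule DERIV_cong[OF DERIV_diff[OF M1(6)[OF that] M2(6)[OF that]]]) (simp add: algebra_simps)
  have d\<xi>: "(?\<xi> has_real_derivative ?w t) (at t within {0..})" if "0 \<le> t" for t
    by (intro derivative_intros M1 M2 that)
  have dw: "(?w has_real_derivative - ?F t) (at t within {0..})" if "0 \<le> t" for t
    by (rule DERIV_cong[OF DERIV_diff[OF M1(4)[OF that] M2(4)[OF that]]]) simp
  have cF: "continuous_on {0..} ?F" by (intro continuous_intros M1 M2)
  have Feq: "?F t = B * ?\<xi> t + C * ?w t + (\<Sum>n. ?b n t * rc n) + (\<Sum>n. ?a n t * qc n)" if t: "0 \<le> t" for t
  proof -
    have "(\<Sum>n. ?b n t * rc n) = (\<Sum>n. b1 n t * rc n) - (\<Sum>n. b2 n t * rc n)"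
      unfolding left_diff_distrib by (rule suminf_diff[symmetric]) (intro M1 M2 t)+
    moreover have "(\<Sum>n. ?a n t * qc n) = (\<Sum>n. a1 n t * qc n) - (\<Sum>n. a2 n t * qc n)"
      unfolding left_diff_distrib by (rule suminf_diff[symmetric]) (intro M1 M2 t)+
    ultimately show ?thesis using M1(9)[OF t] M2(9)[OF t] by (simp add: algebra_simps)
  qed
  have init: "?a n 0 = 0" "?b n 0 = 0" "?\<xi> 0 = 0" "?w 0 = 0" for n by (simp_all add: M1 M2)
  note U = modes_unique[of gam om Kf bet rc th qc ?a ?b ?F ?\<xi> ?w, OF gam_nonneg om_nonneg Kf_nonneg Kf_summable bet_sq_le
      rc_summable th_nonneg th_summable qc_sq_le da db d\<xi> dw init cF Feq t]
  show "\<xi>1 t = \<xi>2 t" "w1 t = w2 t" using U(2,3) by simp_all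
  show "AE x in lebesgue_on {0..L}. \<phi>1 t x = \<phi>2 t x"
  proof (rule ce_coeff_unique[OF L L2_integrable[OF M1(1)[OF t]] L2_integrable[OF M2(1)[OF t]]])
    fix n
    show "ip L (\<phi>1 t) (ce L n) = ip L (\<phi>2 t) (ce L n)"
    proof (cases "n = 0")
      case True
      thus ?thesis using M1(2)[OF t] M2(2)[OF t] by (simp add: a1_def a2_def)
    next
      case False
      have "0 < sig * hs * (lam L n)\<^sup>2" using sig hs lam_pos[OF False] by simp
      hence "om n \<noteq> 0" using om_ge[of n] by simp
      thus ?thesis using U(4)[of n] by (simp add: a1_def a2_def)
    qed
  qed
qed

end

section \<open>From coefficients back to functions of time\<close>

lemma D2_cong: "L > 0 \<Longrightarrow> (\<And>x. x \<in> {0..L} \<Longrightarrow> s x = s' x) \<Longrightarrow> x \<in> {0..L} \<Longrightarrow> D2 L A s x = D2 L A s' x"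
proof -
  assume L: "L > 0" and eq: "\<And>x. x \<in> {0..L} \<Longrightarrow> s x = s' x" and x: "x \<in> {0..L}"
  have 1: "D1 A s y = D1 A s' y" if "y \<in> {0..L}" for y
    unfolding D1_def using that by (intro arg_cong2[of _ _ _ _ "(+)"] refl integral_cong eq) auto
  have 2: "integral {0..y} (D1 A s) = integral {0..y} (D1 A s')" if "y \<in> {0..L}" for y
    by (intro integral_cong 1) (use that in auto)
  have "integral {0..L} (\<lambda>z. integral {0..z} (D1 A s)) = integral {0..L} (\<lambda>z. integral {0..z} (D1 A s'))"
    by (intro integral_cong 2)
  thus ?thesis unfolding D2_def 2[OF x] by simp
qed

lemma D2_diff:
  assumes "integrable (lebesgue_on {0..L}) s" "integrable (lebesgue_on {0..L}) s'" "x \<in> {0..L}"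
  shows "D2 L (A - A') (\<lambda>x. s x - s' x) x = D2 L A s x - D2 L A' s' x"
  using D2_lincomb[OF assms, of 1 A "-1" A'] by simp

text \<open>The relation at n = 0 reads that \<open>s\<close> has integral 0, so the slope of the
  double primitive is \<open>A\<close> at both ends. For positive n one divides by
  \<open>lam L n\<close>; at n = 0 the mean-zero normalisation of \<open>D2\<close> matches
  \<open>x 0 = 0\<close>.\<close>

lemma coeff_D2_eq:
  assumes L: "L > 0" and s: "L2 L s"
    and c: "\<And>n. ip L s (ce L n) = A * (ce L n L - ce L n 0) - lam L n * x n" and x0: "x 0 = 0"
  shows "integral {0..L} s = 0" "ip L (D2 L A s) (ce L n) = x n"
proof -
  note i = L2_integrable[OF s]
  have "ip L s (ce L 0) = 0" using c[of 0] by (simp add: ce_def lam_def)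
  thus i0: "integral {0..L} s = 0"
    using L lebesgue_integral_eq_integral[OF i] by (simp add: coeff_0)
  show "ip L (D2 L A s) (ce L n) = x n"
  proof (cases "n = 0")
    case True
    thus ?thesis using mean0_D2[OF L i] mean0_iff[OF L] x0 by simp
  next
    case False
    have "lam L n * ip L (D2 L A s) (ce L n) = lam L n * x n"
      using coeff_D2[OF L i, of n A] c[of n] i0 by (simp add: D1_def algebra_simps)
    moreover have "lam L n \<noteq> 0" using False L by (simp add: lam_def)
    ultimately show ?thesis by simp
  qed
qed

lemma at_within_atLeast0_neq_bot:
  fixes t :: real
  assumes "0 \<le> t"
  shows "at t within {0..} \<noteq> bot"
proof
  assume "at t within {0..} = bot"
  moreover have "at_right t \<le> at t within {0..}" by (rule at_le) (use assms in auto)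
  ultimately have "at_right t = bot" by (simp add: bot_unique)
  thus False using trivial_limit_at_right_real[of t] by (simp add: trivial_limit_def)
qed

lemma l2norm_continuous_of_coeffs:
  fixes X :: "real \<Rightarrow> real \<Rightarrow> real" and x :: "nat \<Rightarrow> real \<Rightarrow> real"
  assumes L: "L > 0" and X: "\<And>t. 0 \<le> t \<Longrightarrow> L2 L (X t)"
    and x: "\<And>n t. 0 \<le> t \<Longrightarrow> ip L (X t) (ce L n) = x n t"
    and cont: "\<And>n. continuous_on {0..} (x n)"
    and dom: "\<And>T. 0 \<le> T \<Longrightarrow> \<exists>M. summable M \<and> (\<forall>n. \<forall>t\<in>{0..T}. (x n t)\<^sup>2 \<le> M n)" and t: "0 \<le> t"
  shows "((\<lambda>s. l2norm L (\<lambda>y. X s y - X t y)) \<longlongrightarrow> 0) (at t within {0..})"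
proof -
  obtain M where M: "summable M" "\<And>n s. s \<in> {0..t+1} \<Longrightarrow> (x n s)\<^sup>2 \<le> M n" using dom[of "t+1"] t by auto
  have ev: "\<forall>\<^sub>F s in at t within {0..}. s \<in> {0..t+1}"
    using t by (auto simp: eventually_at dist_real_def intro!: exI[of _ 1])
  show ?thesis
  proof (rule l2norm_tendsto_0[OF L, where M="\<lambda>n. 4 * M n"])
    show "\<forall>\<^sub>F s in at t within {0..}. L2 L (\<lambda>y. X s y - X t y)"
      using ev by eventually_elim (use X t in \<open>auto intro!: L2_diff\<close>)
    show "((\<lambda>s. ip L (\<lambda>y. X s y - X t y) (ce L n)) \<longlongrightarrow> 0) (at t within {0..})" for n
    proof (rule Lim_transform_eventually)
      have "(x n \<longlongrightarrow> x n t) (at t within {0..})" using cont[of n] t by (auto simp: continuous_on_def)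
      thus "((\<lambda>s. x n s - x n t) \<longlongrightarrow> 0) (at t within {0..})" by (simp add: LIM_zero_iff)
      show "\<forall>\<^sub>F s in at t within {0..}. x n s - x n t = ip L (\<lambda>y. X s y - X t y) (ce L n)"
        using ev by eventually_elim (use X t x in \<open>simp add: ip_diff L2_ce[OF L]\<close>)
    qed
    show "\<forall>\<^sub>F s in at t within {0..}. \<forall>n. (ip L (\<lambda>y. X s y - X t y) (ce L n))\<^sup>2 \<le> 4 * M n"
      using ev
    proof eventually_elim
      case (elim s)
      show ?case
      proof
        fix n
        have "(ip L (\<lambda>y. X s y - X t y) (ce L n))\<^sup>2 = (x n s + (- x n t))\<^sup>2"
          using elim X t x by (simp add: ip_diff L2_ce[OF L])
        also have "\<dots> \<le> 2 * (x n s)\<^sup>2 + 2 * (- x n t)\<^sup>2" by (rule sq_sum_le)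
        also have "\<dots> \<le> 4 * M n" using M(2)[OF elim, of n] M(2)[of t n] t by simp
        finally show "(ip L (\<lambda>y. X s y - X t y) (ce L n))\<^sup>2 \<le> 4 * M n" .
      qed
    qed
    show "summable (\<lambda>n. 4 * M n)" by (intro summable_mult M)
    show "at t within {0..} \<noteq> bot" by (rule at_within_atLeast0_neq_bot[OF t])
  qed
qed

text \<open>Termwise derivatives give pointwise convergence of the coefficients of the difference
  quotients; the mean value inequality turns the bound on \<open>x'\<close> into a bound on these
  quotients, uniform near t. The factor 4 comes from squaring a difference.\<close>

lemma l2norm_derivative_of_coeffs:
  fixes X Y :: "real \<Rightarrow> real \<Rightarrow> real" and x x' :: "nat \<Rightarrow> real \<Rightarrow> real"
  assumes L: "L > 0" and X: "\<And>t. 0 \<le> t \<Longrightarrow> L2 L (X t)" and Y: "\<And>t. 0 \<le> t \<Longrightarrow> L2 L (Y t)"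
    and x: "\<And>n t. 0 \<le> t \<Longrightarrow> ip L (X t) (ce L n) = x n t"
    and y: "\<And>n t. 0 \<le> t \<Longrightarrow> ip L (Y t) (ce L n) = x' n t"
    and d: "\<And>n t. 0 \<le> t \<Longrightarrow> (x n has_real_derivative x' n t) (at t within {0..})"
    and dom: "\<And>T. 0 \<le> T \<Longrightarrow> \<exists>M. summable M \<and> (\<forall>n. \<forall>t\<in>{0..T}. (x' n t)\<^sup>2 \<le> M n)" and t: "0 \<le> t"
  shows "((\<lambda>s. l2norm L (\<lambda>z. (X s z - X t z) / (s - t) - Y t z)) \<longlongrightarrow> 0) (at t within {0..})"
proof -
  obtain M where M: "summable M" "\<And>n s. s \<in> {0..t+1} \<Longrightarrow> (x' n s)\<^sup>2 \<le> M n" using dom[of "t+1"] t by auto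
  have ev: "\<forall>\<^sub>F s in at t within {0..}. s \<in> {0..t+1} \<and> s \<noteq> t"
    using t by (auto simp: eventually_at dist_real_def intro!: exI[of _ 1])
  have LX: "L2 L (\<lambda>z. (X s z - X t z) / (s - t) - Y t z)" if "s \<in> {0..t+1}" for s
    using X Y t that by (intro L2_diff L2_divide) auto
  have ipX: "ip L (\<lambda>z. (X s z - X t z) / (s - t) - Y t z) (ce L n) = (x n s - x n t) / (s - t) - x' n t"
    if "s \<in> {0..t+1}" for s n
  proof -
    have "ip L (\<lambda>z. (X s z - X t z) / (s - t)) (ce L n) = (x n s - x n t) / (s - t)"
      using ip_cmult[of L "1 / (s - t)" "\<lambda>z. X s z - X t z" "ce L n"] X t that x by (simp add: ip_diff L2_ce[OF L])
    moreover have "L2 L (\<lambda>z. (X s z - X t z) / (s - t))" using X t that by (intro L2_divide L2_diff) auto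
    ultimately show ?thesis using Y t y by (simp add: ip_diff L2_ce[OF L])
  qed
  show ?thesis
  proof (rule l2norm_tendsto_0[OF L, where M="\<lambda>n. 4 * M n"])
    show "\<forall>\<^sub>F s in at t within {0..}. L2 L (\<lambda>z. (X s z - X t z) / (s - t) - Y t z)"
      using ev by eventually_elim (auto intro!: LX)
    show "((\<lambda>s. ip L (\<lambda>z. (X s z - X t z) / (s - t) - Y t z) (ce L n)) \<longlongrightarrow> 0) (at t within {0..})" for n
    proof (rule Lim_transform_eventually)
      have "((\<lambda>s. (x n s - x n t) / (s - t)) \<longlongrightarrow> x' n t) (at t within {0..})"
        using d[OF t, of n] by (simp add: has_field_derivative_iff)
      thus "((\<lambda>s. (x n s - x n t) / (s - t) - x' n t) \<longlongrightarrow> 0) (at t within {0..})" by (simp add: LIM_zero_iff)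
      show "\<forall>\<^sub>F s in at t within {0..}. (x n s - x n t) / (s - t) - x' n t = ip L (\<lambda>z. (X s z - X t z) / (s - t) - Y t z) (ce L n)"
        using ev by eventually_elim (simp add: ipX)
    qed
    show "\<forall>\<^sub>F s in at t within {0..}. \<forall>n. (ip L (\<lambda>z. (X s z - X t z) / (s - t) - Y t z) (ce L n))\<^sup>2 \<le> 4 * M n"
      using ev
    proof eventually_elim
      case (elim s)
      show ?case
      proof
        fix n
        have M0: "0 \<le> M n" using order_trans[OF zero_le_power2 M(2)[of t n]] t by simp
        \<comment> \<open>Mean value inequality on the convex interval [0, t+1], where
          \<open>sqrt (M n)\<close> bounds the derivative.\<close>
        have "norm (x n s - x n t) \<le> sqrt (M n) * norm (s - t)"
        proof (rule field_differentiable_bound[of "{0..t+1}" "x n" "x' n"])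
          show "(x n has_real_derivative x' n z) (at z within {0..t+1})" if "z \<in> {0..t+1}" for z
            by (rule has_field_derivative_subset[OF d]) (use that in auto)
          show "norm (x' n z) \<le> sqrt (M n)" if "z \<in> {0..t+1}" for z
            using M(2)[OF that, of n] by (simp add: real_le_rsqrt)
        qed (use elim t in auto)
        hence "(x n s - x n t)\<^sup>2 \<le> (sqrt (M n) * norm (s - t))\<^sup>2"
          by (subst abs_le_square_iff[symmetric]) (use M0 in \<open>simp add: abs_mult\<close>)
        hence "((x n s - x n t) / (s - t))\<^sup>2 \<le> M n"
          using elim M0 by (simp add: power_divide power_mult_distrib divide_le_eq)
        moreover have "((x n s - x n t) / (s - t) + (- x' n t))\<^sup>2 \<le> 2 * ((x n s - x n t) / (s - t))\<^sup>2 + 2 * (- x' n t)\<^sup>2"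
          by (rule sq_sum_le)
        moreover have "(x' n t)\<^sup>2 \<le> M n" using M(2)[of t n] t by simp
        ultimately show "(ip L (\<lambda>z. (X s z - X t z) / (s - t) - Y t z) (ce L n))\<^sup>2 \<le> 4 * M n"
          using elim by (simp add: ipX)
      qed
    qed
    show "summable (\<lambda>n. 4 * M n)" by (intro summable_mult M)
    show "at t within {0..} \<noteq> bot" by (rule at_within_atLeast0_neq_bot[OF t])
  qed
qed

section \<open>Construction of a solution\<close>

context sloshing
begin

lemma om_summable:
  assumes "summable (\<lambda>n. (c n)\<^sup>2)" "summable (\<lambda>n. (lam L n * c n)\<^sup>2)"
  shows "summable (\<lambda>n. om n * (c n)\<^sup>2)"
proof (rule summable_comparison_test')
  show "summable (\<lambda>n. grav * hs * ((c n)\<^sup>2 + (lam L n * c n)\<^sup>2) + sig * hs * (lam L n * c n)\<^sup>2)"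
    by (intro summable_add summable_mult assms)
  show "norm (om n * (c n)\<^sup>2) \<le> grav * hs * ((c n)\<^sup>2 + (lam L n * c n)\<^sup>2) + sig * hs * (lam L n * c n)\<^sup>2" if "n \<ge> 0" for n
  proof -
    \<comment> \<open>Interpolation: the linear part of \<open>om\<close> is dominated by its
      constant and quadratic companions.\<close>
    have "2 * lam L n \<le> 1 + (lam L n)\<^sup>2" using sum_squares_bound[of "lam L n" 1] by simp
    hence "lam L n \<le> 1 + (lam L n)\<^sup>2" using lam_nonneg[of n] by linarith
    hence "lam L n * (c n)\<^sup>2 \<le> (c n)\<^sup>2 + (lam L n * c n)\<^sup>2"
      using mult_right_mono[of "lam L n" "1 + (lam L n)\<^sup>2" "(c n)\<^sup>2"] by (simp add: algebra_simps power_mult_distrib)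
    hence "grav * hs * (lam L n * (c n)\<^sup>2) \<le> grav * hs * ((c n)\<^sup>2 + (lam L n * c n)\<^sup>2)"
      using grav hs by (intro mult_left_mono) auto
    moreover have "om n * (c n)\<^sup>2 = grav * hs * (lam L n * (c n)\<^sup>2) + sig * hs * (lam L n * c n)\<^sup>2"
      by (simp add: om_def power_mult_distrib algebra_simps)
    moreover have nn: "0 \<le> om n * (c n)\<^sup>2" using om_nonneg[of n] by simp
    ultimately show ?thesis unfolding real_norm_def abs_of_nonneg[OF nn] by linarith
  qed
qed

lemma Fourier_function_exists:
  assumes "\<And>t. 0 \<le> t \<Longrightarrow> summable (\<lambda>n. (c n t)\<^sup>2)"
  shows "\<exists>X. \<forall>t\<ge>0. L2 L (X t) \<and> (\<forall>n. ip L (X t) (ce L n) = c n t)"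
proof -
  have "\<forall>t. \<exists>X. 0 \<le> t \<longrightarrow> L2 L X \<and> (\<forall>n. ip L X (ce L n) = c n t)"
  proof
    fix t
    show "\<exists>X. 0 \<le> t \<longrightarrow> L2 L X \<and> (\<forall>n. ip L X (ce L n) = c n t)"
    proof (cases "0 \<le> t")
      case True
      from Riesz_Fischer_cos[OF L assms[OF True]] show ?thesis by blast
    qed simp
  qed
  thus ?thesis by (rule choice[THEN exE]) blast
qed

text \<open>Stiffness and forcing both vanish at n = 0, so the mean evolves by its own damping only
  and stays 0. This preserves the mean-zero conditions.\<close>

lemma zero_mode:
  assumes a: "\<And>t. 0 \<le> t \<Longrightarrow> (a has_real_derivative b t) (at t within {0..})"
    and b: "\<And>t. 0 \<le> t \<Longrightarrow> (b has_real_derivative d t) (at t within {0..})"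
    and d: "\<And>t. 0 \<le> t \<Longrightarrow> d t = - gam 0 * b t - om 0 * a t + bet 0 * f t"
    and i: "a 0 = 0" "b 0 = 0" and t: "0 \<le> t"
  shows "a t = 0" "b t = 0" "d t = 0"
proof -
  have o0: "om 0 = 0" by (simp add: om_def lam_0)
  have b0: "b t = 0" if t: "0 \<le> t" for t
  proof -
    \<comment> \<open>The energy estimate with stiffness, forcing and gain all 0 bounds the squared
      velocity by its initial value.\<close>
    have "(b t)\<^sup>2 + 0 * (a t)\<^sup>2 \<le> (b 0)\<^sup>2 + 0 * (a 0)\<^sup>2 + 0 * integral {0..t} (\<lambda>s. 0\<^sup>2)"
    proof (rule damped_energy_estimate[where \<gamma>="gam 0" and \<beta>=0, OF a _ _ gam_nonneg _ _ t])
      show "(b has_real_derivative - gam 0 * b t - 0 * a t + 0 * 0) (at t within {0..})" if "0 \<le> t" for t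
        using b[OF that] d[OF that] by (simp add: o0 bet_0)
    qed auto
    thus ?thesis using i by simp
  qed
  show "b t = 0" by (rule b0[OF t])
  show "d t = 0" using d[OF t] b0[OF t] by (simp add: o0 bet_0)
  have nb: "b s \<le> 0" "- b s \<le> 0" if "0 \<le> s" for s using b0[OF that] by simp_all
  have "a t \<le> a 0" by (rule nonincreasing_atLeast0[OF a nb(1) t])
  moreover have "- a t \<le> - a 0"
    by (rule nonincreasing_atLeast0[where f="\<lambda>t. - a t" and f'="\<lambda>t. - b t", OF DERIV_minus[OF a] nb(2) t])
  ultimately show "a t = 0" using i by simp
qed

lemma sol_exists:
  assumes \<phi>0: "barS L \<phi>0" "inHk L 4 \<phi>0" "mean0 L \<phi>0" and u0: "barS L u0" "mean0 L u0"
    and bv: "bval L ((wd L ^^ 3) \<phi>0) 0 = - (B * \<xi>0 + C * w0 + ip L u0 r + ip L (wd L \<phi>0) p) / sig"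
      "bval L ((wd L ^^ 3) \<phi>0) L = - (B * \<xi>0 + C * w0 + ip L u0 r + ip L (wd L \<phi>0) p) / sig"
  shows "\<exists>\<phi> \<xi> w. is_sol L hs grav mu sig kappa B C r p \<xi>0 w0 \<phi>0 u0 \<phi> \<xi> w"
proof -
  define a0 where "a0 n = ip L \<phi>0 (ce L n)" for n
  define b0 where "b0 n = ip L u0 (ce L n)" for n
  define f0 where "f0 = B * \<xi>0 + C * w0 + ip L u0 r + ip L (wd L \<phi>0) p"
  note l\<phi> = barS_facts(1,2)[OF \<phi>0(1)] and lu = barS_facts(1,2)[OF u0(1)]
  have f0: "f0 = B * \<xi>0 + C * w0 + (\<Sum>n. b0 n * rc n) + (\<Sum>n. a0 n * qc n)"
    unfolding f0_def a0_def b0_def using ip_r_sums[OF lu(1)] barS_facts(4)[OF \<phi>0(1)] by (simp add: sums_iff)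
  note V = rhs_coeff[OF \<phi>0(1,2) u0(1) bv, folded f0_def a0_def b0_def]
  \<comment> \<open>Here the compatibility conditions \<open>bv\<close> enter: the boundary terms of
    the fourth derivative of \<open>\<phi>0\<close> are exactly \<open>bet n * f0\<close>.\<close>
  have d0: "summable (\<lambda>n. (- gam n * b0 n - om n * a0 n + bet n * f0)\<^sup>2)"
    using sums_summable[OF Parseval[OF L V(1)]] unfolding V(2) .
  have sb: "summable (\<lambda>n. (b0 n)\<^sup>2)" unfolding b0_def by (rule sums_summable[OF Parseval[OF L lu(1)]])
  have sa: "summable (\<lambda>n. (a0 n)\<^sup>2)" unfolding a0_def by (rule sums_summable[OF Parseval[OF L l\<phi>(1)]])
  have "summable (\<lambda>n. (lam L n * b0 n)\<^sup>2)"
    using sums_summable[OF Parseval[OF L lu(2)]] unfolding barS_facts(3)[OF u0(1)] b0_def by simp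
  hence ob: "summable (\<lambda>n. om n * (b0 n)\<^sup>2)" by (rule om_summable[OF sb])
  have "summable (\<lambda>n. (lam L n * a0 n)\<^sup>2)"
    using sums_summable[OF Parseval[OF L l\<phi>(2)]] unfolding barS_facts(3)[OF \<phi>0(1)] a0_def by simp
  hence oa: "summable (\<lambda>n. om n * (a0 n)\<^sup>2)" by (rule om_summable[OF sa])
  obtain a b d :: "nat \<Rightarrow> real \<Rightarrow> real" and \<xi> w f :: "real \<Rightarrow> real" where
    H1: "\<forall>t\<ge>0. \<forall>n. (a n has_real_derivative b n t) (at t within {0..})
        \<and> (b n has_real_derivative d n t) (at t within {0..})
        \<and> continuous_on {0..} (d n)
        \<and> d n t = - gam n * b n t - om n * a n t + bet n * f t"
    and H2: "\<forall>n. a n 0 = a0 n \<and> b n 0 = b0 n" and init2: "\<xi> 0 = \<xi>0" "w 0 = w0"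
    and cf: "continuous_on {0..} f"
    and H3: "\<forall>t\<ge>0. (\<xi> has_real_derivative w t) (at t within {0..}) \<and> (w has_real_derivative - f t) (at t within {0..})
        \<and> f t = B * \<xi> t + C * w t + (\<Sum>n. b n t * rc n) + (\<Sum>n. a n t * qc n)"
    and dom': "\<forall>T\<ge>0. \<exists>M. summable M \<and> (\<forall>n. \<forall>t\<in>{0..T}. (d n t)\<^sup>2 \<le> M n \<and> om n * (b n t)\<^sup>2 \<le> M n
        \<and> om n * (a n t)\<^sup>2 \<le> M n \<and> (b n t)\<^sup>2 \<le> M n)"
    using modes_exist[of gam om Kf bet rc th qc f0 B \<xi>0 C w0 b0 a0, OF gam_nonneg om_nonneg Kf_nonneg Kf_summable bet_sq_le
      rc_summable th_nonneg th_summable qc_sq_le f0 d0 sb ob oa]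
    by (elim exE conjE) (rule that)
  have da: "(a n has_real_derivative b n t) (at t within {0..})"
    and db: "(b n has_real_derivative d n t) (at t within {0..})"
    and deq: "d n t = - gam n * b n t - om n * a n t + bet n * f t" if "0 \<le> t" for n t
    using H1 that by blast+
  have cd: "continuous_on {0..} (d n)" for n using H1 by blast
  have init: "a n 0 = a0 n" "b n 0 = b0 n" "\<xi> 0 = \<xi>0" "w 0 = w0" for n using H2 init2 by auto
  have d\<xi>: "(\<xi> has_real_derivative w t) (at t within {0..})"
    and dw: "(w has_real_derivative - f t) (at t within {0..})"
    and feq: "f t = B * \<xi> t + C * w t + (\<Sum>n. b n t * rc n) + (\<Sum>n. a n t * qc n)" if "0 \<le> t" for t
    using H3 that by blast+
  note dom = dom'[rule_format]
  have ca: "continuous_on {0..} (a n)" and cb: "continuous_on {0..} (b n)" for n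
    by (rule DERIV_continuous_on, rule da db, simp)+
  have z: "a 0 t = 0" "b 0 t = 0" "d 0 t = 0" if "0 \<le> t" for t
  proof -
    have "a 0 0 = 0" "b 0 0 = 0" using \<phi>0(3) u0(2) mean0_iff[OF L] by (simp_all add: init a0_def b0_def)
    from zero_mode[OF da db deq this that] show "a 0 t = 0" "b 0 t = 0" "d 0 t = 0" by auto
  qed
  have dom4: "\<exists>M. summable M \<and> (\<forall>n. \<forall>t\<in>{0..T}. (d n t)\<^sup>2 \<le> M n \<and> (- lam L n * b n t)\<^sup>2 \<le> M n
        \<and> (- lam L n * a n t)\<^sup>2 \<le> M n \<and> (b n t)\<^sup>2 \<le> M n)" if T: "0 \<le> T" for T
  proof -
    obtain M where M: "summable M" "\<And>n t. t \<in> {0..T} \<Longrightarrow> (d n t)\<^sup>2 \<le> M n \<and> om n * (b n t)\<^sup>2 \<le> M n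
        \<and> om n * (a n t)\<^sup>2 \<le> M n \<and> (b n t)\<^sup>2 \<le> M n" using dom[OF T] by blast
    have M0: "0 \<le> M n" for n using order_trans[OF zero_le_power2 conjunct1[OF M(2)[of 0 n]]] T by simp
    \<comment> \<open>The 1 keeps the bounds already available; the quotient converts the
      \<open>om\<close>-weighted bounds into bounds on lam^2 times the square.\<close>
    define k where "k = 1 + 1 / (sig * hs)"
    have k: "0 < k" "1 \<le> k" "1 / (sig * hs) \<le> k" using sig hs by (auto simp: k_def add_pos_pos)
    have le: "x \<le> k * M n" if "x \<le> M n" for x n
      using that mult_right_mono[OF k(2) M0[of n]] by simp
    have lm: "(- lam L n * x)\<^sup>2 \<le> k * M n" if "om n * x\<^sup>2 \<le> M n" for x n
    proof -
      have "sig * hs * (lam L n)\<^sup>2 * x\<^sup>2 \<le> om n * x\<^sup>2" by (rule mult_right_mono[OF om_ge]) simp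
      hence "sig * hs * (- lam L n * x)\<^sup>2 \<le> M n" using that by (simp add: power_mult_distrib)
      hence "(- lam L n * x)\<^sup>2 \<le> 1 / (sig * hs) * M n" using sig hs by (simp add: field_simps)
      also have "\<dots> \<le> k * M n" by (rule mult_right_mono[OF k(3) M0])
      finally show ?thesis .
    qed
    show ?thesis
      by (rule exI[of _ "\<lambda>n. k * M n"]) (use M le lm in \<open>auto intro!: summable_mult simp del: mult_minus_left\<close>)
  qed
  have domd: "\<exists>M. summable M \<and> (\<forall>n. \<forall>t\<in>{0..T}. (d n t)\<^sup>2 \<le> M n)"
    and doms: "\<exists>M. summable M \<and> (\<forall>n. \<forall>t\<in>{0..T}. (- lam L n * b n t)\<^sup>2 \<le> M n)"
    and domq: "\<exists>M. summable M \<and> (\<forall>n. \<forall>t\<in>{0..T}. (- lam L n * a n t)\<^sup>2 \<le> M n)"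
    and domb: "\<exists>M. summable M \<and> (\<forall>n. \<forall>t\<in>{0..T}. (b n t)\<^sup>2 \<le> M n)" if "0 \<le> T" for T
    using dom4[OF that] by blast+
  have summ: "summable (\<lambda>n. (x n t)\<^sup>2)"
    if D: "\<And>T. 0 \<le> T \<Longrightarrow> \<exists>M. summable M \<and> (\<forall>n. \<forall>t\<in>{0..T}. (x n t)\<^sup>2 \<le> M n)" and t: "0 \<le> t" for x :: "nat \<Rightarrow> real \<Rightarrow> real" and t
  proof -
    obtain M where M: "summable M" "\<And>n. (x n t)\<^sup>2 \<le> M n" using D[OF t] t by auto
    show ?thesis by (rule summable_comparison_test'[OF M(1)]) (use M(2) in simp)
  qed
  \<comment> \<open>\<open>v\<close>, \<open>s\<close> and \<open>q\<close> are to become the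
    acceleration, u_xx and phi_xx. They are chosen for each time separately, with regularity in time
    recovered later from the coefficients.\<close>
  obtain v where v: "\<And>t. 0 \<le> t \<Longrightarrow> L2 L (v t)" "\<And>n t. 0 \<le> t \<Longrightarrow> ip L (v t) (ce L n) = d n t"
    using Fourier_function_exists[of d, OF summ[of d, OF domd]] by blast
  obtain s where s: "\<And>t. 0 \<le> t \<Longrightarrow> L2 L (s t)" "\<And>n t. 0 \<le> t \<Longrightarrow> ip L (s t) (ce L n) = - lam L n * b n t"
    using Fourier_function_exists[of "\<lambda>n t. - lam L n * b n t", OF summ[of "\<lambda>n t. - lam L n * b n t", OF doms]] by blast
  obtain q where q: "\<And>t. 0 \<le> t \<Longrightarrow> L2 L (q t)" "\<And>n t. 0 \<le> t \<Longrightarrow> ip L (q t) (ce L n) = - lam L n * a n t"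
    using Fourier_function_exists[of "\<lambda>n t. - lam L n * a n t", OF summ[of "\<lambda>n t. - lam L n * a n t", OF domq]] by blast
  define u where "u t = D2 L 0 (s t)" for t
  define A where "A t = - f t / sig" for t
  \<comment> \<open>The fourth derivative as the equation prescribes it: every other term is already
    an L2 function, so this one is too.\<close>
  define zf where "zf t x = (grav * hs * q t x + mu * s t x - kappa * u t x - v t x) / (sig * hs)" for t x
  define Q where "Q t = D2 L (A t) (zf t)" for t
  define \<phi> where "\<phi> t = D2 L 0 (Q t)" for t
  have L2u: "L2 L (u t)" if "0 \<le> t" for t
    unfolding u_def by (intro L2_continuous continuous_on_D2 L2_integrable s that)
  have L2z: "L2 L (zf t)" if "0 \<le> t" for t
    unfolding zf_def[abs_def] by (intro L2_divide L2_diff L2_add L2_cmult s q v L2u that)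
  have cQ: "continuous_on {0..L} (Q t)" if "0 \<le> t" for t
    unfolding Q_def by (intro continuous_on_D2 L2_integrable L2z that)
  have L2Q: "L2 L (Q t)" if "0 \<le> t" for t by (rule L2_continuous[OF cQ[OF that]])
  have ints: "integral {0..L} (s t) = 0" and ipu: "ip L (u t) (ce L n) = b n t" if "0 \<le> t" for t n
    using coeff_D2_eq[OF L s(1)[OF that], of 0 "\<lambda>n. b n t"] s(2)[OF that] z(2)[OF that] by (auto simp: u_def)
  \<comment> \<open>Inserting the oscillator equation cancels all damping and gravity terms. What
    remains is the coefficient of a second derivative with slope \<open>A t\<close> at both ends,
    for a function with coefficients - lam a.\<close>
  have ipz: "ip L (zf t) (ce L n) = A t * (ce L n L - ce L n 0) - lam L n * (- lam L n * a n t)" if t: "0 \<le> t" for t n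
  proof -
    let ?h = "\<lambda>x. grav * hs * q t x + mu * s t x - kappa * u t x - v t x"
    have "ip L (zf t) (ce L n) = (1 / (sig * hs)) * ip L ?h (ce L n)"
      using ip_cmult[of L "1 / (sig * hs)" ?h "ce L n"] by (simp add: zf_def[abs_def])
    also have "ip L ?h (ce L n) = grav * hs * (- lam L n * a n t) + mu * (- lam L n * b n t) - kappa * b n t - d n t"
      using q s v L2u ipu t by (simp add: ip_add ip_diff ip_cmult L2_add L2_diff L2_cmult L2_ce[OF L])
    also have "\<dots> = sig * hs * (A t * (ce L n L - ce L n 0) - lam L n * (- lam L n * a n t))"
      unfolding deq[OF t] A_def gam_def om_def bet_def using sig by (simp add: field_simps power2_eq_square)
    finally show ?thesis using sig hs by simp
  qed
  have intz: "integral {0..L} (zf t) = 0" and ipQ: "ip L (Q t) (ce L n) = - lam L n * a n t" if "0 \<le> t" for t n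
    using coeff_D2_eq[OF L L2z[OF that], of "A t" "\<lambda>n. - lam L n * a n t"] ipz[OF that] by (auto simp: Q_def lam_0)
  \<comment> \<open>Consistency: phi_xx obtained by integrating the fourth derivative twice agrees
    with phi_xx taken from the modes.\<close>
  have Qq: "AE x in lebesgue_on {0..L}. Q t x = q t x" if "0 \<le> t" for t
    by (rule ce_coeff_unique[OF L L2_integrable[OF L2Q[OF that]] L2_integrable[OF q(1)[OF that]]])
      (simp add: ipQ q that)
  have intQ: "integral {0..L} (Q t) = 0" and ip\<phi>: "ip L (\<phi> t) (ce L n) = a n t" if "0 \<le> t" for t n
    using coeff_D2_eq[OF L L2Q[OF that], of 0 "\<lambda>n. a n t"] ipQ[OF that] z(1)[OF that] by (auto simp: \<phi>_def)
  note C\<phi> = D2_chain[OF L L2Q, of _ "\<phi> _" 0]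
  note C\<phi>4 = D2_D2_chain[OF L L2z, of _ "\<phi> _" "A _"]
  note Cu = D2_chain[OF L s(1), of _ "u _" 0]
  have ae\<phi>: "AE x in lebesgue_on {0..L}. \<phi> t x = D2 L 0 (Q t) x" for t by (simp add: \<phi>_def)
  have ae\<phi>4: "AE x in lebesgue_on {0..L}. \<phi> t x = D2 L 0 (D2 L (A t) (zf t)) x" for t by (simp add: \<phi>_def Q_def)
  have aeu: "AE x in lebesgue_on {0..L}. u t x = D2 L 0 (s t) x" for t by (simp add: u_def)
  have bS\<phi>: "barS L (\<phi> t)" if "0 \<le> t" for t
    unfolding barS_def using C\<phi>(1,4,5)[OF that ae\<phi>] intQ[OF that] by simp
  have bSu: "barS L (u t)" if "0 \<le> t" for t
    unfolding barS_def using Cu(1,4,5)[OF that aeu] ints[OF that] by simp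
  have Feq: "B * \<xi> t + C * w t + ip L (u t) r + ip L (wd L (\<phi> t)) p = f t" if "0 \<le> t" for t
    using ip_r_sums[OF L2u[OF that]] barS_facts(4)[OF bS\<phi>[OF that]] feq[OF that]
    by (simp add: ipu[OF that] ip\<phi>[OF that] sums_iff)
  have L2\<phi>: "L2 L (\<phi> t)" if "0 \<le> t" for t by (rule barS_facts(1)[OF bS\<phi>[OF that]])
  have inx: "AE x in lebesgue_on {0..L}. x \<in> {0..L}" by (rule AE_I2) (simp add: space_restrict_space)
  have evnn: "\<forall>\<^sub>F s in at t within {0..}. s \<in> {0..}" for t :: real by (simp add: eventually_at_filter)
  have ints': "integrable (lebesgue_on {0..L}) (s t)" "integrable (lebesgue_on {0..L}) (zf t)" "integrable (lebesgue_on {0..L}) (Q t)"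
    if "0 \<le> t" for t using s L2z L2Q that by (auto intro: L2_integrable)
  have cb': "continuous_on {0..} (\<lambda>t. - lam L n * b n t)" and ca': "continuous_on {0..} (\<lambda>t. - lam L n * a n t)" for n
    by (intro continuous_intros ca cb)+
  have lim_s: "((\<lambda>\<tau>. l2norm L (\<lambda>x. s \<tau> x - s t x)) \<longlongrightarrow> 0) (at t within {0..})" if "0 \<le> t" for t
    by (rule l2norm_continuous_of_coeffs[OF L s cb' doms that])
  have lim_q: "((\<lambda>\<tau>. l2norm L (\<lambda>x. q \<tau> x - q t x)) \<longlongrightarrow> 0) (at t within {0..})" if "0 \<le> t" for t
    by (rule l2norm_continuous_of_coeffs[OF L q ca' domq that])
  have lim_u: "((\<lambda>\<tau>. l2norm L (\<lambda>x. u \<tau> x - u t x)) \<longlongrightarrow> 0) (at t within {0..})" if "0 \<le> t" for t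
    by (rule l2norm_continuous_of_coeffs[OF L L2u ipu cb domb that])
  have lim_v: "((\<lambda>\<tau>. l2norm L (\<lambda>x. v \<tau> x - v t x)) \<longlongrightarrow> 0) (at t within {0..})" if "0 \<le> t" for t
    by (rule l2norm_continuous_of_coeffs[OF L v cd domd that])
  have lim_z: "((\<lambda>\<tau>. l2norm L (\<lambda>x. zf \<tau> x - zf t x)) \<longlongrightarrow> 0) (at t within {0..})" if t: "0 \<le> t" for t
  proof (rule Lim_null_comparison)
    let ?k = "1 / (sig * hs)"
    let ?bd = "\<lambda>\<tau>. ?k * (grav * hs * l2norm L (\<lambda>x. q \<tau> x - q t x) + mu * l2norm L (\<lambda>x. s \<tau> x - s t x)
        + kappa * l2norm L (\<lambda>x. u \<tau> x - u t x) + l2norm L (\<lambda>x. v \<tau> x - v t x))"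
    have "(?bd \<longlongrightarrow> ?k * (grav * hs * 0 + mu * 0 + kappa * 0 + 0)) (at t within {0..})"
      by (intro tendsto_intros lim_s lim_q lim_u lim_v t)
    thus "(?bd \<longlongrightarrow> 0) (at t within {0..})" by simp
    show "\<forall>\<^sub>F \<tau> in at t within {0..}. norm (l2norm L (\<lambda>x. zf \<tau> x - zf t x)) \<le> ?bd \<tau>"
      using evnn
    proof eventually_elim
      case (elim \<tau>)
      let ?q = "\<lambda>x. grav * hs * (q \<tau> x - q t x)" and ?s = "\<lambda>x. mu * (s \<tau> x - s t x)"
        and ?u = "\<lambda>x. (- kappa) * (u \<tau> x - u t x)" and ?v = "\<lambda>x. (-1) * (v \<tau> x - v t x)"
      have \<tau>: "0 \<le> \<tau>" using elim by simp
      have l: "L2 L ?q" "L2 L ?s" "L2 L ?u" "L2 L ?v"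
        by (rule L2_cmult[OF L2_diff[OF q(1)[OF \<tau>] q(1)[OF t]]] L2_cmult[OF L2_diff[OF s(1)[OF \<tau>] s(1)[OF t]]]
          L2_cmult[OF L2_diff[OF L2u[OF \<tau>] L2u[OF t]]] L2_cmult[OF L2_diff[OF v(1)[OF \<tau>] v(1)[OF t]]])+
      have kabs: "\<bar>grav * hs\<bar> = grav * hs" "\<bar>mu\<bar> = mu" "\<bar>- kappa\<bar> = kappa" "\<bar>- 1 :: real\<bar> = 1" "\<bar>?k\<bar> = ?k"
        using grav hs mu kappa sig by (simp_all add: abs_mult)
      have n: "l2norm L ?q = grav * hs * l2norm L (\<lambda>x. q \<tau> x - q t x)" "l2norm L ?s = mu * l2norm L (\<lambda>x. s \<tau> x - s t x)"
        "l2norm L ?u = kappa * l2norm L (\<lambda>x. u \<tau> x - u t x)" "l2norm L ?v = l2norm L (\<lambda>x. v \<tau> x - v t x)"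
        using l2norm_cmult[of L "grav * hs" "\<lambda>x. q \<tau> x - q t x"] l2norm_cmult[of L mu "\<lambda>x. s \<tau> x - s t x"]
          l2norm_cmult[of L "- kappa" "\<lambda>x. u \<tau> x - u t x"] l2norm_cmult[of L "- 1" "\<lambda>x. v \<tau> x - v t x"]
        by (simp_all only: kabs mult_1_left)
      have "(\<lambda>x. zf \<tau> x - zf t x) = (\<lambda>x. ?k * ((?q x + ?s x) + (?u x + ?v x)))"
        using sig hs by (auto simp: zf_def fun_eq_iff field_simps)
      hence e: "l2norm L (\<lambda>x. zf \<tau> x - zf t x) = ?k * l2norm L (\<lambda>x. (?q x + ?s x) + (?u x + ?v x))"
        using l2norm_cmult[of L ?k "\<lambda>x. (?q x + ?s x) + (?u x + ?v x)"] by (simp only: kabs)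
      have "l2norm L (\<lambda>x. (?q x + ?s x) + (?u x + ?v x)) \<le> (l2norm L ?q + l2norm L ?s) + (l2norm L ?u + l2norm L ?v)"
        by (rule order_trans[OF l2norm_triangle[OF L2_add[OF l(1,2)] L2_add[OF l(3,4)]]
            add_mono[OF l2norm_triangle[OF l(1,2)] l2norm_triangle[OF l(3,4)]]])
      hence "l2norm L (\<lambda>x. (?q x + ?s x) + (?u x + ?v x)) \<le> grav * hs * l2norm L (\<lambda>x. q \<tau> x - q t x)
        + mu * l2norm L (\<lambda>x. s \<tau> x - s t x) + kappa * l2norm L (\<lambda>x. u \<tau> x - u t x) + l2norm L (\<lambda>x. v \<tau> x - v t x)"
        unfolding n by (simp only: add.assoc)
      hence "l2norm L (\<lambda>x. zf \<tau> x - zf t x) \<le> ?bd \<tau>"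
        unfolding e by (rule mult_left_mono) (use sig hs in simp)
      thus ?case by (simp only: real_norm_def abs_of_nonneg[OF l2norm_nonneg])
    qed
  qed
  have lim_A: "((\<lambda>\<tau>. \<bar>A \<tau> - A t\<bar>) \<longlongrightarrow> 0) (at t within {0..})" if "0 \<le> t" for t
  proof -
    have "continuous_on {0..} A" unfolding A_def[abs_def] using sig by (intro continuous_intros cf) auto
    hence "(A \<longlongrightarrow> A t) (at t within {0..})" using that by (auto simp: continuous_on_def)
    thus ?thesis by (simp add: LIM_zero_iff tendsto_rabs_zero_iff)
  qed
  obtain K4 where K4: "0 \<le> K4" "\<And>f A z. L2 L z \<Longrightarrow> AE x in lebesgue_on {0..L}. f x = D2 L 0 (D2 L A z) x \<Longrightarrow>
    hknorm L 4 f \<le> K4 * (\<bar>A\<bar> + l2norm L z)"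
    using hknorm_4_bound[OF L] by blast
  obtain K2 where K2: "0 \<le> K2" "\<And>f s. L2 L s \<Longrightarrow> AE x in lebesgue_on {0..L}. f x = D2 L 0 s x \<Longrightarrow> hknorm L 2 f \<le> K2 * l2norm L s"
    using hknorm_2_bound[OF L] by blast
  have hk_nonneg: "0 \<le> hknorm L k g" for k g unfolding hknorm_def by (simp add: sum_nonneg)
  have c1: "cont_in (hknorm L 4) \<phi>"
    unfolding cont_in_def
  proof (intro allI impI)
    fix t :: real assume t: "0 \<le> t"
    show "((\<lambda>\<tau>. hknorm L 4 (\<lambda>x. \<phi> \<tau> x - \<phi> t x)) \<longlongrightarrow> 0) (at t within {0..})"
    proof (rule Lim_null_comparison)
      have "((\<lambda>\<tau>. K4 * (\<bar>A \<tau> - A t\<bar> + l2norm L (\<lambda>x. zf \<tau> x - zf t x))) \<longlongrightarrow> K4 * (0 + 0)) (at t within {0..})"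
        by (intro tendsto_intros lim_A lim_z t)
      thus "((\<lambda>\<tau>. K4 * (\<bar>A \<tau> - A t\<bar> + l2norm L (\<lambda>x. zf \<tau> x - zf t x))) \<longlongrightarrow> 0) (at t within {0..})" by simp
      show "\<forall>\<^sub>F \<tau> in at t within {0..}. norm (hknorm L 4 (\<lambda>x. \<phi> \<tau> x - \<phi> t x)) \<le> K4 * (\<bar>A \<tau> - A t\<bar> + l2norm L (\<lambda>x. zf \<tau> x - zf t x))"
        using evnn
      proof eventually_elim
        case (elim \<tau>)
        hence \<tau>: "0 \<le> \<tau>" by simp
        \<comment> \<open>By linearity of the double primitives the increment of phi is again a
          reconstruction, from the increments of \<open>A\<close> and \<open>zf\<close>, so the H4
          bound applies to it.\<close>
        have pt: "\<phi> \<tau> x - \<phi> t x = D2 L 0 (D2 L (A \<tau> - A t) (\<lambda>x. zf \<tau> x - zf t x)) x" if x: "x \<in> {0..L}" for x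
        proof -
          have "\<phi> \<tau> x - \<phi> t x = D2 L 0 (\<lambda>x. Q \<tau> x - Q t x) x"
            using D2_diff[OF ints'(3)[OF \<tau>] ints'(3)[OF t] x, of 0 0] by (simp add: \<phi>_def)
          also have "\<dots> = D2 L 0 (D2 L (A \<tau> - A t) (\<lambda>x. zf \<tau> x - zf t x)) x"
            by (rule D2_cong[OF L _ x]) (simp only: Q_def D2_diff[OF ints'(2)[OF \<tau>] ints'(2)[OF t]])
          finally show ?thesis .
        qed
        have "AE x in lebesgue_on {0..L}. \<phi> \<tau> x - \<phi> t x = D2 L 0 (D2 L (A \<tau> - A t) (\<lambda>x. zf \<tau> x - zf t x)) x"
          using inx by eventually_elim (rule pt)
        from K4(2)[OF L2_diff[OF L2z[OF \<tau>] L2z[OF t]] this] show ?case using hk_nonneg by simp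
      qed
    qed
  qed
  have c2: "cont_in (hknorm L 2) u"
    unfolding cont_in_def
  proof (intro allI impI)
    fix t :: real assume t: "0 \<le> t"
    show "((\<lambda>\<tau>. hknorm L 2 (\<lambda>x. u \<tau> x - u t x)) \<longlongrightarrow> 0) (at t within {0..})"
    proof (rule Lim_null_comparison)
      show "((\<lambda>\<tau>. K2 * l2norm L (\<lambda>x. s \<tau> x - s t x)) \<longlongrightarrow> 0) (at t within {0..})"
        using tendsto_mult_right[OF lim_s[OF t], of K2] by (simp add: mult.commute)
      show "\<forall>\<^sub>F \<tau> in at t within {0..}. norm (hknorm L 2 (\<lambda>x. u \<tau> x - u t x)) \<le> K2 * l2norm L (\<lambda>x. s \<tau> x - s t x)"
        using evnn
      proof eventually_elim
        case (elim \<tau>)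
        hence \<tau>: "0 \<le> \<tau>" by simp
        have "AE x in lebesgue_on {0..L}. u \<tau> x - u t x = D2 L 0 (\<lambda>x. s \<tau> x - s t x) x"
          using inx
        proof eventually_elim
          case (elim x)
          thus ?case using D2_diff[OF ints'(1)[OF \<tau>] ints'(1)[OF t] elim, of 0 0] by (simp add: u_def)
        qed
        from K2(2)[OF L2_diff[OF s(1)[OF \<tau>] s(1)[OF t]] this] show ?case using hk_nonneg by simp
      qed
    qed
  qed
  have c3: "cont_in (hknorm L 0) v" unfolding cont_in_def hknorm_0 using lim_v by blast
  have t2: "tderiv_in (hknorm L 0) u v"
    unfolding tderiv_in_def hknorm_0
    using l2norm_derivative_of_coeffs[OF L L2u v(1) ipu v(2) db domd] by blast
  have t1: "tderiv_in (hknorm L 2) \<phi> u"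
    unfolding tderiv_in_def
  proof (intro allI impI)
    fix t :: real assume t: "0 \<le> t"
    have lim: "((\<lambda>\<tau>. l2norm L (\<lambda>x. (Q \<tau> x - Q t x) / (\<tau> - t) - s t x)) \<longlongrightarrow> 0) (at t within {0..})"
      by (rule l2norm_derivative_of_coeffs[OF L L2Q s(1) ipQ s(2) DERIV_cmult[OF da] doms t])
    show "((\<lambda>\<tau>. hknorm L 2 (\<lambda>x. (\<phi> \<tau> x - \<phi> t x) / (\<tau> - t) - u t x)) \<longlongrightarrow> 0) (at t within {0..})"
    proof (rule Lim_null_comparison)
      show "((\<lambda>\<tau>. K2 * l2norm L (\<lambda>x. (Q \<tau> x - Q t x) / (\<tau> - t) - s t x)) \<longlongrightarrow> 0) (at t within {0..})"
        using tendsto_mult_right[OF lim, of K2] by (simp add: mult.commute)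
      show "\<forall>\<^sub>F \<tau> in at t within {0..}. norm (hknorm L 2 (\<lambda>x. (\<phi> \<tau> x - \<phi> t x) / (\<tau> - t) - u t x))
          \<le> K2 * l2norm L (\<lambda>x. (Q \<tau> x - Q t x) / (\<tau> - t) - s t x)"
        using evnn
      proof eventually_elim
        case (elim \<tau>)
        hence \<tau>: "0 \<le> \<tau>" by simp
        have l: "L2 L (\<lambda>x. (Q \<tau> x - Q t x) / (\<tau> - t))" by (intro L2_divide L2_diff L2Q \<tau> t)
        have "AE x in lebesgue_on {0..L}. (\<phi> \<tau> x - \<phi> t x) / (\<tau> - t) - u t x = D2 L 0 (\<lambda>x. (Q \<tau> x - Q t x) / (\<tau> - t) - s t x) x"
          using inx
        proof eventually_elim
          case (elim x)
          have "D2 L 0 (\<lambda>x. (Q \<tau> x - Q t x) / (\<tau> - t) - s t x) x = D2 L 0 (\<lambda>x. (Q \<tau> x - Q t x) / (\<tau> - t)) x - u t x"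
            using D2_diff[OF L2_integrable[OF l] ints'(1)[OF t] elim, of 0 0] by (simp add: u_def)
          also have "D2 L 0 (\<lambda>x. (Q \<tau> x - Q t x) / (\<tau> - t)) x = (\<phi> \<tau> x - \<phi> t x) / (\<tau> - t)"
            \<comment> \<open>Linearity with the scalars 1 / (\<tau> - t) and its negative; \<tau> =
              t is no exception because division by 0 gives 0.\<close>
            using D2_lincomb[OF ints'(3)[OF \<tau>] ints'(3)[OF t] elim, of "1 / (\<tau> - t)" 0 "- 1 / (\<tau> - t)" 0]
            by (simp add: \<phi>_def diff_divide_distrib)
          finally show ?case ..
        qed
        from K2(2)[OF L2_diff[OF l s(1)[OF t]] this] show ?case using hk_nonneg by simp
      qed
    qed
  qed
  have pde: "AE x in lebesgue_on {0..L}. v t x = (sqrt (grav * hs))\<^sup>2 * (wd L ^^ 2) (\<phi> t) x - sig * hs * (wd L ^^ 4) (\<phi> t) x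
                      + mu * (wd L ^^ 2) (u t) x - kappa * u t x" if t: "0 \<le> t" for t
    using C\<phi>(3)[OF t ae\<phi>] C\<phi>4(2)[OF t ae\<phi>4] Cu(3)[OF t aeu] Qq[OF t]
  proof eventually_elim
    case (elim x)
    have "sig * hs * zf t x = grav * hs * q t x + mu * s t x - kappa * u t x - v t x"
      using sig hs by (simp add: zf_def)
    thus ?case using elim grav hs by simp
  qed
  have i1: "AE x in lebesgue_on {0..L}. \<phi> 0 x = \<phi>0 x"
    by (rule ce_coeff_unique[OF L L2_integrable[OF L2\<phi>] L2_integrable[OF l\<phi>(1)]]) (simp_all add: ip\<phi> init a0_def)
  have i2: "AE x in lebesgue_on {0..L}. u 0 x = u0 x"
    by (rule ce_coeff_unique[OF L L2_integrable[OF L2u] L2_integrable[OF lu(1)]]) (simp_all add: ipu init b0_def)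
  have m: "mean0 L (\<phi> t)" "mean0 L (u t)" if "0 \<le> t" for t
    using mean0_iff[OF L] ip\<phi>[OF that, of 0] ipu[OF that, of 0] z[OF that] by simp_all
  have b3: "bval L ((wd L ^^ 3) (\<phi> t)) 0 = - f t / sig" "bval L ((wd L ^^ 3) (\<phi> t)) L = - f t / sig" if "0 \<le> t" for t
    using C\<phi>4(3,4)[OF that ae\<phi>4] intz[OF that] by (simp_all add: A_def)
  have cF: "continuous_on {0..} (\<lambda>t. B * \<xi> t + C * w t + ip L (u t) r + ip L (wd L (\<phi> t)) p)"
    using cf by (rule continuous_on_eq) (simp add: Feq)
  have "is_sol L hs grav mu sig kappa B C r p \<xi>0 w0 \<phi>0 u0 \<phi> \<xi> w"
    unfolding is_sol_def Let_def
  proof (rule exI[of _ u], rule exI[of _ v], intro conjI allI impI)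
    fix t :: real assume t: "0 \<le> t"
    show "barS L (\<phi> t)" by (rule bS\<phi>[OF t])
    show "inHk L 4 (\<phi> t)" by (rule C\<phi>4(1)[OF t ae\<phi>4])
    show "barS L (u t)" by (rule bSu[OF t])
    show "L2 L (v t)" by (rule v(1)[OF t])
    show "(\<xi> has_real_derivative w t) (at t within {0..})" by (rule d\<xi>[OF t])
    show "(w has_real_derivative - (B * \<xi> t + C * w t + ip L (u t) r + ip L (wd L (\<phi> t)) p)) (at t within {0..})"
      unfolding Feq[OF t] by (rule dw[OF t])
    show "AE x in lebesgue_on {0..L}. v t x = (sqrt (grav * hs))\<^sup>2 * (wd L ^^ 2) (\<phi> t) x - sig * hs * (wd L ^^ 4) (\<phi> t) x
                      + mu * (wd L ^^ 2) (u t) x - kappa * u t x" by (rule pde[OF t])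
    show "bval L (wd L (\<phi> t)) 0 = 0" "bval L (wd L (\<phi> t)) L = 0" using bS\<phi>[OF t] by (simp_all add: barS_def)
    show "bval L ((wd L ^^ 3) (\<phi> t)) 0 = - (B * \<xi> t + C * w t + ip L (u t) r + ip L (wd L (\<phi> t)) p) / sig"
      "bval L ((wd L ^^ 3) (\<phi> t)) L = - (B * \<xi> t + C * w t + ip L (u t) r + ip L (wd L (\<phi> t)) p) / sig"
      unfolding Feq[OF t] by (rule b3[OF t])+
    show "mean0 L (\<phi> t)" "mean0 L (u t)" by (rule m[OF t])+
  qed (fact c1 t1 c2 t2 c3 cF init i1 i2)+
  thus ?thesis by blast
qed

end

theorem theorem6:
  fixes L hs grav mu sig kappa B C :: real and r p :: "real \<Rightarrow> real"
  assumes "L > 0" "hs > 0" "grav > 0" "mu > 0" "sig > 0" "kappa \<ge> 0"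
    and "continuous_on {0..L} r" "continuous_on {0..L} p"
    and "ip L (gt L) r \<ge> 12 * L^4 / pi^4 * sqrt (2 / L) *
           (\<Sum>k. \<bar>ip L (phin L (2*k+1)) r\<bar> / (real (2*k+1))^4)"
    and "ip L (deriv (gt L)) p \<ge> 12 * L^4 / pi^4 * sqrt (2 / L) *
           (\<Sum>k. \<bar>ip L (deriv (phin L (2*k+1))) p\<bar> / (real (2*k+1))^4)"
  shows "\<forall>\<xi>0 w0 \<phi>0 u0.
           barS L \<phi>0 \<and> inHk L 4 \<phi>0 \<and> barS L u0 \<and> mean0 L \<phi>0 \<and> mean0 L u0
           \<and> bval L ((wd L ^^ 3) \<phi>0) 0 = - (B * \<xi>0 + C * w0 + ip L u0 r + ip L (wd L \<phi>0) p) / sig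
           \<and> bval L ((wd L ^^ 3) \<phi>0) L = - (B * \<xi>0 + C * w0 + ip L u0 r + ip L (wd L \<phi>0) p) / sig
         \<longrightarrow> (\<exists>\<phi> \<xi> w. is_sol L hs grav mu sig kappa B C r p \<xi>0 w0 \<phi>0 u0 \<phi> \<xi> w)
           \<and> (\<forall>\<phi>1 \<xi>1 w1 \<phi>2 \<xi>2 w2.
                is_sol L hs grav mu sig kappa B C r p \<xi>0 w0 \<phi>0 u0 \<phi>1 \<xi>1 w1
              \<and> is_sol L hs grav mu sig kappa B C r p \<xi>0 w0 \<phi>0 u0 \<phi>2 \<xi>2 w2
              \<longrightarrow> (\<forall>t\<ge>0. \<xi>1 t = \<xi>2 t \<and> w1 t = w2 t
                          \<and> (AE x in lebesgue_on {0..L}. \<phi>1 t x = \<phi>2 t x)))"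
proof -
  interpret sloshing L hs grav mu sig kappa B C r p
    by (rule sloshing.intro) (use assms in auto)
  show ?thesis
  proof (intro allI impI conjI, goal_cases)
    case (1 \<xi>0 w0 \<phi>0 u0)
    thus ?case by (elim conjE) (rule sol_exists)
  next
    case (2 \<xi>0 w0 \<phi>0 u0 \<phi>1 \<xi>1 w1 \<phi>2 \<xi>2 w2 t)
    thus ?case using sol_unique(1) by blast
  next
    case (3 \<xi>0 w0 \<phi>0 u0 \<phi>1 \<xi>1 w1 \<phi>2 \<xi>2 w2 t)
    thus ?case using sol_unique(2) by blast
  next
    case (4 \<xi>0 w0 \<phi>0 u0 \<phi>1 \<xi>1 w1 \<phi>2 \<xi>2 w2 t)
    thus ?case using sol_unique(3) by blast
  qed
qed

end
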